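(* Let $(R,B(i),L)$, $i=1,\dots,N$, be Hadamard triples on $\mathbb{R}^d$ with $\#B(i)=M$ for all $i$, and let $(\mathbf{R},\mathbf{B},\mathbf{L})$ be a triple in quasi-product form on $\mathbb{R}^{r+d}$ associated with $(R,B(i),L)$, $i=1,\dots,N$, with first component $(R_1,B_1,L_1)$. Let $\mu_1=\mu_{R_1,B_1}$ be the self-affine measure of $(R_1,B_1)$, let $\Lambda_1$ be a spectrum for $\mu_1$, and let $\Lambda_2$ be a subset of $\mathbb{R}^d$. Then $\Lambda_1\times\Lambda_2$ is a spectrum for $\mu_{\mathbf{R},\mathbf{B}}$ if and only if $\Lambda_2$ is a spectrum for $\mu_\omega$ for $\mathbb{P}$-almost every $\omega\in\{1,\dots,N\}^{\mathbb{N}}$.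
   Context: Hadamard triple on $\mathbb{R}^d$: $R\in M_d(\mathbb{Z})$ is expansive (all eigenvalues have modulus $>1$), $B,L\subset\mathbb{Z}^d$ are finite with $0\in B\cap L$ and $\#B=\#L=N'$, and the matrix $\frac{1}{\sqrt{N'}}\left[e^{2\pi i\langle R^{-1}b,\ell\rangle}\right]_{\ell\in L,b\in B}$ is unitary. For a finite set $A$, $\delta_A=\frac{1}{\#A}\sum_{a\in A}\delta_a$. The self-affine measure of a pair $(R,B)$ is the infinite convolution $\mu_{R,B}=\delta_{R^{-1}B}\ast\delta_{R^{-2}B}\ast\cdots$. For $\omega=\omega_1\omega_2\cdots\in\{1,\dots,N\}^{\mathbb{N}}$, $$\mu_\omega=\delta_{R^{-1}B(\omega_1)}\ast\delta_{R^{-2}B(\omega_2)}\ast\cdots.$$ $\mathbb{P}$ is the product probability measure on $\{1,\dots,N\}^{\mathbb{N}}$ giving each symbol probability $1/N$ in each coordinate. Quasi-product form: $(\mathbf{R},\mathbf{B},\mathbf{L})$ is in quasi-product form associated with $(R,B(i),L)$, $i=1,\dots,N$, if $$\mathbf{R}=\begin{bmatrix}R_1&0\\C&R\end{bmatrix},\quad R_1\in M_r(\mathbb{Z}),\ C\in M_{d,r}(\mathbb{Z}),\qquad \mathbf{B}=\left\{\begin{bmatrix}a_i\\d_{i,j}\end{bmatrix}:1\le i\le N,\ d_{i,j}\in B(i)\right\},$$ where $a_1,\dots,a_N\in\mathbb{Z}^r$ are pairwise distinct, $B(i)=\{d_{i,j}:1\le j\le M\}$, $a_1=0$ and $d_{i,1}=0$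 for all $i$; $\mathbf{L}=L_1\times L$ with $L_1\subset\mathbb{Z}^r$; and $(R_1,B_1,L_1)$ with $B_1=\{a_i:1\le i\le N\}$ is a Hadamard triple on $\mathbb{R}^r$. A countable set $\Lambda\subset\mathbb{R}^m$ is a spectrum for a Borel probability measure $\nu$ on $\mathbb{R}^m$ if $\{e^{2\pi i\langle\lambda,x\rangle}:\lambda\in\Lambda\}$ is an orthonormal basis of $L^2(\nu)$. *)

theory Defs
  imports "HOL-Probability.Probability"
begin

definition vec_of_int :: "int ^ 'n \<Rightarrow> real ^ 'n" where
  "vec_of_int v = (\<chi> i. of_int (v $ i))"

subsection \<open>Hadamard triples\<close>

definition expansive :: "int ^ 'n ^ 'n \<Rightarrow> bool" where
  "expansive R \<longleftrightarrow>
     (\<forall>(z::complex) v. v \<noteq> 0 \<and> map_matrix of_int R *v v = z *s v \<longrightarrow> cmod z > 1)"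

text \<open>Rows and columns are indexed by two different finite sets, so both
  \<open>U U\<^sup>* = 1\<close> and \<open>U\<^sup>* U = 1\<close> are required.\<close>

definition unitary_on :: "'i set \<Rightarrow> 'j set \<Rightarrow> ('i \<Rightarrow> 'j \<Rightarrow> complex) \<Rightarrow> bool" where
  "unitary_on I J U \<longleftrightarrow>
     (\<forall>i\<in>I. \<forall>i'\<in>I. (\<Sum>j\<in>J. U i j * cnj (U i' j)) = of_bool (i = i')) \<and>
     (\<forall>j\<in>J. \<forall>j'\<in>J. (\<Sum>i\<in>I. cnj (U i j) * U i j') = of_bool (j = j'))"

definition hadamard_triple ::
  "int ^ 'n ^ 'n \<Rightarrow> (int ^ 'n) set \<Rightarrow> (int ^ 'n) set \<Rightarrow> bool" where
  "hadamard_triple R B L \<longleftrightarrow>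
     expansive R \<and> finite B \<and> finite L \<and> 0 \<in> B \<inter> L \<and> card B = card L \<and>
     unitary_on L B
       (\<lambda>l b. of_real (1 / sqrt (real (card B))) *
          cis (2 * pi * ((matrix_inv (map_matrix of_int R) *v vec_of_int b) \<bullet> vec_of_int l)))"

subsection \<open>Infinite convolutions\<close>

definition uniform_point_measure :: "'a::euclidean_space set \<Rightarrow> 'a measure" where
  "uniform_point_measure A = distr (uniform_count_measure A) borel (\<lambda>x. x)"

definition weakly_converges :: "(nat \<Rightarrow> 'a::euclidean_space measure) \<Rightarrow> 'a measure \<Rightarrow> bool" where
  "weakly_converges \<nu> \<mu> \<longleftrightarrow>
     (\<forall>f :: 'a \<Rightarrow> real. continuous_on UNIV f \<and> bounded (range f) \<longrightarrow>
        (\<lambda>n. integral\<^sup>L (\<nu> n) f) \<longlonglongrightarrow> integral\<^sup>L \<mu> f)"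

primrec partial_convolution ::
  "(nat \<Rightarrow> 'a::ordered_euclidean_space measure) \<Rightarrow> nat \<Rightarrow> 'a measure" where
  "partial_convolution \<nu> 0 = return borel 0"
| "partial_convolution \<nu> (Suc n) = convolution (partial_convolution \<nu> n) (\<nu> n)"

text \<open>The weak limit of the partial convolutions. It is unique if it exists, and it exists
  for the measures below because the matrix is expansive and the digits are bounded.\<close>

definition infinite_convolution ::
  "(nat \<Rightarrow> 'a::ordered_euclidean_space measure) \<Rightarrow> 'a measure" where
  "infinite_convolution \<nu> =
     (THE \<mu>. prob_space \<mu> \<and> sets \<mu> = sets borel \<and>
        weakly_converges (partial_convolution \<nu>) \<mu>)"

text \<open>The set \<open>R\<^sup>-\<^sup>k B\<close>. The inverse is iterated as a linear map because \<open>A ^ k\<close> on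
  the type of matrices is the componentwise power.\<close>

definition scaled_digits :: "int ^ 'n ^ 'n \<Rightarrow> nat \<Rightarrow> (int ^ 'n) set \<Rightarrow> (real ^ 'n) set" where
  "scaled_digits R k B =
     (\<lambda>b. (((*v) (matrix_inv (map_matrix of_int R))) ^^ k) (vec_of_int b)) ` B"

definition self_affine_measure :: "int ^ 'n ^ 'n \<Rightarrow> (int ^ 'n) set \<Rightarrow> (real ^ 'n) measure" where
  "self_affine_measure R B =
     infinite_convolution (\<lambda>k. uniform_point_measure (scaled_digits R (Suc k) B))"

text \<open>Sequences are indexed from \<open>0\<close>, so \<open>\<omega> k\<close> is the symbol \<open>\<omega>\<^sub>k\<^sub>+\<^sub>1\<close>.\<close>

definition random_convolution ::
  "int ^ 'n ^ 'n \<Rightarrow> (nat \<Rightarrow> (int ^ 'n) set) \<Rightarrow> (nat \<Rightarrow> nat) \<Rightarrow> (real ^ 'n) measure" where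
  "random_convolution R B \<omega> =
     infinite_convolution (\<lambda>k. uniform_point_measure (scaled_digits R (Suc k) (B (\<omega> k))))"

definition symbol_measure :: "nat \<Rightarrow> (nat \<Rightarrow> nat) measure" where
  "symbol_measure N = PiM UNIV (\<lambda>_. uniform_count_measure {1..N})"

subsection \<open>Quasi-product form\<close>

text \<open>Vectors of dimension \<open>r + d\<close> are indexed by the sum type, the first \<open>r\<close> coordinates
  being those in the left summand.\<close>

definition block_vec :: "'a ^ 'r \<Rightarrow> 'a ^ 'd \<Rightarrow> 'a ^ ('r + 'd)" where
  "block_vec x y = (\<chi> k. case k of Inl p \<Rightarrow> x $ p | Inr q \<Rightarrow> y $ q)"

definition block_Times :: "('a ^ 'r) set \<Rightarrow> ('a ^ 'd) set \<Rightarrow> ('a ^ ('r + 'd)) set" where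
  "block_Times X Y = {block_vec x y | x y. x \<in> X \<and> y \<in> Y}"

definition lower_block_matrix ::
  "'a::zero ^ 'r ^ 'r \<Rightarrow> 'a ^ 'r ^ 'd \<Rightarrow> 'a ^ 'd ^ 'd \<Rightarrow> 'a ^ ('r + 'd) ^ ('r + 'd)" where
  "lower_block_matrix R\<^sub>1 C R =
     (\<chi> k. case k of Inl p \<Rightarrow> block_vec (R\<^sub>1 $ p) 0 | Inr q \<Rightarrow> block_vec (C $ q) (R $ q))"

definition quasi_product_form ::
  "int ^ ('r + 'd) ^ ('r + 'd) \<Rightarrow> (int ^ ('r + 'd)) set \<Rightarrow> (int ^ ('r + 'd)) set \<Rightarrow>
   nat \<Rightarrow> nat \<Rightarrow> int ^ 'd ^ 'd \<Rightarrow> (nat \<Rightarrow> (int ^ 'd) set) \<Rightarrow> (int ^ 'd) set \<Rightarrow>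
   int ^ 'r ^ 'r \<Rightarrow> (int ^ 'r) set \<Rightarrow> (int ^ 'r) set \<Rightarrow> bool" where
  "quasi_product_form RR BB LL N M R B L R\<^sub>1 B\<^sub>1 L\<^sub>1 \<longleftrightarrow>
     (\<exists>C a d.
        RR = lower_block_matrix R\<^sub>1 C R \<and>
        inj_on a {1..N} \<and> a 1 = 0 \<and> B\<^sub>1 = a ` {1..N} \<and>
        (\<forall>i\<in>{1..N}. B i = d i ` {1..M} \<and> d i 1 = 0) \<and>
        BB = {block_vec (a i) (d i j) | i j. i \<in> {1..N} \<and> j \<in> {1..M}} \<and>
        LL = block_Times L\<^sub>1 L \<and>
        hadamard_triple R\<^sub>1 B\<^sub>1 L\<^sub>1)"

subsection \<open>Spectra\<close>

text \<open>Orthonormal families in the complex Hilbert space \<open>L\<^sup>2(\<nu>)\<close> with dense linear span;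
  elements of \<open>L\<^sup>2(\<nu>)\<close> are represented by square-integrable functions.\<close>

definition square_integrable :: "'a measure \<Rightarrow> ('a \<Rightarrow> complex) \<Rightarrow> bool" where
  "square_integrable \<nu> f \<longleftrightarrow>
     f \<in> borel_measurable \<nu> \<and> integrable \<nu> (\<lambda>x. (cmod (f x))\<^sup>2)"

definition orthonormal_basis_L2 :: "'a measure \<Rightarrow> 'i set \<Rightarrow> ('i \<Rightarrow> 'a \<Rightarrow> complex) \<Rightarrow> bool" where
  "orthonormal_basis_L2 \<nu> I e \<longleftrightarrow>
     (\<forall>i\<in>I. square_integrable \<nu> (e i)) \<and>
     (\<forall>i\<in>I. \<forall>j\<in>I. (LINT x|\<nu>. e i x * cnj (e j x)) = of_bool (i = j)) \<and>
     (\<forall>f. square_integrable \<nu> f \<longrightarrow>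
        (\<forall>\<epsilon>>0. \<exists>F c. finite F \<and> F \<subseteq> I \<and>
           sqrt (LINT x|\<nu>. (cmod (f x - (\<Sum>i\<in>F. c i * e i x)))\<^sup>2) < \<epsilon>))"

definition is_spectrum :: "'a::euclidean_space set \<Rightarrow> 'a measure \<Rightarrow> bool" where
  "is_spectrum \<Lambda> \<nu> \<longleftrightarrow>
     countable \<Lambda> \<and> orthonormal_basis_L2 \<nu> \<Lambda> (\<lambda>\<xi> x. cis (2 * pi * (\<xi> \<bullet> x)))"

end

theory Submission
  imports Defs "HOL-Computational_Algebra.Fundamental_Theorem_Algebra"
begin

text \<open>For a probability measure \<open>\<nu>\<close> of bounded support, \<open>\<Lambda>\<close> is a spectrum if and only if
  \<open>S\<^sub>\<nu>(\<xi>) = \<Sum>\<^sub>\<lambda> |\<nu>^(\<xi> - \<lambda>)|\<^sup>2\<close> equals \<open>1\<close> for all \<open>\<xi>\<close> (Jorgensen--Pedersen), and it is enough to know this for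
  \<open>\<xi>\<close> in \<open>\<Lambda>\<close> and in a dense set. The self-affine measure of the block matrix is the law of
  \<open>(F \<omega>, H \<omega> + Y \<omega> \<eta>)\<close>, where \<open>F\<close> is the coding map of the first component and \<open>Y \<omega>\<close> has law \<open>\<mu>\<^sub>\<omega>\<close>.
  The map \<open>F\<close> is almost surely injective, so a spectrum \<open>\<Lambda>\<^sub>1\<close> of the first component satisfies Parseval's
  identity on the whole of \<open>L\<^sup>2\<close> of the symbol space, and hence
  \<open>S\<^sub>\<mu>(\<xi>\<^sub>1, \<xi>\<^sub>2)\<close> is the expectation of \<open>S\<^bsub>\<mu>_\<omega>\<^esub>(\<xi>\<^sub>2)\<close>, whatever \<open>\<xi>\<^sub>1\<close> is. If it is \<open>1\<close> at all
  \<open>\<xi>\<^sub>2 \<in> \<Lambda>\<^sub>2\<close>, where the integrand is at least \<open>1\<close>, then \<open>\<Lambda>\<^sub>2\<close> is almost surely orthogonal; by Bessel's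
  inequality the integrand is then at most \<open>1\<close> everywhere, hence almost surely equal to \<open>1\<close> on a countable
  dense set.

  For the injectivity of \<open>F\<close>, apply \<open>R\<^sub>1\<^sup>m\<close> to \<open>F \<omega>\<close> and subtract the integer vector
  belonging to a word \<open>I\<close> of length \<open>m\<close>. The digits are distinct modulo \<open>R\<^sub>1\<close>, so different words give
  different points of one translate of the integer lattice, and the number of words whose point lies in a fixed
  ball is bounded in \<open>m\<close>. If another code of \<open>F \<omega>\<close> had a different first letter with positive
  probability, the expectation of this number would tend to infinity.\<close>

subsection \<open>Powers of the inverse of an expansive matrix\<close>

text \<open>This is p(A) v. Powers are iterates of the linear map, since \<open>A ^ k\<close> would
  be the componentwise power, and the vector is an argument because it is enough to annihilate one
  vector at a time.\<close>

definition mat_poly :: "complex ^ 'n ^ 'n \<Rightarrow> complex poly \<Rightarrow> complex ^ 'n \<Rightarrow> complex ^ 'n" where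
  "mat_poly A p v = (\<Sum>k\<le>degree p. coeff p k *s (((*v) A) ^^ k) v)"

lemma mat_poly_altdef:
  assumes "degree p \<le> m"
  shows "mat_poly A p v = (\<Sum>k\<le>m. coeff p k *s (((*v) A) ^^ k) v)"
  unfolding mat_poly_def
  by (rule sum.mono_neutral_left) (use assms in \<open>auto simp: coeff_eq_0\<close>)

lemma mat_poly_add: "mat_poly A (p + q) v = mat_poly A p v + mat_poly A q v"
proof -
  let ?m = "max (degree p) (degree q)"
  have "degree (p + q) \<le> ?m" by (rule degree_add_le_max)
  then show ?thesis
    by (simp add: mat_poly_altdef[of _ ?m] sum.distrib vec.scale_left_distrib)
qed

lemma mat_poly_smult: "mat_poly A (smult c p) v = c *s mat_poly A p v"
proof -
  have "mat_poly A (smult c p) v = (\<Sum>k\<le>degree p. coeff (smult c p) k *s (((*v) A) ^^ k) v)"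
    by (rule mat_poly_altdef) (rule degree_smult_le)
  then show ?thesis by (simp add: mat_poly_def vec.scale_sum_right)
qed

lemma mat_poly_shift: "mat_poly A (pCons 0 p) v = A *v mat_poly A p v"
proof -
  have "mat_poly A (pCons 0 p) v
      = (\<Sum>k\<le>Suc (degree p). coeff (pCons 0 p) k *s (((*v) A) ^^ k) v)"
    by (rule mat_poly_altdef) (simp add: degree_pCons_le)
  also have "\<dots> = (\<Sum>k\<le>degree p. coeff p k *s (A *v (((*v) A) ^^ k) v))"
    by (subst sum.atMost_Suc_shift) simp
  also have "\<dots> = A *v mat_poly A p v"
    by (simp add: mat_poly_def vec.sum vec.scale)
  finally show ?thesis .
qed

lemma funpow_matrix_add:
  fixes A :: "'a::field ^ 'n ^ 'n"
  shows "(((*v) A) ^^ k) (x + y) = (((*v) A) ^^ k) x + (((*v) A) ^^ k) y"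
  by (induction k) (simp_all add: matrix_vector_right_distrib)

lemma funpow_matrix_scale:
  fixes A :: "'a::field ^ 'n ^ 'n"
  shows "(((*v) A) ^^ k) (c *s x) = c *s (((*v) A) ^^ k) x"
  by (induction k) (simp_all add: vec.scale)

text \<open>If the product annihilates \<open>v\<close>, the first form says that
  \<open>mat_poly A q v\<close> is zero or an eigenvector for \<open>z\<close>, the second that
  \<open>q\<close> annihilates (A - z) v.\<close>

lemma mat_poly_linear_factor:
  "mat_poly A ([:-z, 1:] * q) v = A *v mat_poly A q v - z *s mat_poly A q v"
  "mat_poly A ([:-z, 1:] * q) v = mat_poly A q (A *v v - z *s v)"
proof -
  have "[:-z, 1:] * q = pCons 0 q + smult (-z) q" by simp
  then show *: "mat_poly A ([:-z, 1:] * q) v = A *v mat_poly A q v - z *s mat_poly A q v"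
    by (simp only: mat_poly_add mat_poly_smult mat_poly_shift) simp
  have "mat_poly A q (A *v v) = A *v mat_poly A q v"
    by (simp add: mat_poly_def vec.sum vec.scale funpow_swap1)
  moreover have "mat_poly A q ((-z) *s v) = (-z) *s mat_poly A q v"
    unfolding mat_poly_def funpow_matrix_scale vec.scale_sum_right
    by (simp add: vec.scale_scale mult.commute)
  moreover have "mat_poly A q (x + y) = mat_poly A q x + mat_poly A q y" for x y
    unfolding mat_poly_def funpow_matrix_add vec.scale_right_distrib sum.distrib ..
  ultimately have "mat_poly A q (A *v v + (-z) *s v) = A *v mat_poly A q v + (-z) *s mat_poly A q v"
    by (simp only:)
  then show "mat_poly A ([:-z, 1:] * q) v = mat_poly A q (A *v v - z *s v)"
    unfolding * by simp
qed

text \<open>The iterates of \<open>v\<close> up to the dimension are one vector too many to be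
  independent.\<close>

lemma mat_poly_annihilator:
  fixes A :: "complex ^ 'n ^ 'n"
  obtains p where "p \<noteq> 0" "mat_poly A p v = 0"
proof -
  let ?f = "\<lambda>k. (((*v) A) ^^ k) v"
  let ?n = "vec.dim (UNIV :: (complex ^ 'n) set)"
  \<comment> \<open>A repetition among the iterates is treated apart: a set of vectors forgets
    multiplicities, so dependence of the image yields coefficients for the exponents only if the
    iterates are distinct.\<close>
  show ?thesis
  proof (cases "inj_on ?f {..?n}")
    case False
    then obtain i j where ij: "i \<noteq> j" "?f i = ?f j" by (auto simp: inj_on_def)
    let ?p = "monom 1 i - monom 1 j :: complex poly"
    have *: "mat_poly A (monom 1 k) v = ?f k" for k
      by (simp add: mat_poly_def degree_monom_eq if_distrib[of "\<lambda>c. c *s _"] sum.delta cong: if_cong)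
    have "mat_poly A (monom 1 i + smult (-1) (monom 1 j)) v = 0"
      unfolding mat_poly_add mat_poly_smult * by (simp add: ij vec.scale_left_distrib)
    moreover have "coeff (monom 1 i + smult (-1) (monom 1 j) :: complex poly) i = 1" using ij by simp
    ultimately show ?thesis using that by (metis coeff_0 zero_neq_one)
  next
    case True
    have "card (?f ` {..?n}) > ?n" using True by (simp add: card_image)
    moreover have "vec.dim (?f ` {..?n}) \<le> ?n" by (rule vec.dim_subset) auto
    ultimately have "vec.dependent (?f ` {..?n})"
      using vec.independent_card_le_dim[of "?f ` {..?n}" "?f ` {..?n}"] by force
    then obtain u where u: "\<exists>w\<in>?f ` {..?n}. u w \<noteq> 0" "(\<Sum>w\<in>?f ` {..?n}. u w *s w) = 0"
      using vec.dependent_finite[of "?f ` {..?n}"] by auto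
    define p where "p = (\<Sum>k\<le>?n. monom (u (?f k)) k)"
    have cp: "coeff p k = (if k \<le> ?n then u (?f k) else 0)" for k
      by (simp add: p_def coeff_sum)
    have "degree p \<le> ?n" by (rule degree_le) (simp add: cp)
    then have "mat_poly A p v = (\<Sum>k\<le>?n. coeff p k *s ?f k)" by (rule mat_poly_altdef)
    also have "\<dots> = (\<Sum>w\<in>?f ` {..?n}. u w *s w)" by (subst sum.reindex[OF True]) (auto simp: cp intro!: sum.cong)
    finally have "mat_poly A p v = 0" using u(2) by simp
    moreover have "p \<noteq> 0"
    proof
      assume "p = 0"
      then have "u (?f k) = 0" if "k \<le> ?n" for k using cp[of k] that by simp
      with u(1) show False by blast
    qed
    ultimately show ?thesis using that by blast
  qed
qed

text \<open>Summing the recurrence bounds a partial sum S by |s 0| + |z| S + W, and |z| < 1 allows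
  solving for S.\<close>

lemma summable_norm_recurrence:
  fixes s w :: "nat \<Rightarrow> complex"
  assumes rec: "\<And>k. s (Suc k) = z * s k + w k" and z: "cmod z < 1"
    and w: "summable (\<lambda>k. cmod (w k))"
  shows "summable (\<lambda>k. cmod (s k))"
proof (rule summableI_nonneg_bounded)
  let ?W = "\<Sum>k. cmod (w k)"
  fix n
  have "(\<Sum>k<n. cmod (s k)) \<le> (\<Sum>k<Suc n. cmod (s k))" by simp
  also have "\<dots> = cmod (s 0) + (\<Sum>k<n. cmod (s (Suc k)))" by (rule sum.lessThan_Suc_shift)
  also have "\<dots> \<le> cmod (s 0) + (\<Sum>k<n. cmod z * cmod (s k) + cmod (w k))"
    by (intro add_left_mono sum_mono) (metis rec norm_triangle_ineq norm_mult)
  also have "\<dots> \<le> cmod (s 0) + cmod z * (\<Sum>k<n. cmod (s k)) + ?W"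
    using sum_le_suminf[OF w, of "{..<n}"] by (simp add: sum.distrib sum_distrib_left)
  finally have "(\<Sum>k<n. cmod (s k)) * (1 - cmod z) \<le> cmod (s 0) + ?W" by (simp add: algebra_simps)
  then show "(\<Sum>k<n. cmod (s k)) \<le> (cmod (s 0) + ?W) / (1 - cmod z)"
    using z by (simp add: field_simps)
qed simp

text \<open>The roots of an annihilating polynomial of \<open>v\<close> are peeled off one at a time: if \<open>(A - z) v\<close>
  has summable powers, then so has \<open>v\<close>, provided \<open>cmod z < 1\<close>; and either \<open>z\<close> is an eigenvalue
  or the remaining factor already annihilates \<open>v\<close>.\<close>

lemma summable_matrix_powers_complex:
  fixes A :: "complex ^ 'n ^ 'n"
  assumes eig: "\<And>z v. v \<noteq> 0 \<Longrightarrow> A *v v = z *s v \<Longrightarrow> cmod z < 1"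
  shows "summable (\<lambda>k. cmod ((((*v) A) ^^ k) v $ i))"
proof -
  have "p \<noteq> 0 \<Longrightarrow> mat_poly A p v = 0 \<Longrightarrow> summable (\<lambda>k. cmod ((((*v) A) ^^ k) v $ i))" for p v
  proof (induction "degree p" arbitrary: p v)
    case 0
    then obtain c where "p = [:c:]" "c \<noteq> 0" by (metis degree_eq_zeroE pCons_eq_0_iff)
    then have "v = 0" using 0 by (simp add: mat_poly_def)
    moreover have "(((*v) A) ^^ k) 0 = 0" for k by (induction k) simp_all
    ultimately show ?case by simp
  next
    case (Suc n)
    then obtain z where "poly p z = 0"
      using fundamental_theorem_of_algebra[of p] by (metis constant_degree nat.simps(3))
    then obtain q where q: "p = [:-z, 1:] * q" by (metis dvdE poly_eq_0_iff_dvd)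
    then have "q \<noteq> 0" using Suc.prems by auto
    then have "degree p = Suc (degree q)" unfolding q by (subst degree_mult_eq) auto
    then have n: "n = degree q" using Suc.hyps by simp
    let ?w = "A *v v - z *s v"
    \<comment> \<open>By the second form of the factorization, \<open>q\<close> annihilates
      \<open>?w\<close>; its degree is smaller by one, so the induction hypothesis applies to this
      other vector.\<close>
    have sw: "summable (\<lambda>k. cmod ((((*v) A) ^^ k) ?w $ i))"
      using Suc.prems mat_poly_linear_factor(2)[of A z q v] q \<open>q \<noteq> 0\<close> by (intro Suc.hyps(1)[OF n]) auto
    show ?case
    proof (cases "mat_poly A q v = 0")
      case True
      with \<open>q \<noteq> 0\<close> show ?thesis by (intro Suc.hyps(1)[OF n])
    next
      case False
      then have z: "cmod z < 1"
        using eig mat_poly_linear_factor(1)[of A z q v] q Suc.prems by auto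
      show ?thesis
      proof (rule summable_norm_recurrence[OF _ z sw])
        fix k
        have "A *v v = z *s v + ?w" by simp
        then have "(((*v) A) ^^ k) (A *v v) = z *s (((*v) A) ^^ k) v + (((*v) A) ^^ k) ?w"
          by (metis funpow_matrix_add funpow_matrix_scale)
        then show "(((*v) A) ^^ Suc k) v $ i = z * (((*v) A) ^^ k) v $ i + (((*v) A) ^^ k) ?w $ i"
          by (simp add: funpow_swap1)
      qed
    qed
  qed
  then show ?thesis using mat_poly_annihilator by metis
qed

section \<open>Real matrices and their complex eigenvalues\<close>

definition complex_vec :: "real ^ 'n \<Rightarrow> complex ^ 'n" where
  "complex_vec x = (\<chi> i. of_real (x $ i))"

lemma complex_vec_matrix_mult: "map_matrix of_real A *v complex_vec x = complex_vec (A *v x)"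
  by (simp add: complex_vec_def matrix_vector_mult_def vec_eq_iff)

lemma complex_vec_eq_0_iff: "complex_vec x = 0 \<longleftrightarrow> x = 0"
  by (simp add: complex_vec_def vec_eq_iff)

text \<open>A real kernel vector, read as a complex one, would be an eigenvector for 0.\<close>

lemma expansive_invertible:
  fixes R :: "int ^ 'n ^ 'n"
  assumes "expansive R"
  shows "invertible (map_matrix of_int R :: real ^ 'n ^ 'n)"
proof -
  let ?A = "map_matrix of_int R :: real ^ 'n ^ 'n"
  have AC: "map_matrix of_real ?A = (map_matrix of_int R :: complex ^ 'n ^ 'n)"
    by (simp add: vec_eq_iff)
  have "x = 0" if "?A *v x = 0" for x
  proof (rule ccontr)
    assume "x \<noteq> 0"
    moreover have "(map_matrix of_int R :: complex ^ 'n ^ 'n) *v complex_vec x = 0 *s complex_vec x"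
      using that complex_vec_matrix_mult[of ?A x] by (simp add: AC complex_vec_eq_0_iff)
    ultimately show False using assms unfolding expansive_def
      by (metis complex_vec_eq_0_iff norm_zero not_one_less_zero)
  qed
  then show ?thesis
    by (simp add: invertible_left_inverse matrix_left_invertible_ker)
qed

lemma matrix_inv_vector:
  fixes A :: "'a::field ^ 'n ^ 'n"
  assumes "invertible A"
  shows "A *v (matrix_inv A *v x) = x" "matrix_inv A *v (A *v x) = x"
proof -
  have "A ** matrix_inv A = mat 1 \<and> matrix_inv A ** A = mat 1"
    using assms unfolding invertible_def matrix_inv_def by (rule someI_ex)
  then show "A *v (matrix_inv A *v x) = x" "matrix_inv A *v (A *v x) = x"
    by (simp_all add: matrix_vector_mul_assoc)
qed

text \<open>Eigenvalues of the inverse are reciprocals of eigenvalues of \<open>R\<close>, hence of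
  modulus below 1, so the powers are summable on each vector. Taking the finitely many basis vectors
  gives a summable bound of the operator norms, on which the convergence of all digit series
  rests.\<close>

lemma expansive_inverse_powers:
  fixes R :: "int ^ 'n ^ 'n"
  assumes "expansive R"
  obtains c where "summable c" "\<And>k. c k \<ge> 0"
    "\<And>k x. norm (((*v) (matrix_inv (map_matrix of_int R :: real ^ 'n ^ 'n)) ^^ k) x) \<le> c k * norm x"
proof -
  let ?A = "map_matrix of_int R :: real ^ 'n ^ 'n"
  let ?AC = "map_matrix of_int R :: complex ^ 'n ^ 'n"
  let ?T = "matrix_inv ?A"
  let ?TC = "map_matrix of_real ?T :: complex ^ 'n ^ 'n"
  note inv = expansive_invertible[OF assms]
  have mm: "map_matrix of_real (X ** Y) = (map_matrix of_real X ** map_matrix of_real Y :: complex ^ 'n ^ 'n)"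
    for X Y :: "real ^ 'n ^ 'n"
    by (simp add: matrix_matrix_mult_def vec_eq_iff)
  have AC: "map_matrix of_real ?A = ?AC" by (simp add: vec_eq_iff)
  have "?A ** ?T = mat 1"
    using matrix_inv_vector[OF inv] by (simp add: matrix_eq flip: matrix_vector_mul_assoc)
  then have "?AC ** ?TC = map_matrix of_real (mat 1)" using mm[of ?A ?T] AC by simp
  also have "map_matrix of_real (mat 1 :: real ^ 'n ^ 'n) = (mat 1 :: complex ^ 'n ^ 'n)"
    by (simp add: mat_def vec_eq_iff)
  finally have id: "?AC *v (?TC *v v) = v" for v by (simp add: matrix_vector_mul_assoc)
  have eig: "cmod z < 1" if v: "v \<noteq> 0" "?TC *v v = z *s v" for z v
  proof -
    have e: "v = z *s (?AC *v v)" using id[of v] v(2) by (simp add: vec.scale)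
    then have "z \<noteq> 0" using v by auto
    then have "?AC *v v = (1/z) *s v" by (subst (2) e) (simp add: vec.scale_scale)
    then have "1 < cmod (1 / z)" using assms v(1) unfolding expansive_def by blast
    then show ?thesis using \<open>z \<noteq> 0\<close> by (simp add: norm_divide field_simps)
  qed
  have cv: "(((*v) ?TC) ^^ k) (complex_vec x) = complex_vec (((*v) ?T ^^ k) x)" for k x
    by (induction k) (simp_all add: complex_vec_matrix_mult)
  have s: "summable (\<lambda>k. \<bar>((*v) ?T ^^ k) x $ i\<bar>)" for x i
    using summable_matrix_powers_complex[of ?TC "complex_vec x" i, OF eig]
    by (simp add: cv) (simp add: complex_vec_def)
  \<comment> \<open>The sum of the absolute values of all entries of the k-th power of the inverse;
    it dominates the operator norm.\<close>
  define c where "c k = (\<Sum>j\<in>UNIV. \<Sum>i\<in>UNIV. \<bar>((*v) ?T ^^ k) (axis j 1) $ i\<bar>)" for k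
  show ?thesis
  proof
    show "summable c" unfolding c_def by (intro summable_sum s)
    show "c k \<ge> 0" for k unfolding c_def by (intro sum_nonneg) simp
    fix k x
    have sum: "((*v) ?T ^^ k) (sum f S) = (\<Sum>i\<in>S. ((*v) ?T ^^ k) (f i))" for f and S :: "'n set"
      by (induction k) (simp_all add: vec.sum)
    have "((*v) ?T ^^ k) x = (\<Sum>j\<in>UNIV. (x $ j) *s ((*v) ?T ^^ k) (axis j 1))"
      by (subst basis_expansion[of x, symmetric]) (simp add: sum funpow_matrix_scale)
    also have "norm \<dots> \<le> (\<Sum>j\<in>UNIV. norm x * (\<Sum>i\<in>UNIV. \<bar>((*v) ?T ^^ k) (axis j 1) $ i\<bar>))"
    proof (intro sum_norm_le)
      fix j
      have "norm ((x $ j) *s ((*v) ?T ^^ k) (axis j 1)) = \<bar>x $ j\<bar> * norm (((*v) ?T ^^ k) (axis j 1))"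
        by (simp add: scalar_mult_eq_scaleR)
      also have "\<dots> \<le> norm x * (\<Sum>i\<in>UNIV. \<bar>((*v) ?T ^^ k) (axis j 1) $ i\<bar>)"
        using component_le_norm_cart[of x j] by (intro mult_mono norm_le_l1_cart) auto
      finally show "norm ((x $ j) *s ((*v) ?T ^^ k) (axis j 1)) \<le> \<dots>" .
    qed
    also have "\<dots> = c k * norm x" by (simp add: c_def sum_distrib_left mult.commute)
    finally show "norm (((*v) ?T ^^ k) x) \<le> c k * norm x" .
  qed
qed

subsection \<open>Infinite convolutions as laws of random series\<close>

text \<open>Outside \<open>C\<close> the distance is positive, so the approximants vanish
  eventually. They are continuous with values in [0, 1], which makes closed sets accessible through
  continuous functions.\<close>

lemma tendsto_indicator_closed:
  fixes C :: "'a::metric_space set"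
  assumes C: "closed C" "C \<noteq> {}"
  shows "(\<lambda>n. max 0 (1 - real n * infdist x C)) \<longlonglongrightarrow> indicator C x"
proof (cases "x \<in> C")
  case True
  then show ?thesis by simp
next
  case False
  have pos: "infdist x C > 0"
    using in_closed_iff_infdist_zero[OF C, of x] False infdist_nonneg[of x C] by linarith
  obtain n0 :: nat where n0: "1 / infdist x C < real n0" using reals_Archimedean2 by blast
  have "max 0 (1 - real n * infdist x C) = 0" if "n \<ge> n0" for n
  proof -
    have "1 / infdist x C < real n" using n0 that by linarith
    then have "1 < real n * infdist x C" using pos by (simp add: field_simps)
    then show ?thesis by simp
  qed
  then have "eventually (\<lambda>n. max 0 (1 - real n * infdist x C) = indicator C x) sequentially"
    using False by (auto simp: eventually_sequentially)
  then show ?thesis by (rule tendsto_eventually)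
qed

text \<open>Closed sets are an intersection-stable generator, and dominated convergence recovers
  their measure from continuous functions. This is the uniqueness of weak limits that the definite
  description in \<open>infinite_convolution\<close> requires.\<close>

lemma finite_measure_eqI_bounded_continuous:
  fixes \<mu> \<nu> :: "'a::metric_space measure"
  assumes fin: "finite_measure \<mu>" "finite_measure \<nu>"
    and sets [measurable_cong]: "sets \<mu> = sets borel" "sets \<nu> = sets borel"
    and eq: "\<And>f :: 'a \<Rightarrow> real. continuous_on UNIV f \<Longrightarrow> bounded (range f) \<Longrightarrow> integral\<^sup>L \<mu> f = integral\<^sup>L \<nu> f"
  shows "\<mu> = \<nu>"
proof (rule measure_eqI_generator_eq[where E = "{S. closed S}" and \<Omega> = UNIV and A = "\<lambda>_. UNIV"])
  interpret \<mu>: finite_measure \<mu> by fact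
  interpret \<nu>: finite_measure \<nu> by fact
  show "Int_stable {S :: 'a set. closed S}" by (auto simp: Int_stable_def)
  have "sets (borel :: 'a measure) = sigma_sets UNIV {S. closed S}"
    by (subst borel_eq_closed) simp
  then show "sets \<mu> = sigma_sets UNIV {S. closed S}" "sets \<nu> = sigma_sets UNIV {S. closed S}"
    using sets by simp_all
  fix C :: "'a set" assume "C \<in> {S. closed S}"
  then have C: "closed C" by simp
  show "emeasure \<mu> C = emeasure \<nu> C"
  proof (cases "C = {}")
    case False
    define f where "f n x = max 0 (1 - real n * infdist x C)" for n x
    have cont: "continuous_on UNIV (f n)" for n
      unfolding f_def by (intro continuous_intros)
    have bd: "norm (f n x) \<le> 1" for n x
      unfolding f_def using infdist_nonneg[of x C] by (auto simp: max_def)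
    have lim: "(\<lambda>n. f n x) \<longlonglongrightarrow> indicator C x" for x
      unfolding f_def by (rule tendsto_indicator_closed[OF C False])
    have meas: "f n \<in> borel_measurable borel" for n
      by (intro borel_measurable_continuous_onI cont)
    have "(\<lambda>n. integral\<^sup>L M (f n)) \<longlonglongrightarrow> measure M C"
      if M: "finite_measure M" "sets M = sets borel" for M
    proof -
      interpret finite_measure M by fact
      note [measurable_cong] = M(2)
      have sp: "space M = UNIV" using sets_eq_imp_space_eq[OF M(2)] by simp
      have "(\<lambda>n. integral\<^sup>L M (f n)) \<longlonglongrightarrow> integral\<^sup>L M (indicator C)"
        by (rule integral_dominated_convergence[where w = "\<lambda>_. 1"])
           (use C meas M(2) bd lim in \<open>auto simp: measurable_cong_sets[OF M(2) refl]\<close>)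
      then show ?thesis by (simp add: sp)
    qed
    note lims = this[OF fin(1) sets(1)] this[OF fin(2) sets(2)]
    have "bounded (range (f n))" for n using bd by (auto simp: bounded_iff)
    then have "integral\<^sup>L \<mu> (f n) = integral\<^sup>L \<nu> (f n)" for n by (rule eq[OF cont])
    then have "measure \<mu> C = measure \<nu> C"
      using LIMSEQ_unique[OF lims(1)] lims(2) by simp
    then show ?thesis by (simp add: \<mu>.emeasure_eq_measure \<nu>.emeasure_eq_measure)
  qed simp
next
  show "emeasure \<mu> UNIV \<noteq> \<infinity>"
    using fin(1) by (simp add: finite_measure.emeasure_finite)
qed auto

section \<open>Independent coordinates and random series\<close>

lemma indep_vars_PiM_coordinates:
  assumes "prob_space D"
  shows "prob_space.indep_vars (PiM UNIV (\<lambda>_ :: nat. D)) (\<lambda>_. D) (\<lambda>k \<omega>. \<omega> k) UNIV"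
proof -
  interpret D: prob_space D by fact
  interpret product_prob_space "\<lambda>_ :: nat. D" UNIV ..
  have "distr (PiM UNIV (\<lambda>_ :: nat. D)) (PiM UNIV (\<lambda>_. D)) (\<lambda>x. \<lambda>i\<in>UNIV. x i) = PiM UNIV (\<lambda>_. D)"
    by (simp add: restrict_UNIV distr_id)
  then show ?thesis
    by (subst P.indep_vars_iff_distr_eq_PiM) (auto simp: PiM_component)
qed

definition series_map :: "(nat \<Rightarrow> 's \<Rightarrow> 'a::real_normed_vector) \<Rightarrow> (nat \<Rightarrow> 's) \<Rightarrow> 'a" where
  "series_map X \<eta> = (\<Sum>k. X k (\<eta> k))"

lemma series_map_measurable [measurable]:
  fixes X :: "nat \<Rightarrow> 's \<Rightarrow> 'a::euclidean_space"
  assumes [measurable]: "\<And>k. X k \<in> borel_measurable D"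
  shows "series_map X \<in> borel_measurable (PiM UNIV (\<lambda>_. D))"
  unfolding series_map_def[abs_def] by measurable

lemma series_map_sums:
  fixes X :: "nat \<Rightarrow> 's \<Rightarrow> 'a::euclidean_space"
  assumes "\<And>k. norm (X k (\<eta> k)) \<le> c k" "summable c"
  shows "(\<lambda>k. X k (\<eta> k)) sums series_map X \<eta>" "norm (series_map X \<eta>) \<le> suminf c"
proof -
  have s: "summable (\<lambda>k. norm (X k (\<eta> k)))"
    by (rule summable_comparison_test'[OF assms(2)]) (simp add: assms(1))
  then show "(\<lambda>k. X k (\<eta> k)) sums series_map X \<eta>"
    unfolding series_map_def by (rule summable_sums[OF summable_norm_cancel])
  show "norm (series_map X \<eta>) \<le> suminf c"
    unfolding series_map_def using summable_norm[OF s] suminf_le[OF assms(1) s assms(2)] by linarith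
qed

text \<open>Convolution is the law of a sum of independent variables: the first \<open>n\<close>
  terms depend on the coordinates below \<open>n\<close>, the next one on coordinate
  \<open>n\<close>.\<close>

lemma partial_convolution_distr:
  fixes X :: "nat \<Rightarrow> 's \<Rightarrow> 'a::ordered_euclidean_space"
  assumes D: "prob_space D" and [measurable]: "\<And>k. X k \<in> borel_measurable D"
  shows "partial_convolution (\<lambda>k. distr D borel (X k)) n
    = distr (PiM UNIV (\<lambda>_. D)) borel (\<lambda>\<eta>. \<Sum>k<n. X k (\<eta> k))"
proof -
  interpret D: prob_space D by fact
  interpret product_prob_space "\<lambda>_ :: nat. D" UNIV ..
  let ?S = "PiM UNIV (\<lambda>_ :: nat. D)"
  show ?thesis
  proof (induction n)
    case 0
    show ?case
      by (rule measure_eqI) (auto simp: emeasure_distr P.emeasure_space_1 indicator_def)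
  next
    case (Suc n)
    have iv: "P.indep_vars (\<lambda>_. borel) (\<lambda>k \<eta>. X k (\<eta> k)) UNIV"
      by (rule P.indep_vars_compose2[OF indep_vars_PiM_coordinates[OF D]]) simp
    have "P.indep_var
      borel ((\<lambda>f. \<Sum>k<n. f k) \<circ> (\<lambda>\<omega>. restrict (\<lambda>k. X k (\<omega> k)) {..<n}))
      borel ((\<lambda>f. f n) \<circ> (\<lambda>\<omega>. restrict (\<lambda>k. X k (\<omega> k)) {n}))"
      by (intro P.indep_var_compose[OF P.indep_var_restrict[OF iv]]) auto
    also have "((\<lambda>f. \<Sum>k<n. f k) \<circ> (\<lambda>\<omega>. restrict (\<lambda>k. X k (\<omega> k)) {..<n})) = (\<lambda>\<omega>. \<Sum>k<n. X k (\<omega> k))"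
      by (auto simp: fun_eq_iff)
    also have "((\<lambda>f. f n) \<circ> (\<lambda>\<omega>. restrict (\<lambda>k. X k (\<omega> k)) {n})) = (\<lambda>\<omega>. X n (\<omega> n))"
      by (auto simp: fun_eq_iff)
    finally have *: "distr ?S borel (\<lambda>\<omega>. (\<Sum>k<n. X k (\<omega> k)) + X n (\<omega> n))
        = convolution (distr ?S borel (\<lambda>\<omega>. \<Sum>k<n. X k (\<omega> k))) (distr ?S borel (\<lambda>\<omega>. X n (\<omega> n)))"
      by (rule P.sum_indep_random_variable) measurable
    have "distr ?S borel (\<lambda>\<omega>. X n (\<omega> n)) = distr (distr ?S D (\<lambda>\<omega>. \<omega> n)) borel (X n)"
      by (subst distr_distr) (auto simp: o_def)
    also have "\<dots> = distr D borel (X n)" using PiM_component[of n] by simp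
    finally show ?case using * Suc by simp
  qed
qed

text \<open>The partial sums converge pointwise under the summable bound, hence their laws, the
  partial convolutions, converge weakly to the law of the series. Uniqueness of weak limits then
  identifies the infinite convolution.\<close>

lemma infinite_convolution_distr:
  fixes X :: "nat \<Rightarrow> 's \<Rightarrow> 'a::ordered_euclidean_space"
  assumes D: "prob_space D" and X [measurable]: "\<And>k. X k \<in> borel_measurable D"
    and le: "\<And>k s. s \<in> space D \<Longrightarrow> norm (X k s) \<le> c k" and c: "summable c"
  shows "infinite_convolution (\<lambda>k. distr D borel (X k)) = distr (PiM UNIV (\<lambda>_. D)) borel (series_map X)"
proof -
  interpret D: prob_space D by fact
  interpret product_prob_space "\<lambda>_ :: nat. D" UNIV ..
  let ?S = "PiM UNIV (\<lambda>_ :: nat. D)" and ?\<nu> = "\<lambda>k. distr D borel (X k)"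
  let ?\<mu> = "distr ?S borel (series_map X)"
  have sm [measurable]: "series_map X \<in> borel_measurable ?S" by (rule series_map_measurable[OF X])
  have conv: "weakly_converges (partial_convolution ?\<nu>) ?\<mu>"
    unfolding weakly_converges_def
  proof (intro allI impI, elim conjE)
    fix f :: "'a \<Rightarrow> real" assume f: "continuous_on UNIV f" "bounded (range f)"
    then obtain K where K: "\<And>x. norm (f x) \<le> K" by (auto simp: bounded_iff)
    have [measurable]: "f \<in> borel_measurable borel" using f(1) by (rule borel_measurable_continuous_onI)
    have "(\<lambda>n. integral\<^sup>L ?S (\<lambda>\<eta>. f (\<Sum>k<n. X k (\<eta> k)))) \<longlonglongrightarrow> integral\<^sup>L ?S (\<lambda>\<eta>. f (series_map X \<eta>))"
    proof (rule integral_dominated_convergence[where w = "\<lambda>_. K"])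
      show "AE \<eta> in ?S. (\<lambda>n. f (\<Sum>k<n. X k (\<eta> k))) \<longlonglongrightarrow> f (series_map X \<eta>)"
      proof (rule AE_I2)
        fix \<eta> assume "\<eta> \<in> space ?S"
        then have "norm (X k (\<eta> k)) \<le> c k" for k by (intro le) (auto simp: space_PiM)
        from series_map_sums(1)[of X \<eta> c, OF this c]
        have "(\<lambda>n. \<Sum>k<n. X k (\<eta> k)) \<longlonglongrightarrow> series_map X \<eta>" by (simp add: sums_def)
        then show "(\<lambda>n. f (\<Sum>k<n. X k (\<eta> k))) \<longlonglongrightarrow> f (series_map X \<eta>)"
          by (rule continuous_on_tendsto_compose[OF f(1)]) auto
      qed
    qed (use K in \<open>auto intro!: AE_I2\<close>)
    then show "(\<lambda>n. integral\<^sup>L (partial_convolution ?\<nu> n) f) \<longlonglongrightarrow> integral\<^sup>L ?\<mu> f"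
      by (simp add: partial_convolution_distr[OF D X] integral_distr)
  qed
  show ?thesis
    unfolding infinite_convolution_def
  proof (rule the_equality)
    show "prob_space ?\<mu> \<and> sets ?\<mu> = sets borel \<and> weakly_converges (partial_convolution ?\<nu>) ?\<mu>"
      using conv by (auto intro: P.prob_space_distr)
    fix \<mu> :: "'a measure"
    assume \<mu>: "prob_space \<mu> \<and> sets \<mu> = sets borel \<and> weakly_converges (partial_convolution ?\<nu>) \<mu>"
    show "\<mu> = ?\<mu>"
    proof (rule finite_measure_eqI_bounded_continuous)
      show "finite_measure \<mu>" using \<mu> by (simp add: prob_space.finite_measure)
      show "finite_measure ?\<mu>" by (intro prob_space.finite_measure P.prob_space_distr) simp
      show "integral\<^sup>L \<mu> f = integral\<^sup>L ?\<mu> f" if "continuous_on UNIV f" "bounded (range f)" for f :: "'a \<Rightarrow> real"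
      proof (rule LIMSEQ_unique)
        show "(\<lambda>n. integral\<^sup>L (partial_convolution ?\<nu> n) f) \<longlonglongrightarrow> integral\<^sup>L \<mu> f"
          using \<mu> that unfolding weakly_converges_def by blast
        show "(\<lambda>n. integral\<^sup>L (partial_convolution ?\<nu> n) f) \<longlonglongrightarrow> integral\<^sup>L ?\<mu> f"
          using conv that unfolding weakly_converges_def by blast
      qed
    qed (use \<mu> in auto)
  qed
qed

text \<open>A product measure is determined by its cylinders over finite sets of coordinates. On a
  cylinder, Fubini integrates the second sequence first, and independence of the coordinates of the
  first one splits the remaining integral into factors.\<close>

lemma PiM_pair_zip:
  assumes "prob_space D" "prob_space E"
  shows "distr (PiM UNIV (\<lambda>_ :: nat. D) \<Otimes>\<^sub>M PiM UNIV (\<lambda>_ :: nat. E)) (PiM UNIV (\<lambda>_. D \<Otimes>\<^sub>M E))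
      (\<lambda>(\<omega>, \<eta>) k. (\<omega> k, \<eta> k)) = PiM UNIV (\<lambda>_. D \<Otimes>\<^sub>M E)" (is "distr (?P \<Otimes>\<^sub>M ?Q) ?PQ ?z = _")
proof -
  interpret D: prob_space D by fact
  interpret E: prob_space E by fact
  interpret P: product_prob_space "\<lambda>_ :: nat. D" UNIV ..
  interpret Q: product_prob_space "\<lambda>_ :: nat. E" UNIV ..
  interpret DE: pair_prob_space D E ..
  interpret PQ: product_prob_space "\<lambda>_ :: nat. D \<Otimes>\<^sub>M E" UNIV ..
  have z [measurable]: "?z \<in> measurable (?P \<Otimes>\<^sub>M ?Q) ?PQ"
    by (intro measurable_PiM_single') (auto simp: space_pair_measure space_PiM split_beta')
  show ?thesis
  proof (rule PQ.PiM_eq)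
    fix J :: "nat set" and F
    assume J: "finite J" and F: "\<And>j. j \<in> J \<Longrightarrow> F j \<in> sets (D \<Otimes>\<^sub>M E)"
    let ?C = "PQ.emb UNIV J (PiE J F)"
    have C: "?C = {\<omega> \<in> space ?PQ. \<forall>j\<in>J. \<omega> j \<in> F j}"
      by (auto simp: prod_emb_def space_PiM PiE_iff)
    have Cm: "?C \<in> sets ?PQ" using J F by (intro sets_PiM_I) auto
    have "emeasure (distr (?P \<Otimes>\<^sub>M ?Q) ?PQ ?z) ?C
        = emeasure (?P \<Otimes>\<^sub>M ?Q) (?z -` ?C \<inter> space (?P \<Otimes>\<^sub>M ?Q))"
      by (rule emeasure_distr[OF z Cm])
    also have "\<dots> = (\<integral>\<^sup>+\<omega>. emeasure ?Q (Pair \<omega> -` (?z -` ?C \<inter> space (?P \<Otimes>\<^sub>M ?Q))) \<partial>?P)"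
      by (rule Q.P.emeasure_pair_measure_alt) (rule measurable_sets[OF z Cm])
    also have "\<dots> = (\<integral>\<^sup>+\<omega>. (\<Prod>j\<in>J. emeasure E (Pair (\<omega> j) -` F j)) \<partial>?P)"
    proof (rule nn_integral_cong)
      fix \<omega> assume w: "\<omega> \<in> space ?P"
      \<comment> \<open>The section at \<omega> is again a cylinder, built from the sections of the
        sets \<open>F j\<close> at \<open>\<omega> j\<close>.\<close>
      have "Pair \<omega> -` (?z -` ?C \<inter> space (?P \<Otimes>\<^sub>M ?Q)) = Q.emb UNIV J (\<Pi>\<^sub>E j\<in>J. Pair (\<omega> j) -` F j)"
        using w sets.sets_into_space[OF F]
        by (fastforce simp: C prod_emb_def space_PiM space_pair_measure PiE_iff)
      also have "emeasure ?Q \<dots> = (\<Prod>j\<in>J. emeasure E (Pair (\<omega> j) -` F j))"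
        using J F by (intro Q.emeasure_PiM_emb) (auto intro: sets_Pair1)
      finally show "emeasure ?Q (Pair \<omega> -` (?z -` ?C \<inter> space (?P \<Otimes>\<^sub>M ?Q))) = \<dots>" .
    qed
    also have "\<dots> = (\<Prod>j\<in>J. \<integral>\<^sup>+\<omega>. emeasure E (Pair (\<omega> j) -` F j) \<partial>?P)"
    proof (rule P.P.indep_vars_nn_integral[OF J])
      \<comment> \<open>Independence of all coordinates asks for a measurable function at every
        \<open>j\<close>; outside \<open>J\<close>, where \<open>F j\<close> is arbitrary, the zero
        function stands in.\<close>
      have "P.P.indep_vars (\<lambda>_. borel) (\<lambda>j \<omega>. (if j \<in> J then (\<lambda>x. emeasure E (Pair x -` F j)) else (\<lambda>_. 0)) (\<omega> j)) UNIV"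
        by (rule P.P.indep_vars_compose2[OF indep_vars_PiM_coordinates[OF assms(1)]])
           (auto intro: E.measurable_emeasure_Pair F)
      then have "P.P.indep_vars (\<lambda>_. borel) (\<lambda>j \<omega>. (if j \<in> J then (\<lambda>x. emeasure E (Pair x -` F j)) else (\<lambda>_. 0)) (\<omega> j)) J"
        by (rule P.P.indep_vars_subset) simp
      then show "P.P.indep_vars (\<lambda>_. borel) (\<lambda>j \<omega>. emeasure E (Pair (\<omega> j) -` F j)) J"
        by (subst P.P.indep_vars_cong[OF refl _ refl]) (auto simp: fun_eq_iff)
    qed simp
    also have "\<dots> = (\<Prod>j\<in>J. emeasure (D \<Otimes>\<^sub>M E) (F j))"
    proof (rule prod.cong[OF refl])
      fix j assume j: "j \<in> J"
      have [measurable]: "(\<lambda>x. emeasure E (Pair x -` F j)) \<in> borel_measurable D"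
        using E.measurable_emeasure_Pair F j by blast
      have "(\<integral>\<^sup>+\<omega>. emeasure E (Pair (\<omega> j) -` F j) \<partial>?P)
        = (\<integral>\<^sup>+x. emeasure E (Pair x -` F j) \<partial>distr ?P D (\<lambda>\<omega>. \<omega> j))"
        by (subst nn_integral_distr) auto
      also have "\<dots> = emeasure (D \<Otimes>\<^sub>M E) (F j)"
        using P.PiM_component[of j] E.emeasure_pair_measure_alt[OF F[OF j]] by simp
      finally show "(\<integral>\<^sup>+\<omega>. emeasure E (Pair (\<omega> j) -` F j) \<partial>?P) = emeasure (D \<Otimes>\<^sub>M E) (F j)" .
    qed
    finally show "emeasure (distr (?P \<Otimes>\<^sub>M ?Q) ?PQ ?z) ?C = \<dots>" .
  qed simp
qed

lemma uniform_count_measure_pair: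
  assumes "finite A" "finite B" "A \<noteq> {}" "B \<noteq> {}"
  shows "uniform_count_measure A \<Otimes>\<^sub>M uniform_count_measure B = uniform_count_measure (A \<times> B)"
proof -
  interpret A: prob_space "uniform_count_measure A" using assms by (intro prob_space_uniform_count_measure)
  interpret B: prob_space "uniform_count_measure B" using assms by (intro prob_space_uniform_count_measure)
  have s: "sets (uniform_count_measure A \<Otimes>\<^sub>M uniform_count_measure B) = Pow (A \<times> B)"
    using assms sets_pair_measure_cong[OF sets_uniform_count_measure_count_space[of A] sets_uniform_count_measure_count_space[of B]]
    unfolding pair_measure_count_space[OF assms(1,2)] by simp
  show ?thesis
  proof (rule measure_eqI_finite[OF s])
    fix x assume "x \<in> A \<times> B"
    then obtain a b where x: "x = (a, b)" "a \<in> A" "b \<in> B" by auto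
    have "emeasure (uniform_count_measure A \<Otimes>\<^sub>M uniform_count_measure B) ({a} \<times> {b})
      = emeasure (uniform_count_measure A) {a} * emeasure (uniform_count_measure B) {b}"
      using x by (intro B.emeasure_pair_measure_Times) (auto simp: sets_uniform_count_measure)
    also have "\<dots> = emeasure (uniform_count_measure (A \<times> B)) {x}"
      using x assms by (simp add: emeasure_uniform_count_measure card_cartesian_product
          flip: ennreal_mult)
    finally show "emeasure (uniform_count_measure A \<Otimes>\<^sub>M uniform_count_measure B) {x}
      = emeasure (uniform_count_measure (A \<times> B)) {x}" by (simp add: x)
  qed (use assms in \<open>auto simp: sets_uniform_count_measure\<close>)
qed

lemma uniform_point_measure_image:
  fixes f :: "'s \<Rightarrow> 'a::euclidean_space"
  assumes "finite A" "A \<noteq> {}" "inj_on f A"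
  shows "uniform_point_measure (f ` A) = distr (uniform_count_measure A) borel f"
proof -
  have d: "distr (uniform_count_measure A) (uniform_count_measure (f ` A)) f = uniform_count_measure (f ` A)"
  proof (rule measure_eqI_finite[of _ "f ` A"])
    fix y assume "y \<in> f ` A"
    then obtain x where x: "x \<in> A" "y = f x" by auto
    then have "f -` {y} \<inter> A = {x}" using assms(3) by (auto simp: inj_on_def)
    moreover have "card (f ` A) = card A" using assms(3) by (rule card_image)
    ultimately show "emeasure (distr (uniform_count_measure A) (uniform_count_measure (f ` A)) f) {y}
      = emeasure (uniform_count_measure (f ` A)) {y}"
      using x assms by (subst emeasure_distr)
        (auto simp: emeasure_uniform_count_measure sets_uniform_count_measure space_uniform_count_measure measurable_def)
  qed (use assms in \<open>auto simp: sets_uniform_count_measure\<close>)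
  show ?thesis
    unfolding uniform_point_measure_def
    by (subst d[symmetric], subst distr_distr)
       (auto simp: o_def sets_uniform_count_measure space_uniform_count_measure measurable_def)
qed

section \<open>Integer vectors, digit series and residues\<close>

lemma vec_of_int_add: "vec_of_int (x + y) = vec_of_int x + vec_of_int y"
  and vec_of_int_diff: "vec_of_int (x - y) = vec_of_int x - vec_of_int y"
  and vec_of_int_0 [simp]: "vec_of_int 0 = 0"
  and vec_of_int_inject [simp]: "vec_of_int x = vec_of_int y \<longleftrightarrow> x = y"
  by (simp_all add: vec_of_int_def vec_eq_iff)

lemma vec_of_int_mult: "map_matrix of_int R *v vec_of_int z = vec_of_int (R *v z)"
  by (simp add: vec_of_int_def matrix_vector_mult_def vec_eq_iff)

lemma finite_bounded_vec_of_int: "finite {z :: int ^ 'n. norm (vec_of_int z) \<le> K}"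
proof -
  have "{z :: int ^ 'n. norm (vec_of_int z) \<le> K} \<subseteq> vec_lambda ` (UNIV \<rightarrow>\<^sub>E {-\<lceil>K\<rceil>..\<lceil>K\<rceil>})"
  proof safe
    fix z :: "int ^ 'n" assume z: "norm (vec_of_int z) \<le> K"
    have "\<bar>z $ i\<bar> \<le> \<lceil>K\<rceil>" for i
    proof -
      have "\<bar>vec_of_int z $ i\<bar> \<le> norm (vec_of_int z)" by (rule component_le_norm_cart)
      with z have "of_int \<bar>z $ i\<bar> \<le> K" by (simp add: vec_of_int_def)
      then show ?thesis by linarith
    qed
    then have "z $ i \<in> {-\<lceil>K\<rceil>..\<lceil>K\<rceil>}" for i by (simp only: abs_le_iff atLeastAtMost_iff minus_le_iff)
    then have "vec_nth z \<in> UNIV \<rightarrow>\<^sub>E {-\<lceil>K\<rceil>..\<lceil>K\<rceil>}" by blast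
    then show "z \<in> vec_lambda ` (UNIV \<rightarrow>\<^sub>E {-\<lceil>K\<rceil>..\<lceil>K\<rceil>})" by (metis imageI vec_nth_inverse)
  qed
  moreover have "finite ((UNIV :: 'n set) \<rightarrow>\<^sub>E {-\<lceil>K\<rceil>..\<lceil>K\<rceil>})" by (intro finite_PiE) auto
  ultimately show ?thesis by (rule finite_subset[OF _ finite_imageI])
qed

text \<open>The exponent is \<open>Suc k\<close> because positions start at 0. Digits are given by a
  map on symbols, so that one symbol space can carry digit sets that vary with the position.\<close>

definition digit_term :: "int ^ 'n ^ 'n \<Rightarrow> ('s \<Rightarrow> int ^ 'n) \<Rightarrow> nat \<Rightarrow> 's \<Rightarrow> real ^ 'n" where
  "digit_term R d k s = (((*v) (matrix_inv (map_matrix of_int R))) ^^ Suc k) (vec_of_int (d s))"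

lemma digit_term_bound:
  fixes R :: "int ^ 'n ^ 'n"
  assumes "expansive R"
  obtains c where "summable c" "\<And>k. c k \<ge> 0"
    "\<And>K k (d :: 's \<Rightarrow> int ^ 'n) s. norm (vec_of_int (d s)) \<le> K \<Longrightarrow> norm (digit_term R d k s) \<le> c k * K"
proof -
  obtain c where c: "summable c" "\<And>k. c k \<ge> 0"
    "\<And>k x. norm (((*v) (matrix_inv (map_matrix of_int R :: real ^ 'n ^ 'n)) ^^ k) x) \<le> c k * norm x"
    using expansive_inverse_powers[OF assms] by blast
  show ?thesis
  proof (rule that[of "\<lambda>k. c (Suc k)"])
    show "summable (\<lambda>k. c (Suc k))" using c(1) by (subst summable_Suc_iff)
    show "c (Suc k) \<ge> 0" for k by (rule c)
    fix K k and d :: "'s \<Rightarrow> int ^ 'n" and s assume K: "norm (vec_of_int (d s)) \<le> K"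
    have "norm (digit_term R d k s) \<le> c (Suc k) * norm (vec_of_int (d s))"
      unfolding digit_term_def by (rule c)
    also have "\<dots> \<le> c (Suc k) * K" by (intro mult_left_mono K c)
    finally show "norm (digit_term R d k s) \<le> c (Suc k) * K" .
  qed
qed

lemma inj_funpow_matrix_inv:
  assumes "expansive R"
  shows "inj (((*v) (matrix_inv (map_matrix of_int R :: real ^ 'n ^ 'n))) ^^ k)"
proof (induction k)
  case (Suc k)
  have "inj ((*v) (matrix_inv (map_matrix of_int R :: real ^ 'n ^ 'n)))"
    by (rule inj_on_inverseI[where g = "(*v) (map_matrix of_int R)"])
       (rule matrix_inv_vector[OF expansive_invertible[OF assms]])
  from inj_compose[OF this Suc] show ?case by (simp only: funpow.simps)
qed simp

text \<open>The digit map may depend on the position: a constant choice yields self-affine measures,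
  a choice along \<omega> yields the random convolutions. Scaling by powers of the inverse keeps the
  digits distinct.\<close>

lemma infinite_convolution_digits:
  fixes d :: "nat \<Rightarrow> 's \<Rightarrow> int ^ 'n"
  assumes R: "expansive R" and S: "finite S" "S \<noteq> {}" and inj: "\<And>k. inj_on (d k) S"
    and K: "\<And>k s. s \<in> S \<Longrightarrow> norm (vec_of_int (d k s)) \<le> K"
  shows "infinite_convolution (\<lambda>k. uniform_point_measure (scaled_digits R (Suc k) (d k ` S)))
    = distr (PiM UNIV (\<lambda>_. uniform_count_measure S)) borel (series_map (\<lambda>k. digit_term R (d k) k))"
proof -
  obtain c where c: "summable c" "\<And>k. c k \<ge> 0"
    "\<And>K k d (s :: 's). norm (vec_of_int (d s)) \<le> K \<Longrightarrow> norm (digit_term R d k s) \<le> c k * K"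
    by (rule digit_term_bound[OF R]) (blast intro: that)
  have i: "inj_on (digit_term R (d k) k) S" for k
    unfolding digit_term_def[abs_def]
    by (intro inj_onI inj_onD[OF inj[of k]]) (metis injD[OF inj_funpow_matrix_inv[OF R]] vec_of_int_inject)
  have "scaled_digits R (Suc k) (d k ` S) = digit_term R (d k) k ` S" for k
    unfolding scaled_digits_def digit_term_def[abs_def] by (simp add: image_image)
  then have "uniform_point_measure (scaled_digits R (Suc k) (d k ` S))
      = distr (uniform_count_measure S) borel (digit_term R (d k) k)" for k
    using uniform_point_measure_image[OF S i] by simp
  then show ?thesis
    by (simp only:)
       (rule infinite_convolution_distr[where c = "\<lambda>k. c k * K"],
         use S K c in \<open>auto intro: prob_space_uniform_count_measure summable_mult2
            simp: space_uniform_count_measure measurable_def sets_uniform_count_measure\<close>)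
qed

text \<open>Congruent digits have identical columns in the Hadamard matrix, since their characters
  differ by exp of 2 pi i times an integer. The inner product of such columns is 1, while distinct
  columns of a unitary matrix are orthogonal.\<close>

lemma hadamard_triple_residues:
  assumes "hadamard_triple R B L" "b \<in> B" "b' \<in> B" "b - b' = R *v z"
  shows "b = b'"
proof (rule ccontr)
  assume ne: "b \<noteq> b'"
  let ?T = "matrix_inv (map_matrix of_int R :: real ^ 'a ^ 'a)"
  define U where "U l b = of_real (1 / sqrt (real (card B))) * cis (2 * pi * ((?T *v vec_of_int b) \<bullet> vec_of_int l))" for l b
  have R: "expansive R" and B: "finite B" "0 \<in> B" and L: "finite L" "card L = card B" and u: "unitary_on L B U"
    using assms(1) unfolding hadamard_triple_def U_def[abs_def] by auto
  have N: "card B > 0" using B by (auto simp: card_gt_0_iff)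
  have "vec_of_int b = vec_of_int b' + map_matrix of_int R *v vec_of_int z"
    using assms(4) by (metis vec_of_int_mult vec_of_int_add add_diff_cancel_left' diff_add_cancel add.commute)
  then have tb: "?T *v vec_of_int b = ?T *v vec_of_int b' + vec_of_int z"
    by (simp add: matrix_vector_right_distrib matrix_inv_vector[OF expansive_invertible[OF R]])
  have eq: "U l b = U l b'" for l
  proof -
    define m where "m = (\<Sum>i\<in>UNIV. z $ i * l $ i)"
    have "vec_of_int z \<bullet> vec_of_int l = of_int m"
      by (simp add: inner_vec_def vec_of_int_def m_def)
    then show ?thesis
      unfolding U_def tb inner_add_left
      by (simp add: distrib_left flip: cis_mult)
  qed
  have "cnj (U l b) * U l b' = of_real (1 / real (card B))" for l
    unfolding eq[symmetric] using N
    by (simp add: U_def cis_cnj cis_mult real_sqrt_mult_self flip: of_real_mult)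
  then have "(\<Sum>l\<in>L. cnj (U l b) * U l b') = 1" using N L by simp
  moreover have "(\<Sum>l\<in>L. cnj (U l b) * U l b') = 0"
    using u assms(2,3) ne unfolding unitary_on_def by auto
  ultimately show False by simp
qed

lemma prob_space_symbol_measure: "N \<ge> 1 \<Longrightarrow> prob_space (symbol_measure N)"
  unfolding symbol_measure_def by (intro prob_space_PiM prob_space_uniform_count_measure) auto

lemma space_symbol_measure: "space (symbol_measure N) = {\<omega>. \<forall>k. \<omega> k \<in> {1..N}}"
  by (auto simp: symbol_measure_def space_PiM space_uniform_count_measure PiE_UNIV_domain Pi_iff)

subsection \<open>Almost sure injectivity of the coding map\<close>

text \<open>The first component enters the injectivity argument through expansiveness and the
  distinctness of its digits modulo \<open>R\<close>.\<close>

locale digit_system =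
  fixes R :: "int ^ 'r ^ 'r" and a :: "nat \<Rightarrow> int ^ 'r" and N :: nat
  assumes expansive: "expansive R" and N: "N \<ge> 1"
    and residues: "\<And>i j z. i \<in> {1..N} \<Longrightarrow> j \<in> {1..N} \<Longrightarrow> a i - a j = R *v z \<Longrightarrow> i = j"
begin

abbreviation "A \<equiv> (map_matrix of_int R :: real ^ 'r ^ 'r)"
abbreviation "P \<equiv> symbol_measure N"

definition F :: "(nat \<Rightarrow> nat) \<Rightarrow> real ^ 'r" where
  "F = series_map (digit_term R a)"

definition lshift :: "(nat \<Rightarrow> nat) \<Rightarrow> nat \<Rightarrow> nat" where
  "lshift \<omega> k = \<omega> (Suc k)"

sublocale P: prob_space P using N by (rule prob_space_symbol_measure)

lemma space_P: "space P = {\<omega>. \<forall>k. \<omega> k \<in> {1..N}}"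
  by (rule space_symbol_measure)

lemma measurable_P_coordinate [measurable]: "(\<lambda>\<omega>. \<omega> k) \<in> measurable P (count_space {1..N})"
proof -
  have "(\<lambda>\<omega>. \<omega> k) \<in> measurable P (uniform_count_measure {1..N})"
    unfolding symbol_measure_def by measurable
  then show ?thesis using measurable_cong_sets[OF refl sets_uniform_count_measure_count_space] by blast
qed

lemma measurable_P_coordinate_UNIV [measurable]: "(\<lambda>\<omega>. \<omega> k) \<in> measurable P (count_space UNIV)"
  by (rule measurable_compose[OF measurable_P_coordinate]) auto

lemma measurable_into_P:
  assumes "\<And>k. (\<lambda>x. f x k) \<in> measurable M (count_space {1..N})"
  shows "f \<in> measurable M P"
proof -
  have "(\<lambda>x. f x k) \<in> measurable M (uniform_count_measure {1..N})" for k
    using assms measurable_cong_sets[OF refl sets_uniform_count_measure_count_space] by blast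
  then show ?thesis unfolding symbol_measure_def
    by (intro measurable_PiM_single') (use measurable_space[OF assms] in \<open>auto simp: space_uniform_count_measure\<close>)
qed

lemma measurable_shift [measurable]: "lshift \<in> measurable P P"
  by (rule measurable_into_P) (unfold lshift_def, rule measurable_P_coordinate)

lemma distr_shift: "distr P P lshift = P"
proof -
  have "distr (PiM UNIV (\<lambda>_. uniform_count_measure {1..N})) (PiM UNIV (\<lambda>_. uniform_count_measure {1..N}))
     (\<lambda>\<omega>. \<lambda>n\<in>UNIV. \<omega> (Suc n)) = PiM UNIV (\<lambda>_. uniform_count_measure {1..N})"
    using N by (intro distr_PiM_reindex prob_space_uniform_count_measure) auto
  then show ?thesis by (simp add: symbol_measure_def lshift_def[abs_def] restrict_UNIV)
qed

lemma measurable_F [measurable]: "F \<in> borel_measurable P"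
  unfolding F_def symbol_measure_def by (rule series_map_measurable)
    (auto simp: measurable_def sets_uniform_count_measure space_uniform_count_measure)

lemma F_sums_bounded: "\<exists>C. \<forall>\<omega>\<in>space P. (\<lambda>k. digit_term R a k (\<omega> k)) sums F \<omega> \<and> norm (F \<omega>) \<le> C"
proof -
  obtain c where c: "summable c" "\<And>k. c k \<ge> 0"
    "\<And>K k d (s :: nat). norm (vec_of_int (d s)) \<le> K \<Longrightarrow> norm (digit_term R d k s) \<le> c k * K"
    by (rule digit_term_bound[OF expansive]) (blast intro: that)
  define K where "K = (\<Sum>i\<in>{1..N}. norm (vec_of_int (a i)))"
  have K: "norm (vec_of_int (a i)) \<le> K" if "i \<in> {1..N}" for i
    unfolding K_def using that by (intro member_le_sum) auto
  have bd: "norm (digit_term R a k (\<omega> k)) \<le> c k * K" if "\<omega> \<in> space P" for \<omega> k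
    using that by (intro c K) (simp add: space_P)
  note s = series_map_sums[of "digit_term R a" _ "\<lambda>k. c k * K", OF bd summable_mult2[OF c(1)]]
  have "(\<lambda>k. digit_term R a k (\<omega> k)) sums F \<omega> \<and> norm (F \<omega>) \<le> suminf (\<lambda>k. c k * K)"
    if "\<omega> \<in> space P" for \<omega>
    unfolding F_def using s[OF that] by (rule conjI)
  then show ?thesis by blast
qed

text \<open>A bound of the attractor; any choice serves.\<close>

definition radius :: real where
  "radius = (SOME C. \<forall>\<omega>\<in>space P. (\<lambda>k. digit_term R a k (\<omega> k)) sums F \<omega> \<and> norm (F \<omega>) \<le> C)"

lemma radius: "\<omega> \<in> space P \<Longrightarrow> (\<lambda>k. digit_term R a k (\<omega> k)) sums F \<omega>" "\<omega> \<in> space P \<Longrightarrow> norm (F \<omega>) \<le> radius"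
  using someI_ex[OF F_sums_bounded] unfolding radius_def[symmetric] by blast+

text \<open>Self-affinity: multiplying the series by the matrix lowers every exponent by one and
  turns the first term into an integer vector.\<close>

lemma F_shift:
  assumes "\<omega> \<in> space P"
  shows "A *v F \<omega> = vec_of_int (a (\<omega> 0)) + F (lshift \<omega>)"
proof -
  note inv = matrix_inv_vector[OF expansive_invertible[OF expansive]]
  have sh: "lshift \<omega> \<in> space P" using assms by (auto simp: space_P lshift_def)
  have "(\<lambda>k. A *v digit_term R a k (\<omega> k)) sums (A *v F \<omega>)"
    using bounded_linear.sums[OF matrix_vector_mul_bounded_linear radius(1)[OF assms]] .
  moreover have "(\<lambda>k. A *v digit_term R a (Suc k) (\<omega> (Suc k))) sums F (lshift \<omega>)"
    using radius(1)[OF sh] by (simp add: digit_term_def lshift_def inv)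
  then have "(\<lambda>k. A *v digit_term R a k (\<omega> k)) sums (F (lshift \<omega>) + A *v digit_term R a 0 (\<omega> 0))"
    by (rule sums_Suc)
  ultimately have "A *v F \<omega> = F (lshift \<omega>) + A *v digit_term R a 0 (\<omega> 0)" by (rule sums_unique2)
  then show ?thesis by (simp add: digit_term_def inv)
qed

text \<open>For a word of length m this is the m-th power of the matrix applied to \<open>x\<close>,
  minus an integer vector depending on the word. Along the true code of \<open>x\<close> it visits
  the values of \<open>F\<close> at the shifted code.\<close>

primrec orbit :: "nat list \<Rightarrow> real ^ 'r \<Rightarrow> real ^ 'r" where
  "orbit [] x = x"
| "orbit (i # I) x = orbit I (A *v x - vec_of_int (a i))"

lemma measurable_orbit [measurable]: "orbit I \<in> borel_measurable borel"
proof (induction I)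
  case (Cons i I)
  note [measurable] = Cons
  have [measurable]: "(\<lambda>x. A *v x) \<in> borel_measurable borel"
    by (intro borel_measurable_continuous_onI linear_continuous_on matrix_vector_mul_bounded_linear)
  have "(\<lambda>x. orbit I (A *v x - vec_of_int (a i))) \<in> borel_measurable borel" by measurable
  then show ?case by simp
qed simp

lemma orbit_step_diff:
  assumes "x - y = vec_of_int z"
  shows "(A *v x - vec_of_int (a i)) - (A *v y - vec_of_int (a j)) = vec_of_int (R *v z - a i + a j)"
proof -
  have "A *v x - A *v y = vec_of_int (R *v z)"
    using assms vec_of_int_mult[of R z] by (simp flip: matrix_vector_mult_diff_distrib)
  then show ?thesis by (simp add: vec_of_int_diff vec_of_int_add algebra_simps)
qed

lemma orbit_diff:
  "length I = length J \<Longrightarrow> x - y = vec_of_int z \<Longrightarrow> \<exists>z. orbit I x - orbit J y = vec_of_int z"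
proof (induction I J arbitrary: x y z rule: list_induct2)
  case (Cons i I j J)
  from Cons.IH[OF orbit_step_diff[OF Cons.prems]] show ?case by simp
qed auto

text \<open>The starting points may differ by an integer vector, since the induction produces such
  pairs after one step. Going back, equality after the first letters gives
  \<open>a i - a j = R *v z\<close>; the residues force \<open>i = j\<close>, and then invertibility
  forces \<open>z = 0\<close>.\<close>

lemma orbit_inj:
  "length I = length J \<Longrightarrow> set I \<subseteq> {1..N} \<Longrightarrow> set J \<subseteq> {1..N} \<Longrightarrow> x - y = vec_of_int z
    \<Longrightarrow> orbit I x = orbit J y \<Longrightarrow> I = J \<and> z = 0"
proof (induction I J arbitrary: x y z rule: list_induct2)
  case Nil
  then show ?case by (metis diff_self orbit.simps(1) vec_of_int_0 vec_of_int_inject)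
next
  case (Cons i I j J)
  have "I = J \<and> R *v z - a i + a j = 0"
    using Cons.prems by (intro Cons.IH[OF _ _ orbit_step_diff[OF Cons.prems(3)]]) auto
  then have IJ: "I = J" and Rz: "a i - a j = R *v z" by (auto simp: algebra_simps)
  have ij: "i = j" using Cons.prems by (intro residues[OF _ _ Rz]) auto
  then have "A *v vec_of_int z = 0" using Rz vec_of_int_mult[of R z] by simp
  then have "vec_of_int z = (0 :: real ^ 'r)"
    using matrix_inv_vector(2)[OF expansive_invertible[OF expansive], of "vec_of_int z"] by simp
  then show ?case using IJ ij vec_of_int_inject[of z 0] by simp
qed

section \<open>Counting the words that stay in a ball\<close>

definition words :: "nat \<Rightarrow> nat list set" where
  "words m = {I. length I = m \<and> set I \<subseteq> {1..N}}"

lemma finite_words: "finite (words m)"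
  using finite_lists_length_eq[of "{1..N}" m] by (simp add: words_def conj_commute)

text \<open>These words are the candidates for the first \<open>m\<close> letters of a code of
  \<open>x\<close>.\<close>

definition hits :: "nat \<Rightarrow> real ^ 'r \<Rightarrow> nat list set" where
  "hits m x = {I \<in> words m. norm (orbit I x) \<le> radius}"

lemma finite_hits: "finite (hits m x)"
  using finite_words by (simp add: hits_def)

definition max_hits :: nat where
  "max_hits = card {z :: int ^ 'r. norm (vec_of_int z) \<le> 2 * radius}"

text \<open>Relative to one fixed hit, each hit is an integer vector of length at most
  \<open>2 * radius\<close>, and different words give different vectors. The bound does not depend
  on \<open>m\<close>.\<close>

lemma card_hits_le: "card (hits m x) \<le> max_hits"
proof (cases "hits m x = {}")
  case False
  then obtain I0 where I0: "I0 \<in> hits m x" by auto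
  have "\<exists>z. orbit I x - orbit I0 x = vec_of_int z" if "I \<in> hits m x" for I
    by (rule orbit_diff[where z = 0]) (use that I0 in \<open>auto simp: hits_def words_def\<close>)
  then obtain z where z: "\<And>I. I \<in> hits m x \<Longrightarrow> orbit I x - orbit I0 x = vec_of_int (z I)" by metis
  have "inj_on z (hits m x)"
  proof (rule inj_onI)
    fix I J assume IJ: "I \<in> hits m x" "J \<in> hits m x" "z I = z J"
    then have "orbit I x = orbit J x" using z[of I] z[of J] by (metis diff_add_cancel)
    then have "I = J \<and> (0 :: int ^ 'r) = 0"
      by (intro orbit_inj[of I J x x]) (use IJ in \<open>auto simp: hits_def words_def\<close>)
    then show "I = J" by simp
  qed
  moreover have "z ` hits m x \<subseteq> {z. norm (vec_of_int z) \<le> 2 * radius}"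
  proof safe
    fix I assume I: "I \<in> hits m x"
    have "norm (orbit I x - orbit I0 x) \<le> radius + radius"
      using I I0 by (intro order.trans[OF norm_triangle_ineq4] add_mono) (auto simp: hits_def)
    then show "norm (vec_of_int (z I)) \<le> 2 * radius" using z[OF I] by simp
  qed
  ultimately show ?thesis unfolding max_hits_def by (intro card_inj_on_le finite_bounded_vec_of_int)
qed simp

lemma measurable_card_hits [measurable]: "(\<lambda>x. real (card (hits m x))) \<in> borel_measurable borel"
proof -
  have "real (card (hits m x)) = (\<Sum>I\<in>words m. indicator {x. norm (orbit I x) \<le> radius} x)" for x
    using finite_words[of m] by (simp add: hits_def indicator_def sum.If_cases Int_def)
  moreover have [measurable]: "{x. norm (orbit I x) \<le> radius} \<in> sets borel" for I by measurable
  ultimately show ?thesis by simp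
qed

text \<open>A wrong first letter has survived \<open>m\<close> further letters without being ruled
  out by the ball.\<close>

definition bad :: "nat \<Rightarrow> (nat \<Rightarrow> nat) set" where
  "bad m = {\<omega> \<in> space P. \<exists>i\<in>{1..N}. i \<noteq> \<omega> 0 \<and> (\<exists>I\<in>words m. norm (orbit (i # I) (F \<omega>)) \<le> radius)}"

lemma measurable_bad [measurable]: "bad m \<in> sets P"
proof -
  have [measurable]: "Measurable.pred P (\<lambda>\<omega>. \<exists>I\<in>words m. norm (orbit (i # I) (F \<omega>)) \<le> radius)" for i
    by (rule pred_intros_finite(4)[OF finite_words]) measurable
  show ?thesis unfolding bad_def by measurable
qed

text \<open>Prefixing \<open>\<omega> 0\<close> embeds the hits of the shifted point; on
  \<open>bad m\<close> there is at least one more hit, starting with another letter.\<close>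

lemma card_hits_step:
  assumes \<omega>: "\<omega> \<in> space P"
  shows "card (hits m (F (lshift \<omega>))) + indicator (bad m) \<omega> \<le> card (hits (Suc m) (F \<omega>))"
proof -
  let ?S = "(#) (\<omega> 0) ` hits m (F (lshift \<omega>))"
  have c: "card ?S = card (hits m (F (lshift \<omega>)))" by (rule card_image) (simp add: inj_on_def)
  have w0: "\<omega> 0 \<in> {1..N}" using \<omega> by (simp add: space_P)
  then have sub: "?S \<subseteq> hits (Suc m) (F \<omega>)"
    using F_shift[OF \<omega>] by (auto simp: hits_def words_def)
  show ?thesis
  proof (cases "\<omega> \<in> bad m")
    case False
    then show ?thesis using card_mono[OF finite_hits sub] c by simp
  next
    case True
    then obtain i I where i: "i \<in> {1..N}" "i \<noteq> \<omega> 0" "I \<in> words m" "norm (orbit (i # I) (F \<omega>)) \<le> radius"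
      by (auto simp: bad_def)
    then have "insert (i # I) ?S \<subseteq> hits (Suc m) (F \<omega>)" using sub by (auto simp: hits_def words_def)
    from card_mono[OF finite_hits this] show ?thesis
      using True i c finite_hits by (subst (asm) card_insert_disjoint) auto
  qed
qed

text \<open>Since the shift preserves \<open>P\<close>, the expected number of words of length \<open>m\<close> within
  \<open>radius\<close> grows at least by the probability of \<open>bad m\<close>, and it is bounded by \<open>max_hits\<close>.\<close>

lemma prob_bad_tendsto: "(\<lambda>m. P.prob (bad m)) \<longlonglongrightarrow> 0"
proof -
  define e where "e m = P.expectation (\<lambda>\<omega>. real (card (hits m (F \<omega>))))" for m
  have int: "integrable P (\<lambda>\<omega>. real (card (hits m (f \<omega>))))" if [measurable]: "f \<in> borel_measurable P" for m f
    by (rule P.integrable_const_bound[where B = max_hits]) (auto simp: card_hits_le)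
  have es: "e m = P.expectation (\<lambda>\<omega>. real (card (hits m (F (lshift \<omega>)))))" for m
    unfolding e_def by (subst (1) distr_shift[symmetric], subst integral_distr) auto
  have ind: "integrable P (indicator (bad m) :: _ \<Rightarrow> real)" for m
    by (rule P.integrable_const_bound[where B = 1]) (auto simp: indicator_def)
  have step: "e m + P.prob (bad m) \<le> e (Suc m)" for m
  proof -
    have "e m + P.prob (bad m)
      = P.expectation (\<lambda>\<omega>. real (card (hits m (F (lshift \<omega>)))) + indicator (bad m) \<omega>)"
      unfolding es using ind by (subst Bochner_Integration.integral_add) (auto intro!: int)
    also have "\<dots> \<le> e (Suc m)"
      unfolding e_def
    proof (rule integral_mono)
      fix \<omega> assume "\<omega> \<in> space P"
      from card_hits_step[OF this, of m]
      show "real (card (hits m (F (lshift \<omega>)))) + indicator (bad m) \<omega> \<le> real (card (hits (Suc m) (F \<omega>)))"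
        by (auto simp: indicator_def split: if_splits)
    qed (use ind in \<open>auto intro!: int Bochner_Integration.integrable_add\<close>)
    finally show ?thesis .
  qed
  have "incseq e" using step by (intro incseq_SucI) (metis add_increasing2 measure_nonneg order_refl order_trans)
  moreover have "e m \<le> max_hits" for m
  proof -
    have "e m \<le> P.expectation (\<lambda>_. real max_hits)"
      unfolding e_def by (intro integral_mono int) (auto simp: card_hits_le)
    then show ?thesis by (simp add: P.prob_space)
  qed
  ultimately obtain l where l: "e \<longlonglongrightarrow> l"
    using incseq_convergent[of e max_hits] by blast
  have "(\<lambda>m. e (Suc m) - e m) \<longlonglongrightarrow> l - l" by (intro tendsto_diff LIMSEQ_Suc l)
  then have lim: "(\<lambda>m. e (Suc m) - e m) \<longlonglongrightarrow> 0" by simp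
  show ?thesis
  proof (rule tendsto_sandwich[OF _ _ tendsto_const lim])
    have "P.prob (bad m) \<le> e (Suc m) - e m" for m using step[of m] by simp
    then show "\<forall>\<^sub>F m in sequentially. P.prob (bad m) \<le> e (Suc m) - e m" by simp
  qed simp
qed

section \<open>Recovering the code of a point\<close>

text \<open>A stand-in for the image under \<open>F\<close> of the sequences starting with
  \<open>i\<close>, which it contains. Its description by finite words makes it a Borel set
  directly.\<close>

definition cyl :: "nat \<Rightarrow> (real ^ 'r) set" where
  "cyl i = {x. \<forall>m. \<exists>I\<in>words m. norm (orbit (i # I) x) \<le> radius}"

lemma measurable_cyl [measurable]: "Measurable.pred borel (\<lambda>x. x \<in> cyl i)"
proof -
  have [measurable]: "Measurable.pred borel (\<lambda>x. \<exists>I\<in>words m. norm (orbit (i # I) x) \<le> radius)" for m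
    by (rule pred_intros_finite(4)[OF finite_words]) measurable
  have "Measurable.pred borel (\<lambda>x. \<forall>m. \<exists>I\<in>words m. norm (orbit (i # I) x) \<le> radius)" by measurable
  then show ?thesis by (simp add: cyl_def)
qed

lemma orbit_F: 
  assumes "\<omega> \<in> space P"
  shows "\<exists>I\<in>words m. orbit I (F \<omega>) = F ((lshift ^^ m) \<omega>)"
  using assms
proof (induction m arbitrary: \<omega>)
  case 0
  show ?case by (auto simp: words_def)
next
  case (Suc m)
  have "lshift \<omega> \<in> space P" using Suc.prems by (auto simp: space_P lshift_def)
  from Suc.IH[OF this] obtain I where "I \<in> words m" "orbit I (F (lshift \<omega>)) = F ((lshift ^^ m) (lshift \<omega>))" by auto
  moreover have "\<omega> 0 \<in> {1..N}" using Suc.prems by (simp add: space_P)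
  ultimately show ?case
    using F_shift[OF Suc.prems]
    by (intro bexI[of _ "\<omega> 0 # I"]) (auto simp: words_def funpow_swap1)
qed

lemma shift_space: "\<omega> \<in> space P \<Longrightarrow> (lshift ^^ m) \<omega> \<in> space P"
  by (induction m) (auto simp: space_P lshift_def)

lemma F_in_cyl:
  assumes \<omega>: "\<omega> \<in> space P"
  shows "F \<omega> \<in> cyl (\<omega> 0)"
  unfolding cyl_def
proof safe
  fix m
  have sh: "lshift \<omega> \<in> space P" using shift_space[OF \<omega>, of 1] by simp
  obtain I where I: "I \<in> words m" "orbit I (F (lshift \<omega>)) = F ((lshift ^^ m) (lshift \<omega>))"
    using orbit_F[OF sh] by blast
  have "norm (orbit (\<omega> 0 # I) (F \<omega>)) \<le> radius"
    using F_shift[OF \<omega>] I radius(2)[OF shift_space[OF sh]] by simp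
  then show "\<exists>I\<in>words m. norm (orbit (\<omega> 0 # I) (F \<omega>)) \<le> radius" using I by blast
qed

text \<open>The exceptional event lies in \<open>bad m\<close> for every \<open>m\<close>, and these
  probabilities tend to 0.\<close>

lemma AE_cyl_unique: "AE \<omega> in P. \<forall>i\<in>{1..N}. F \<omega> \<in> cyl i \<longrightarrow> i = \<omega> 0"
proof -
  let ?Z = "{\<omega> \<in> space P. \<not> (\<forall>i\<in>{1..N}. F \<omega> \<in> cyl i \<longrightarrow> i = \<omega> 0)}"
  have Z: "?Z \<in> sets P" by measurable
  have "P.prob ?Z \<le> P.prob (bad m)" for m
    by (rule P.finite_measure_mono) (auto simp: bad_def cyl_def simp del: orbit.simps)
  then have "P.prob ?Z \<le> 0"
    by (intro LIMSEQ_le_const[OF prob_bad_tendsto]) auto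
  then have "emeasure P ?Z = 0" by (simp add: P.emeasure_eq_measure measure_le_0_iff)
  then show ?thesis using Z by (subst AE_iff_measurable[OF Z refl])
qed

text \<open>\<open>LEAST\<close> makes a measurable choice where several letters are possible; the
  default 1 keeps the value in the alphabet at points outside all the sets
  \<open>cyl i\<close>.\<close>

definition first_symbol :: "real ^ 'r \<Rightarrow> nat" where
  "first_symbol x = (if \<exists>i\<in>{1..N}. x \<in> cyl i then LEAST i. i \<in> {1..N} \<and> x \<in> cyl i else 1)"

lemma first_symbol_range: "first_symbol x \<in> {1..N}"
proof (cases "\<exists>i. i \<in> {1..N} \<and> x \<in> cyl i")
  case True
  from LeastI_ex[OF this] show ?thesis unfolding first_symbol_def by auto
next
  case False
  then show ?thesis using N unfolding first_symbol_def by auto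
qed

lemma measurable_first_symbol [measurable]: "first_symbol \<in> measurable borel (count_space {1..N})"
proof -
  have "first_symbol \<in> measurable borel (count_space UNIV)"
    unfolding first_symbol_def[abs_def] by measurable
  then show ?thesis
    using first_symbol_range by (auto simp: measurable_count_space_eq2 intro!: measurable_sets_borel)
qed

lemma AE_first_symbol: "AE \<omega> in P. first_symbol (F \<omega>) = \<omega> 0"
  using AE_cyl_unique AE_space
proof eventually_elim
  case (elim \<omega>)
  have *: "F \<omega> \<in> cyl (\<omega> 0)" "\<omega> 0 \<in> {1..N}" using elim(2) F_in_cyl by (auto simp: space_P)
  have "(LEAST i. i \<in> {1..N} \<and> F \<omega> \<in> cyl i) = \<omega> 0"
  proof (rule Least_equality)
    fix i assume "i \<in> {1..N} \<and> F \<omega> \<in> cyl i"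
    then have "i = \<omega> 0" using elim(1) by blast
    then show "\<omega> 0 \<le> i" by simp
  qed (use * in blast)
  moreover have "\<exists>i\<in>{1..N}. F \<omega> \<in> cyl i" using * by blast
  ultimately show ?case unfolding first_symbol_def by (simp only: if_True)
qed

definition unshift :: "real ^ 'r \<Rightarrow> real ^ 'r" where
  "unshift x = A *v x - vec_of_int (a (first_symbol x))"

definition decode :: "real ^ 'r \<Rightarrow> nat \<Rightarrow> nat" where
  "decode x k = first_symbol ((unshift ^^ k) x)"

lemma measurable_decode [measurable]: "decode \<in> measurable borel P"
proof (rule measurable_into_P)
  have [measurable]: "(\<lambda>x. A *v x) \<in> borel_measurable borel"
    by (intro borel_measurable_continuous_onI linear_continuous_on matrix_vector_mul_bounded_linear)
  have [measurable]: "(\<lambda>i. vec_of_int (a i)) \<in> measurable (count_space {1..N}) (borel :: (real ^ 'r) measure)"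
    by simp
  have u: "unshift \<in> borel_measurable borel" unfolding unshift_def[abs_def] by measurable
  have [measurable]: "(unshift ^^ k) \<in> borel_measurable borel" for k
  proof (induction k)
    case (Suc k)
    from measurable_comp[OF this u] show ?case by (simp only: funpow.simps)
  qed (simp add: id_def)
  show "(\<lambda>x. decode x k) \<in> measurable borel (count_space {1..N})" for k
    unfolding decode_def[abs_def] by measurable
qed

lemma AE_shift: "AE \<omega> in P. Q \<omega> \<Longrightarrow> AE \<omega> in P. Q ((lshift ^^ k) \<omega>)"
proof (induction k)
  case (Suc k)
  have "AE \<omega> in distr P P lshift. Q ((lshift ^^ k) \<omega>)" unfolding distr_shift using Suc by blast
  then have "AE \<omega> in P. Q ((lshift ^^ k) (lshift \<omega>))" by (rule AE_distrD[rotated]) simp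
  then show ?case by (simp add: funpow_swap1)
qed simp

text \<open>Shift invariance recovers the first letter at all times at once, outside one null set.
  There \<open>unshift\<close> acts on the values of \<open>F\<close> as the shift does on codes, so
  \<open>decode\<close> is a measurable left inverse of \<open>F\<close> almost everywhere.\<close>

lemma AE_decode: "AE \<omega> in P. decode (F \<omega>) = \<omega>"
proof -
  have "AE \<omega> in P. \<forall>k. first_symbol (F ((lshift ^^ k) \<omega>)) = (lshift ^^ k) \<omega> 0"
    unfolding AE_all_countable using AE_shift[OF AE_first_symbol] by blast
  then show ?thesis using AE_space
  proof eventually_elim
    case (elim \<omega>)
    have "(unshift ^^ k) (F \<omega>) = F ((lshift ^^ k) \<omega>)" for k
    proof (induction k)
      case (Suc k)
      have "(unshift ^^ Suc k) (F \<omega>) = unshift (F ((lshift ^^ k) \<omega>))"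
        by (simp only: funpow.simps o_apply Suc)
      also have "\<dots> = F ((lshift ^^ Suc k) \<omega>)"
        using elim(1)[rule_format, of k] F_shift[OF shift_space[OF elim(2), of k]]
        by (simp add: unshift_def)
      finally show ?case .
    qed simp
    moreover have "(lshift ^^ k) \<omega> 0 = \<omega> k" for k
    proof -
      have "(lshift ^^ k) \<omega> m = \<omega> (m + k)" for m by (induction k arbitrary: m) (simp_all add: lshift_def)
      from this[of 0] show ?thesis by simp
    qed
    ultimately show ?case using elim(1) by (auto simp: decode_def fun_eq_iff)
  qed
qed

end

subsection \<open>A criterion for spectra\<close>

definition expo :: "'a::euclidean_space \<Rightarrow> 'a \<Rightarrow> complex" where
  "expo \<xi> x = cis (2 * pi * (\<xi> \<bullet> x))"

lemma measurable_expo [measurable]: "expo \<xi> \<in> borel_measurable borel"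
  unfolding expo_def[abs_def] cis_conv_exp by measurable

lemma borel_measurable_cnj [measurable (raw)]:
  "f \<in> borel_measurable M \<Longrightarrow> (\<lambda>x. cnj (f x)) \<in> borel_measurable M"
  by (rule borel_measurable_continuous_on[OF linear_continuous_on[OF bounded_linear_cnj]])

lemma norm_expo [simp]: "cmod (expo \<xi> x) = 1"
  by (simp add: expo_def)

lemma expo_0 [simp]: "expo 0 x = 1"
  by (simp add: expo_def)

lemma cnj_expo: "cnj (expo \<xi> x) = expo (- \<xi>) x"
  by (simp add: expo_def cis_cnj)

lemma expo_mult: "expo \<xi> x * expo \<zeta> x = expo (\<xi> + \<zeta>) x"
  by (simp add: expo_def cis_mult algebra_simps)

lemma expo_add: "expo \<xi> (x + y) = expo \<xi> x * expo \<xi> y"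
  by (simp add: expo_def cis_mult algebra_simps)

lemma expo_mult_cnj: "expo \<xi> x * cnj (expo \<zeta> x) = expo (\<xi> - \<zeta>) x"
  by (simp add: cnj_expo expo_mult)

definition fourier :: "'a::euclidean_space measure \<Rightarrow> 'a \<Rightarrow> complex" where
  "fourier \<nu> \<xi> = (LINT x|\<nu>. expo \<xi> x)"

text \<open>The sum of squared Fourier coefficients of \<open>expo \<xi>\<close>. As an integral of
  nonnegative extended reals it always has a value and obeys Tonelli's theorem.\<close>

definition fourier_sum :: "'a::euclidean_space measure \<Rightarrow> 'a set \<Rightarrow> 'a \<Rightarrow> ennreal" where
  "fourier_sum \<nu> \<Lambda> \<xi> = (\<integral>\<^sup>+l. ennreal ((cmod (fourier \<nu> (\<xi> - l)))\<^sup>2) \<partial>count_space \<Lambda>)"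

lemma sum_le_nn_integral_count_space:
  assumes "finite F" "F \<subseteq> \<Lambda>"
  shows "(\<Sum>l\<in>F. g l) \<le> (\<integral>\<^sup>+l. g l \<partial>count_space \<Lambda>)"
proof -
  have "(\<Sum>l\<in>F. g l) = (\<integral>\<^sup>+l. g l \<partial>count_space F)"
    using assms by (simp add: nn_integral_count_space_finite)
  also have "\<dots> = (\<integral>\<^sup>+l. g l * indicator F l \<partial>count_space \<Lambda>)"
    by (subst (1 2) nn_integral_count_space_indicator)
       (use assms in \<open>auto intro!: nn_integral_cong simp: indicator_def\<close>)
  also have "\<dots> \<le> (\<integral>\<^sup>+l. g l \<partial>count_space \<Lambda>)"
    by (intro nn_integral_mono) (auto simp: indicator_def)
  finally show ?thesis .
qed

text \<open>An enumeration of the countable set exhibits the sum as a supremum of finite partial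
  sums.\<close>

lemma nn_integral_count_space_least:
  assumes "countable \<Lambda>" and le: "\<And>F. finite F \<Longrightarrow> F \<subseteq> \<Lambda> \<Longrightarrow> (\<Sum>l\<in>F. g l) \<le> c"
  shows "(\<integral>\<^sup>+l. g l \<partial>count_space \<Lambda>) \<le> c"
proof (cases "finite \<Lambda>")
  case True
  then show ?thesis using le[of \<Lambda>] by (simp add: nn_integral_count_space_finite)
next
  case False
  have bij: "bij_betw (from_nat_into \<Lambda>) UNIV \<Lambda>" using assms(1) False by (rule bij_betw_from_nat_into)
  have "(\<integral>\<^sup>+l. g l \<partial>count_space \<Lambda>) = (\<integral>\<^sup>+n. g (from_nat_into \<Lambda> n) \<partial>count_space UNIV)"
    by (rule nn_integral_bij_count_space[OF bij, symmetric])
  also have "\<dots> = (\<Sum>n. g (from_nat_into \<Lambda> n))" by (rule nn_integral_count_space_nat)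
  also have "\<dots> = (\<Squnion>n. \<Sum>k<n. g (from_nat_into \<Lambda> k))" by (rule suminf_eq_SUP)
  also have "\<dots> \<le> c"
  proof (rule SUP_least)
    fix n
    have inj: "inj_on (from_nat_into \<Lambda>) {..<n}"
      using bij by (auto simp: bij_betw_def intro: inj_on_subset)
    have "(\<Sum>k<n. g (from_nat_into \<Lambda> k)) = (\<Sum>l\<in>from_nat_into \<Lambda> ` {..<n}. g l)"
      by (simp add: sum.reindex[OF inj])
    also have "\<dots> \<le> c" using bij by (intro le) (auto simp: bij_betw_def)
    finally show "(\<Sum>k<n. g (from_nat_into \<Lambda> k)) \<le> c" .
  qed
  finally show ?thesis .
qed

locale borel_prob = prob_space \<nu> for \<nu> :: "'a::euclidean_space measure" +
  assumes sets_\<nu> [measurable_cong]: "sets \<nu> = sets borel"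
begin

lemma space_\<nu> [simp]: "space \<nu> = UNIV"
  using sets_eq_imp_space_eq[OF sets_\<nu>] by simp

lemma prob_UNIV [simp]: "prob UNIV = 1"
  using prob_space by simp

lemma integrable_bounded:
  fixes f :: "'a \<Rightarrow> 'b::{banach, second_countable_topology}"
  assumes "f \<in> borel_measurable \<nu>" "\<And>x. norm (f x) \<le> K"
  shows "integrable \<nu> f"
  by (rule integrable_const_bound[where B = K]) (use assms in auto)

lemma fourier_0 [simp]: "fourier \<nu> 0 = 1"
  by (simp add: fourier_def prob_space)

lemma expo_inner: "(LINT x|\<nu>. expo \<xi> x * cnj (expo \<zeta> x)) = fourier \<nu> (\<xi> - \<zeta>)"
  by (simp add: fourier_def expo_mult_cnj)

definition orthogonal_exponents :: "'a set \<Rightarrow> bool" where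
  "orthogonal_exponents \<Lambda> \<longleftrightarrow> (\<forall>l\<in>\<Lambda>. \<forall>l'\<in>\<Lambda>. l \<noteq> l' \<longrightarrow> fourier \<nu> (l - l') = 0)"

lemma is_spectrum_orthogonal: "is_spectrum \<Lambda> \<nu> \<Longrightarrow> orthogonal_exponents \<Lambda>"
  unfolding is_spectrum_def orthonormal_basis_L2_def orthogonal_exponents_def
  by (simp add: expo_inner flip: expo_def)

lemma sqint_bounded:
  assumes "f \<in> borel_measurable \<nu>" "\<And>x. cmod (f x) \<le> K"
  shows "square_integrable \<nu> f"
  unfolding square_integrable_def
proof
  show "integrable \<nu> (\<lambda>x. (cmod (f x))\<^sup>2)"
    by (rule integrable_bounded[where K = "K\<^sup>2"]) (use assms in \<open>auto intro: power_mono\<close>)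
qed fact

text \<open>Expand the square, use orthonormality for the double sum and complete the square in the
  coefficients. Choosing \<open>c = \<gamma>\<close> gives Bessel's inequality; arbitrary
  \<open>c\<close> gives Parseval's identity from density.\<close>

lemma distance_expansion:
  assumes orth: "orthogonal_exponents \<Lambda>" and F: "finite F" "F \<subseteq> \<Lambda>"
    and f [measurable]: "f \<in> borel_measurable \<nu>" and K: "\<And>x. cmod (f x) \<le> K"
  defines "\<gamma> \<equiv> \<lambda>l. LINT x|\<nu>. f x * cnj (expo l x)"
  shows "(LINT x|\<nu>. (cmod (f x - (\<Sum>l\<in>F. c l * expo l x)))\<^sup>2)
    = (LINT x|\<nu>. (cmod (f x))\<^sup>2) - (\<Sum>l\<in>F. (cmod (\<gamma> l))\<^sup>2) + (\<Sum>l\<in>F. (cmod (c l - \<gamma> l))\<^sup>2)"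
proof -
  define g where "g x = (\<Sum>l\<in>F. c l * expo l x)" for x
  define G where "G = (\<Sum>l\<in>F. cmod (c l))"
  have [measurable]: "g \<in> borel_measurable \<nu>" unfolding g_def[abs_def] by measurable
  have G: "cmod (g x) \<le> G" for x
    unfolding g_def G_def by (rule sum_norm_le) (simp add: norm_mult)
  have G0: "G \<ge> 0" and K0: "K \<ge> 0"
    using G[of 0] K[of 0] norm_ge_zero order_trans by blast+
  have i1: "integrable \<nu> (\<lambda>x. f x * cnj (expo l x))" for l
    by (rule integrable_bounded[where K = K]) (use K in \<open>auto simp: norm_mult\<close>)
  have i2: "integrable \<nu> (\<lambda>x. expo l x * cnj (expo l' x))" for l l'
    by (rule integrable_bounded[where K = 1]) (auto simp: norm_mult)
  have fg: "integrable \<nu> (\<lambda>x. f x * cnj (g x))"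
    by (rule integrable_bounded[where K = "K * G"])
       (use K G K0 in \<open>auto simp: norm_mult intro!: mult_mono\<close>)
  have ff: "integrable \<nu> (\<lambda>x. (cmod (f x))\<^sup>2)" and gg: "integrable \<nu> (\<lambda>x. (cmod (g x))\<^sup>2)"
    using sqint_bounded[of f K] sqint_bounded[of g G] K G by (auto simp: square_integrable_def)
  have e1: "(LINT x|\<nu>. f x * cnj (g x)) = (\<Sum>l\<in>F. cnj (c l) * \<gamma> l)"
  proof -
    have "(LINT x|\<nu>. f x * cnj (g x)) = (LINT x|\<nu>. (\<Sum>l\<in>F. cnj (c l) * (f x * cnj (expo l x))))"
      by (simp add: g_def sum_distrib_left mult_ac)
    also have "\<dots> = (\<Sum>l\<in>F. cnj (c l) * \<gamma> l)"
      unfolding \<gamma>_def by (subst Bochner_Integration.integral_sum) (auto intro: i1)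
    finally show ?thesis .
  qed
  have e2: "of_real (LINT x|\<nu>. (cmod (g x))\<^sup>2) = (\<Sum>l\<in>F. c l * cnj (c l))"
  proof -
    have "of_real (LINT x|\<nu>. (cmod (g x))\<^sup>2) = (LINT x|\<nu>. g x * cnj (g x))"
      by (subst integral_complex_of_real[symmetric]) (simp only: complex_norm_square)
    also have "\<dots> = (LINT x|\<nu>. (\<Sum>l\<in>F. \<Sum>l'\<in>F. c l * cnj (c l') * (expo l x * cnj (expo l' x))))"
      by (simp add: g_def sum_product mult_ac)
    also have "\<dots> = (\<Sum>l\<in>F. \<Sum>l'\<in>F. c l * cnj (c l') * fourier \<nu> (l - l'))"
      by (simp add: i2 Bochner_Integration.integral_sum Bochner_Integration.integrable_sum expo_inner)
    also have "\<dots> = (\<Sum>l\<in>F. \<Sum>l'\<in>F. if l' = l then c l * cnj (c l) else 0)"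
    proof (intro sum.cong refl)
      fix l l' assume "l \<in> F" "l' \<in> F"
      then have "fourier \<nu> (l - l') = (if l' = l then 1 else 0)"
        using orth F(2) by (auto simp: orthogonal_exponents_def subset_iff)
      then show "c l * cnj (c l') * fourier \<nu> (l - l') = (if l' = l then c l * cnj (c l) else 0)" by simp
    qed
    also have "\<dots> = (\<Sum>l\<in>F. c l * cnj (c l))" using F(1) by simp
    finally show ?thesis .
  qed
  have "(LINT x|\<nu>. (cmod (f x - g x))\<^sup>2)
      = (LINT x|\<nu>. (cmod (f x))\<^sup>2 - 2 * Re (f x * cnj (g x)) + (cmod (g x))\<^sup>2)"
    by (intro Bochner_Integration.integral_cong refl)
       (simp only: cmod_power2, simp add: power2_eq_square algebra_simps)
  also have "\<dots> = (LINT x|\<nu>. (cmod (f x))\<^sup>2) - 2 * Re (LINT x|\<nu>. f x * cnj (g x)) + (LINT x|\<nu>. (cmod (g x))\<^sup>2)"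
    unfolding integral_Re[OF fg, symmetric]
    using ff gg integrable_Re[OF fg] by (simp del: times_complex.sel complex_cnj)
  also have "(LINT x|\<nu>. (cmod (g x))\<^sup>2) = (\<Sum>l\<in>F. (cmod (c l))\<^sup>2)"
    using e2 by (metis (no_types, lifting) complex_norm_square of_real_eq_iff of_real_sum sum.cong)
  also have "Re (LINT x|\<nu>. f x * cnj (g x)) = (\<Sum>l\<in>F. Re (cnj (c l) * \<gamma> l))"
    unfolding e1 by (rule Re_sum)
  also have "(LINT x|\<nu>. (cmod (f x))\<^sup>2) - 2 * (\<Sum>l\<in>F. Re (cnj (c l) * \<gamma> l)) + (\<Sum>l\<in>F. (cmod (c l))\<^sup>2)
     = (LINT x|\<nu>. (cmod (f x))\<^sup>2) - (\<Sum>l\<in>F. (cmod (\<gamma> l))\<^sup>2)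
       + (\<Sum>l\<in>F. (cmod (\<gamma> l))\<^sup>2 - 2 * Re (cnj (c l) * \<gamma> l) + (cmod (c l))\<^sup>2)"
    by (simp add: sum.distrib sum_subtractf sum_distrib_left)
  also have "(\<Sum>l\<in>F. (cmod (\<gamma> l))\<^sup>2 - 2 * Re (cnj (c l) * \<gamma> l) + (cmod (c l))\<^sup>2)
     = (\<Sum>l\<in>F. (cmod (c l - \<gamma> l))\<^sup>2)"
    by (intro sum.cong refl) (simp only: cmod_power2, simp add: power2_eq_square algebra_simps)
  finally show ?thesis by (simp add: g_def)
qed

lemma bessel:
  assumes "orthogonal_exponents \<Lambda>" "finite F" "F \<subseteq> \<Lambda>"
    and "f \<in> borel_measurable \<nu>" "\<And>x. cmod (f x) \<le> K"
  shows "(\<Sum>l\<in>F. (cmod (LINT x|\<nu>. f x * cnj (expo l x)))\<^sup>2) \<le> (LINT x|\<nu>. (cmod (f x))\<^sup>2)"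
proof -
  let ?c = "\<lambda>l. LINT x|\<nu>. f x * cnj (expo l x)"
  have "0 \<le> (LINT x|\<nu>. (cmod (f x - (\<Sum>l\<in>F. ?c l * expo l x)))\<^sup>2)" by simp
  then show ?thesis unfolding distance_expansion[OF assms, of ?c] by simp
qed

text \<open>One inequality is Bessel's; for the other, an approximation by a finite combination
  shows that finitely many coefficients already exhaust the norm up to \<epsilon>.\<close>

lemma parseval:
  assumes "is_spectrum \<Lambda> \<nu>" and f: "f \<in> borel_measurable \<nu>" "\<And>x. cmod (f x) \<le> K"
  shows "(\<integral>\<^sup>+l. ennreal ((cmod (LINT x|\<nu>. f x * cnj (expo l x)))\<^sup>2) \<partial>count_space \<Lambda>)
    = ennreal (LINT x|\<nu>. (cmod (f x))\<^sup>2)"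
proof (rule antisym)
  note orth = is_spectrum_orthogonal[OF assms(1)]
  show "(\<integral>\<^sup>+l. ennreal ((cmod (LINT x|\<nu>. f x * cnj (expo l x)))\<^sup>2) \<partial>count_space \<Lambda>)
    \<le> ennreal (LINT x|\<nu>. (cmod (f x))\<^sup>2)"
  proof (rule nn_integral_count_space_least)
    show "countable \<Lambda>" using assms(1) by (simp add: is_spectrum_def)
    show "(\<Sum>l\<in>F. ennreal ((cmod (LINT x|\<nu>. f x * cnj (expo l x)))\<^sup>2)) \<le> ennreal (LINT x|\<nu>. (cmod (f x))\<^sup>2)"
      if "finite F" "F \<subseteq> \<Lambda>" for F
      using bessel[OF orth that f] by (simp add: sum_ennreal ennreal_leI)
  qed
  show "ennreal (LINT x|\<nu>. (cmod (f x))\<^sup>2)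
    \<le> (\<integral>\<^sup>+l. ennreal ((cmod (LINT x|\<nu>. f x * cnj (expo l x)))\<^sup>2) \<partial>count_space \<Lambda>)"
  proof (rule ennreal_le_epsilon)
    fix \<epsilon> :: real assume e: "\<epsilon> > 0"
    have "square_integrable \<nu> f" by (rule sqint_bounded[OF f])
    \<comment> \<open>The definition of a basis measures distance with a root, the expansion
      without.\<close>
    moreover have "sqrt \<epsilon> > 0" using e by simp
    ultimately have "\<exists>F c. finite F \<and> F \<subseteq> \<Lambda> \<and>
        sqrt (LINT x|\<nu>. (cmod (f x - (\<Sum>l\<in>F. c l * expo l x)))\<^sup>2) < sqrt \<epsilon>"
      using assms(1) unfolding is_spectrum_def orthonormal_basis_L2_def expo_def by blast
    then obtain F c where F: "finite F" "F \<subseteq> \<Lambda>"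
      and "sqrt (LINT x|\<nu>. (cmod (f x - (\<Sum>l\<in>F. c l * expo l x)))\<^sup>2) < sqrt \<epsilon>"
      by blast
    then have "(LINT x|\<nu>. (cmod (f x))\<^sup>2) - (\<Sum>l\<in>F. (cmod (LINT x|\<nu>. f x * cnj (expo l x)))\<^sup>2)
        + (\<Sum>l\<in>F. (cmod (c l - (LINT x|\<nu>. f x * cnj (expo l x))))\<^sup>2) < \<epsilon>"
      using distance_expansion[OF orth F f, of c] by simp
    \<comment> \<open>Dropping this sum passes from the given coefficients to the optimal
      ones.\<close>
    moreover have "0 \<le> (\<Sum>l\<in>F. (cmod (c l - (LINT x|\<nu>. f x * cnj (expo l x))))\<^sup>2)" by (intro sum_nonneg) simp
    ultimately have "(LINT x|\<nu>. (cmod (f x))\<^sup>2) \<le> (\<Sum>l\<in>F. (cmod (LINT x|\<nu>. f x * cnj (expo l x)))\<^sup>2) + \<epsilon>"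
      by linarith
    then have "ennreal (LINT x|\<nu>. (cmod (f x))\<^sup>2)
      \<le> (\<Sum>l\<in>F. ennreal ((cmod (LINT x|\<nu>. f x * cnj (expo l x)))\<^sup>2)) + ennreal \<epsilon>"
      using e by (simp add: sum_ennreal ennreal_leI sum_nonneg flip: ennreal_plus)
    also have "\<dots> \<le> (\<integral>\<^sup>+l. ennreal ((cmod (LINT x|\<nu>. f x * cnj (expo l x)))\<^sup>2) \<partial>count_space \<Lambda>) + ennreal \<epsilon>"
      by (intro add_right_mono sum_le_nn_integral_count_space F)
    finally show "ennreal (LINT x|\<nu>. (cmod (f x))\<^sup>2)
      \<le> (\<integral>\<^sup>+l. ennreal ((cmod (LINT x|\<nu>. f x * cnj (expo l x)))\<^sup>2) \<partial>count_space \<Lambda>) + ennreal \<epsilon>" .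
  qed
qed

lemma fourier_sum_spectrum:
  assumes "is_spectrum \<Lambda> \<nu>"
  shows "fourier_sum \<nu> \<Lambda> \<xi> = 1"
  using parseval[OF assms, of "expo \<xi>" 1]
  by (simp add: fourier_sum_def expo_inner prob_space)

lemma fourier_sum_le_1:
  assumes "orthogonal_exponents \<Lambda>" "countable \<Lambda>"
  shows "fourier_sum \<nu> \<Lambda> \<xi> \<le> 1"
  unfolding fourier_sum_def
proof (rule nn_integral_count_space_least[OF assms(2)])
  fix F assume "finite F" "F \<subseteq> \<Lambda>"
  from bessel[OF assms(1) this, of "expo \<xi>" 1]
  show "(\<Sum>l\<in>F. ennreal ((cmod (fourier \<nu> (\<xi> - l)))\<^sup>2)) \<le> 1"
    by (simp add: expo_inner prob_space sum_ennreal)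
qed

lemma fourier_sum_ge_1:
  assumes "l \<in> \<Lambda>"
  shows "fourier_sum \<nu> \<Lambda> l \<ge> 1"
  using sum_le_nn_integral_count_space[of "{l}" \<Lambda> "\<lambda>l'. ennreal ((cmod (fourier \<nu> (l - l')))\<^sup>2)"] assms
  by (simp add: fourier_sum_def)

text \<open>The diagonal term of the sum at \<open>l\<close> is already 1, so every other term must
  vanish.\<close>

lemma orthogonal_exponentsI:
  assumes "\<And>l. l \<in> \<Lambda> \<Longrightarrow> fourier_sum \<nu> \<Lambda> l = 1"
  shows "orthogonal_exponents \<Lambda>"
  unfolding orthogonal_exponents_def
proof (intro ballI impI)
  fix l l' assume l: "l \<in> \<Lambda>" "l' \<in> \<Lambda>" "l \<noteq> l'"
  have "ennreal ((cmod (fourier \<nu> (l - l)))\<^sup>2) + ennreal ((cmod (fourier \<nu> (l - l')))\<^sup>2) \<le> 1"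
    using sum_le_nn_integral_count_space[of "{l, l'}" \<Lambda> "\<lambda>l'. ennreal ((cmod (fourier \<nu> (l - l')))\<^sup>2)"]
      l assms[OF l(1)] by (simp add: fourier_sum_def)
  then have "ennreal (1 + (cmod (fourier \<nu> (l - l')))\<^sup>2) \<le> ennreal 1"
    by (simp add: ennreal_plus)
  then have "1 + (cmod (fourier \<nu> (l - l')))\<^sup>2 \<le> 1" by (subst (asm) ennreal_le_iff) auto
  then show "fourier \<nu> (l - l') = 0" by simp
qed

end

section \<open>Trigonometric polynomials and uniform approximation\<close>

inductive_set trig_polynomials :: "('a::euclidean_space \<Rightarrow> complex) set" where
  expo: "expo \<xi> \<in> trig_polynomials"
| add: "f \<in> trig_polynomials \<Longrightarrow> g \<in> trig_polynomials \<Longrightarrow> (\<lambda>x. f x + g x) \<in> trig_polynomials"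
| scale: "f \<in> trig_polynomials \<Longrightarrow> (\<lambda>x. c * f x) \<in> trig_polynomials"

lemma trig_polynomials_const: "(\<lambda>_. c) \<in> trig_polynomials"
  using trig_polynomials.scale[OF trig_polynomials.expo[of 0], of c] by simp

lemma trig_polynomials_mult:
  assumes "f \<in> trig_polynomials" "g \<in> trig_polynomials"
  shows "(\<lambda>x. f x * g x) \<in> trig_polynomials"
  using assms(1)
proof induction
  case (expo \<xi>)
  show ?case using assms(2)
  proof induction
    case (expo \<zeta>)
    show ?case unfolding expo_mult by (rule trig_polynomials.expo)
  qed (auto simp: distrib_left mult.left_commute intro: trig_polynomials.intros)
qed (auto simp: distrib_right mult.assoc intro: trig_polynomials.intros)

lemma trig_polynomials_cnj:
  "f \<in> trig_polynomials \<Longrightarrow> (\<lambda>x. cnj (f x)) \<in> trig_polynomials"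
  by (induction rule: trig_polynomials.induct) (auto simp: cnj_expo intro: trig_polynomials.intros)

lemma trig_polynomials_continuous: "f \<in> trig_polynomials \<Longrightarrow> continuous_on S f"
  by (induction rule: trig_polynomials.induct)
     (auto simp: expo_def[abs_def] cis_conv_exp intro!: continuous_intros)

lemma trig_polynomials_separate:
  assumes "x \<noteq> (y :: 'a::euclidean_space)"
  shows "\<exists>h. (\<lambda>z. complex_of_real (h z)) \<in> trig_polynomials \<and> h x \<noteq> h y"
proof -
  \<comment> \<open>Scaled so that the inner product of \<xi> with \<open>x - y\<close> is 1/4: the
    sine below then equals 1 at \<open>x\<close>, and the phase in \<open>w\<close> makes it 0 at
    \<open>y\<close>.\<close>
  define \<xi> where "\<xi> = (1 / (4 * ((x - y) \<bullet> (x - y)))) *\<^sub>R (x - y)"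
  define w where "w z = cis (- (2 * pi * (\<xi> \<bullet> y))) * expo \<xi> z" for z
  define h where "h z = Im (w z)" for z
  have w: "w \<in> trig_polynomials" unfolding w_def[abs_def] by (intro trig_polynomials.intros)
  have "complex_of_real (h z) = (1 / (2 * \<i>)) * (w z + (- 1) * cnj (w z))" for z
    by (simp add: complex_eq_iff h_def)
  then have "(\<lambda>z. complex_of_real (h z)) \<in> trig_polynomials"
    using w by (simp only:) (intro trig_polynomials.add trig_polynomials.scale trig_polynomials_cnj)
  moreover have "h z = sin (2 * pi * (\<xi> \<bullet> (z - y)))" for z
    by (simp add: h_def w_def expo_def cis_mult algebra_simps)
  then have "h x = 1" "h y = 0"
    using assms by (simp_all add: \<xi>_def)
  ultimately show ?thesis by (metis zero_neq_one)
qed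

text \<open>The real functions that are trigonometric polynomials form an algebra containing the
  constants and separating points, so Stone-Weierstrass applies on the compact set.\<close>

lemma trig_polynomials_dense:
  fixes f :: "'a::euclidean_space \<Rightarrow> real"
  assumes "compact S" "continuous_on S f" "e > 0"
  obtains g where "g \<in> trig_polynomials" "\<And>x. x \<in> S \<Longrightarrow> cmod (of_real (f x) - g x) < e"
proof -
  interpret function_ring_on "{h. (\<lambda>x. complex_of_real (h x)) \<in> trig_polynomials}" S
  proof
    show "continuous_on S h" if h: "h \<in> {h. (\<lambda>x. complex_of_real (h x)) \<in> trig_polynomials}" for h
    proof -
      have "continuous_on S (\<lambda>x. Re (complex_of_real (h x)))"
        using h by (intro continuous_intros trig_polynomials_continuous) simp
      then show ?thesis by simp
    qed
    show "\<exists>h\<in>{h. (\<lambda>x. complex_of_real (h x)) \<in> trig_polynomials}. h x \<noteq> h y" if "x \<noteq> y" for x y :: 'a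
      using trig_polynomials_separate[OF that] by simp
  qed (use assms in \<open>auto intro: trig_polynomials.add trig_polynomials_mult trig_polynomials_const\<close>)
  obtain h where "(\<lambda>x. complex_of_real (h x)) \<in> trig_polynomials" "\<And>x. x \<in> S \<Longrightarrow> \<bar>f x - h x\<bar> < e"
    using Stone_Weierstrass_basic[OF assms(2,3)] by blast
  then show ?thesis
    by (intro that[of "\<lambda>x. complex_of_real (h x)"]) (auto simp flip: of_real_diff)
qed

lemma cmod_diff_sq_le: "(cmod (a - b))\<^sup>2 \<le> 2 * (cmod (a - c))\<^sup>2 + 2 * (cmod (c - b))\<^sup>2"
proof -
  have "(cmod (a - b))\<^sup>2 \<le> (cmod (a - c) + cmod (c - b))\<^sup>2"
    by (intro power_mono norm_diff_triangle_ineq[of a c c b, simplified] norm_ge_zero)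
  also have "\<dots> \<le> 2 * (cmod (a - c))\<^sup>2 + 2 * (cmod (c - b))\<^sup>2"
    using sum_squares_ge_zero[of "cmod (a - c) - cmod (c - b)" 0] by (simp add: power2_eq_square algebra_simps)
  finally show ?thesis .
qed

section \<open>Density in L2 and sufficiency of the criterion\<close>

context borel_prob
begin

lemma square_integrable_diff:
  assumes "square_integrable \<nu> f" "square_integrable \<nu> g"
  shows "integrable \<nu> (\<lambda>x. (cmod (f x - g x))\<^sup>2)"
proof (rule Bochner_Integration.integrable_bound)
  show "integrable \<nu> (\<lambda>x. 2 * (cmod (f x))\<^sup>2 + 2 * (cmod (g x))\<^sup>2)"
    using assms by (auto simp: square_integrable_def)
  show "(\<lambda>x. (cmod (f x - g x))\<^sup>2) \<in> borel_measurable \<nu>"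
  proof -
    have [measurable]: "f \<in> borel_measurable \<nu>" "g \<in> borel_measurable \<nu>"
      using assms by (simp_all add: square_integrable_def)
    show ?thesis by measurable
  qed
  show "AE x in \<nu>. norm ((cmod (f x - g x))\<^sup>2) \<le> norm (2 * (cmod (f x))\<^sup>2 + 2 * (cmod (g x))\<^sup>2)"
    using cmod_diff_sq_le[of _ _ 0] by simp
qed

text \<open>A closed subspace containing all exponentials is the whole L2. It is reached in stages:
  continuous functions bounded by 1, indicators of closed sets, indicators of Borel sets by a Dynkin
  argument, simple functions, and finally \<open>f\<close>. Bounded support provides the compact
  ball for uniform approximation.\<close>

lemma square_integrable_induct [consumes 1]:
  assumes f: "square_integrable \<nu> f"
    and supp: "AE x in \<nu>. norm x \<le> K"
    and sub: "\<And>f. f \<in> S \<Longrightarrow> square_integrable \<nu> f"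
    and expo: "\<And>\<xi>. expo \<xi> \<in> S"
    and add: "\<And>f g. f \<in> S \<Longrightarrow> g \<in> S \<Longrightarrow> (\<lambda>x. f x + g x) \<in> S"
    and scale: "\<And>f c. f \<in> S \<Longrightarrow> (\<lambda>x. c * f x) \<in> S"
    and lim: "\<And>f. square_integrable \<nu> f \<Longrightarrow> (\<And>\<epsilon>. \<epsilon> > 0 \<Longrightarrow> \<exists>g\<in>S. (LINT x|\<nu>. (cmod (f x - g x))\<^sup>2) < \<epsilon>) \<Longrightarrow> f \<in> S"
  shows "f \<in> S"
proof -
  have trig: "g \<in> S" if "g \<in> trig_polynomials" for g
    using that by induction (auto intro: expo add scale)
  \<comment> \<open>Pointwise limits with dominated squared error are L2 limits, so \<open>S\<close>
    is closed under them.\<close>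
  have dct: "f \<in> S" if f: "square_integrable \<nu> f" and g: "\<And>n. g n \<in> S"
    and conv: "\<And>x. (\<lambda>n. g n x) \<longlonglongrightarrow> f x"
    and W: "integrable \<nu> W" "\<And>n x. (cmod (f x - g n x))\<^sup>2 \<le> W x" for f g W
  proof (rule lim[OF f])
    fix \<epsilon> :: real assume e: "\<epsilon> > 0"
    have m: "(\<lambda>x. (cmod (f x - g n x))\<^sup>2) \<in> borel_measurable \<nu>" for n
      using square_integrable_diff[OF f sub[OF g]] by (rule borel_measurable_integrable)
    have "(\<lambda>n. LINT x|\<nu>. (cmod (f x - g n x))\<^sup>2) \<longlonglongrightarrow> (LINT x|\<nu>. 0)"
    proof (rule integral_dominated_convergence[where w = W])
      show "AE x in \<nu>. (\<lambda>n. (cmod (f x - g n x))\<^sup>2) \<longlonglongrightarrow> 0"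
      proof (rule AE_I2)
        fix x
        have "(\<lambda>n. (cmod (f x - g n x))\<^sup>2) \<longlonglongrightarrow> (cmod (f x - f x))\<^sup>2"
          by (intro tendsto_intros conv)
        then show "(\<lambda>n. (cmod (f x - g n x))\<^sup>2) \<longlonglongrightarrow> 0" by simp
      qed
    qed (use W m in auto)
    then have "eventually (\<lambda>n. (LINT x|\<nu>. (cmod (f x - g n x))\<^sup>2) < \<epsilon>) sequentially"
      using e by (intro order_tendstoD) auto
    then show "\<exists>g\<in>S. (LINT x|\<nu>. (cmod (f x - g x))\<^sup>2) < \<epsilon>"
      using g by (auto simp: eventually_sequentially)
  qed
  have cont: "(\<lambda>x. complex_of_real (h x)) \<in> S"
    if h: "continuous_on UNIV h" "\<And>x. \<bar>h x\<bar> \<le> 1" for h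
  proof (rule lim)
    have [measurable]: "h \<in> borel_measurable borel" using h(1) by (rule borel_measurable_continuous_onI)
    show hs: "square_integrable \<nu> (\<lambda>x. complex_of_real (h x))"
      by (rule sqint_bounded[where K = 1]) (use h in auto)
    fix \<epsilon> :: real assume e: "\<epsilon> > 0"
    \<comment> \<open>The bound 1 gives \<open>d\<^sup>2 \<le> d\<close>, so that a uniform error
      below \<open>d\<close> has squared mean below \<epsilon>. Outside the ball the error is
      uncontrolled, but that set is null.\<close>
    define d where "d = min 1 (\<epsilon> / 2)"
    have d: "d > 0" "d \<le> 1" "d < \<epsilon>" using e by (auto simp: d_def)
    obtain g where g: "g \<in> trig_polynomials" "\<And>x. x \<in> cball 0 K \<Longrightarrow> cmod (of_real (h x) - g x) < d"
      by (rule trig_polynomials_dense[of "cball 0 K" h d]) (use h d in \<open>auto intro: continuous_on_subset\<close>)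
    have "(LINT x|\<nu>. (cmod (of_real (h x) - g x))\<^sup>2) \<le> (LINT x|\<nu>. d)"
    proof (rule integral_mono_AE)
      show "AE x in \<nu>. (cmod (of_real (h x) - g x))\<^sup>2 \<le> d"
        using supp
      proof eventually_elim
        case (elim x)
        then have c: "cmod (of_real (h x) - g x) < d" by (intro g) simp
        have "(cmod (of_real (h x) - g x))\<^sup>2 \<le> d\<^sup>2" using c by (intro power_mono) auto
        also have "\<dots> \<le> d" using d by (simp add: power2_eq_square mult_left_le)
        finally show ?case .
      qed
    qed (use square_integrable_diff[OF hs sub[OF trig[OF g(1)]]] in auto)
    also have "\<dots> < \<epsilon>" using d by simp
    finally show "\<exists>g\<in>S. (LINT x|\<nu>. (cmod (of_real (h x) - g x))\<^sup>2) < \<epsilon>" using trig[OF g(1)] by blast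
  qed
  have zero: "(\<lambda>_. 0) \<in> S" using scale[OF expo[of 0], of 0] by simp
  have ind: "(\<lambda>x. indicator A x) \<in> S" if A: "A \<in> sets borel" for A
  proof -
    have sub: "{S :: 'a set. closed S} \<subseteq> Pow UNIV" by simp
    have closed_Int_stable: "Int_stable {S :: 'a set. closed S}" by (auto simp: Int_stable_def)
    have "A \<in> sigma_sets UNIV {S :: 'a set. closed S}"
      using A by (subst (asm) borel_eq_closed) simp
    then show ?thesis
    proof (induction rule: sigma_sets_induct_disjoint[OF closed_Int_stable sub, consumes 1, case_names basic empty compl union])
      case (basic C)
      then have C: "closed C" by simp
      show ?case
      proof (cases "C = {}")
        case True
        then show ?thesis using zero by simp
      next
        case False
        define f where "f n x = max 0 (1 - real n * infdist x C)" for n x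
        have c: "continuous_on UNIV (f n)" for n
          unfolding f_def by (intro continuous_intros)
        have bd: "0 \<le> f n x" "f n x \<le> 1" for n x
          unfolding f_def using infdist_nonneg[of x C] by (auto simp: max_def)
        have l: "(\<lambda>n. f n x) \<longlonglongrightarrow> indicator C x" for x
          unfolding f_def by (rule tendsto_indicator_closed[OF C False])
        show ?thesis
        proof (rule dct[of "indicator C" "\<lambda>n x. complex_of_real (f n x)" "\<lambda>_. 1"])
          have "indicator C \<in> borel_measurable \<nu>"
            using C by (intro borel_measurable_indicator) (simp add: sets_\<nu>)
          then show "square_integrable \<nu> (indicator C)"
            by (rule sqint_bounded[where K = 1]) (simp add: indicator_def)
          show "(\<lambda>x. complex_of_real (f n x)) \<in> S" for n
            using bd by (intro cont c) (simp add: abs_le_iff le_minus_iff order.trans[of _ 0])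
          show "(\<lambda>n. complex_of_real (f n x)) \<longlonglongrightarrow> indicator C x" for x
            using tendsto_of_real[OF l[of x], where 'a = complex] by (cases "x \<in> C") simp_all
          show "(cmod (indicator C x - complex_of_real (f n x)))\<^sup>2 \<le> 1" for n x
          proof -
            have "indicator C x - complex_of_real (f n x) = of_real (indicator C x - f n x)"
              by (simp add: indicator_def)
            moreover have "\<bar>indicator C x - f n x\<bar> \<le> 1" using bd[of n x] by (simp add: indicator_def)
            ultimately show ?thesis by (simp only: norm_of_real) (simp add: abs_square_le_1)
          qed
        qed simp
      qed
    next
      case empty
      show ?case using zero by simp
    next
      case (compl A)
      have "(\<lambda>x. expo 0 x + (- 1) * indicator A x) \<in> S" by (intro add scale expo compl)
      then show ?case by (simp add: indicator_compl[abs_def] Compl_eq_Diff_UNIV[symmetric])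
    next
      case (union A)
      have A: "A i \<in> sets borel" for i
        using union(2) by (subst borel_eq_closed) auto
      have fin: "(\<lambda>x. indicator (\<Union>i<n. A i) x :: complex) \<in> S" for n
      proof (induction n)
        case 0
        show ?case using zero by simp
      next
        case (Suc n)
        have "A n \<inter> A i = {}" if "i < n" for i
          using union(1) that unfolding disjoint_family_on_def by simp
        then have "A n \<inter> (\<Union>i<n. A i) = {}" by blast
        then have "indicator (\<Union>i<Suc n. A i) x = (indicator (A n) x + indicator (\<Union>i<n. A i) x :: complex)" for x
          by (auto simp: lessThan_Suc indicator_def)
        then show ?case using add[OF union(3)[of n] Suc] by simp
      qed
      show ?case
      proof (rule dct[of "indicator (\<Union>i. A i)" "\<lambda>n. indicator (\<Union>i<n. A i)" "\<lambda>_. 1", OF _ fin])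
        show "square_integrable \<nu> (indicator (\<Union>i. A i))"
          by (rule sqint_bounded[where K = 1]) (use A in \<open>auto simp: indicator_def\<close>)
        show "(\<lambda>n. indicator (\<Union>i<n. A i) x :: complex) \<longlonglongrightarrow> indicator (\<Union>i. A i) x" for x
          by (rule LIMSEQ_indicator_UN)
        show "(cmod (indicator (\<Union>i. A i) x - indicator (\<Union>i<n. A i) x))\<^sup>2 \<le> 1" for n x
          by (auto simp: indicator_def)
      qed simp
    qed
  qed
  have sum: "(\<lambda>x. \<Sum>i\<in>I. g i x) \<in> S" if "finite I" "\<And>i. i \<in> I \<Longrightarrow> g i \<in> S" for I :: "complex set" and g
    using that by (induction I rule: finite_induct) (auto intro: zero add)
  have fm: "f \<in> borel_measurable \<nu>" and fi: "integrable \<nu> (\<lambda>x. (cmod (f x))\<^sup>2)"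
    using f by (auto simp: square_integrable_def)
  obtain s where s: "\<And>i. simple_function \<nu> (s i)" "\<And>x. (\<lambda>i. s i x) \<longlonglongrightarrow> f x"
    "\<And>i x. dist (s i x) 0 \<le> 2 * dist (f x) 0"
    using borel_measurable_implies_sequence_metric[OF fm, of 0] by auto
  have sS: "s i \<in> S" for i
  proof -
    have fin: "finite (s i ` UNIV)" using simple_functionD(1)[OF s(1)[of i]] by simp
    have "s i -` {y} \<in> sets borel" for y
      using simple_functionD(2)[OF s(1)[of i], of "{y}"] by (simp add: sets_\<nu>)
    then have "(\<lambda>x. \<Sum>y\<in>s i ` UNIV. y * indicator (s i -` {y}) x) \<in> S"
      by (intro sum fin scale ind)
    also have "(\<lambda>x. \<Sum>y\<in>s i ` UNIV. y * indicator (s i -` {y}) x) = s i"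
    proof
      fix x
      have "(\<Sum>y\<in>s i ` UNIV. y * indicator (s i -` {y}) x) = (\<Sum>y\<in>s i ` UNIV. if y = s i x then y else 0)"
        by (intro sum.cong refl) (auto simp: indicator_def)
      also have "\<dots> = s i x" using fin by simp
      finally show "(\<Sum>y\<in>s i ` UNIV. y * indicator (s i -` {y}) x) = s i x" .
    qed
    finally show ?thesis .
  qed
  show ?thesis
  proof (rule dct[OF f sS s(2)])
    show "integrable \<nu> (\<lambda>x. 9 * (cmod (f x))\<^sup>2)" using fi by simp
    fix n x
    \<comment> \<open>The simple functions are bounded by twice \<open>f\<close>, so the difference
      is at most three times \<open>f\<close>; squaring gives the dominating factor 9.\<close>
    have "cmod (f x - s n x) \<le> 3 * cmod (f x)"
      using norm_triangle_ineq4[of "f x" "s n x"] s(3)[of n x] by simp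
    then have "(cmod (f x - s n x))\<^sup>2 \<le> (3 * cmod (f x))\<^sup>2" by (intro power_mono) auto
    then show "(cmod (f x - s n x))\<^sup>2 \<le> 9 * (cmod (f x))\<^sup>2" by (simp add: power_mult_distrib)
  qed
qed

text \<open>The values on \<Lambda> give orthogonality. At a point of \<open>D\<close>, the squared
  distance of the exponential from the closed span of \<Lambda> is 1 minus the Fourier sum, hence 0.
  Density of \<open>D\<close> and L2-continuity of \<open>expo \<xi>\<close> in \<xi> put every
  exponential into the span, which is therefore everything.\<close>

lemma is_spectrumI:
  assumes supp: "AE x in \<nu>. norm x \<le> K" and count: "countable \<Lambda>"
    and \<Lambda>: "\<And>l. l \<in> \<Lambda> \<Longrightarrow> fourier_sum \<nu> \<Lambda> l = 1"
    and D: "closure D = UNIV" "\<And>\<xi>. \<xi> \<in> D \<Longrightarrow> fourier_sum \<nu> \<Lambda> \<xi> = 1"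
  shows "is_spectrum \<Lambda> \<nu>"
proof -
  note orth = orthogonal_exponentsI[OF \<Lambda>]
  \<comment> \<open>The closed linear span of the exponentials in \<Lambda>, written with squared
    distances.\<close>
  define S where "S = {f. square_integrable \<nu> f \<and> (\<forall>\<epsilon>>0. \<exists>F c. finite F \<and> F \<subseteq> \<Lambda> \<and>
    (LINT x|\<nu>. (cmod (f x - (\<Sum>l\<in>F. c l * expo l x)))\<^sup>2) < \<epsilon>)}"
  have se: "square_integrable \<nu> (expo \<xi>)" for \<xi>
    by (rule sqint_bounded[where K = 1]) auto
  have ss: "square_integrable \<nu> (\<lambda>x. \<Sum>l\<in>F. c l * expo l x)" for F and c :: "'a \<Rightarrow> complex"
    by (rule sqint_bounded[where K = "\<Sum>l\<in>F. cmod (c l)"]) (auto simp: norm_mult intro!: sum_norm_le)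
  have lim: "f \<in> S" if f: "square_integrable \<nu> f"
    and ex: "\<And>\<epsilon>. \<epsilon> > 0 \<Longrightarrow> \<exists>g\<in>S. (LINT x|\<nu>. (cmod (f x - g x))\<^sup>2) < \<epsilon>" for f
    unfolding S_def
  proof (intro CollectI conjI allI impI f)
    fix \<epsilon> :: real assume e: "\<epsilon> > 0"
    \<comment> \<open>The squared triangle inequality doubles both errors, hence the
      quarter.\<close>
    obtain g where g: "g \<in> S" "(LINT x|\<nu>. (cmod (f x - g x))\<^sup>2) < \<epsilon> / 4"
      using ex[of "\<epsilon> / 4"] e by auto
    then have gs: "square_integrable \<nu> g" by (simp add: S_def)
    have "\<epsilon> / 4 > 0" using e by simp
    with g(1) obtain F c where F: "finite F" "F \<subseteq> \<Lambda>"
      "(LINT x|\<nu>. (cmod (g x - (\<Sum>l\<in>F. c l * expo l x)))\<^sup>2) < \<epsilon> / 4"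
      unfolding S_def by blast
    have "(LINT x|\<nu>. (cmod (f x - (\<Sum>l\<in>F. c l * expo l x)))\<^sup>2)
      \<le> (LINT x|\<nu>. 2 * (cmod (f x - g x))\<^sup>2 + 2 * (cmod (g x - (\<Sum>l\<in>F. c l * expo l x)))\<^sup>2)"
      using square_integrable_diff[OF f ss] square_integrable_diff[OF f gs] square_integrable_diff[OF gs ss]
      by (intro integral_mono cmod_diff_sq_le) auto
    also have "\<dots> = 2 * (LINT x|\<nu>. (cmod (f x - g x))\<^sup>2) + 2 * (LINT x|\<nu>. (cmod (g x - (\<Sum>l\<in>F. c l * expo l x)))\<^sup>2)"
      using square_integrable_diff[OF f gs] square_integrable_diff[OF gs ss] by simp
    also have "\<dots> < \<epsilon>" using g(2) F(3) by simp
    finally show "\<exists>F c. finite F \<and> F \<subseteq> \<Lambda> \<and> (LINT x|\<nu>. (cmod (f x - (\<Sum>l\<in>F. c l * expo l x)))\<^sup>2) < \<epsilon>"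
      using F by blast
  qed
  have expo_D: "expo \<xi> \<in> S" if "\<xi> \<in> D" for \<xi>
    unfolding S_def
  proof (intro CollectI conjI allI impI se)
    fix \<epsilon> :: real assume e: "\<epsilon> > 0"
    \<comment> \<open>The sum 1 is a supremum of finite sums, so some of them exceeds
      \<open>1 - \<epsilon>\<close>. For \<epsilon> above 1 the conversion truncates to 0, which is
      still below 1.\<close>
    have "\<exists>F. finite F \<and> F \<subseteq> \<Lambda> \<and> \<not> (\<Sum>l\<in>F. ennreal ((cmod (fourier \<nu> (\<xi> - l)))\<^sup>2)) \<le> ennreal (1 - \<epsilon>)"
    proof (rule ccontr)
      assume "\<not> ?thesis"
      then have "fourier_sum \<nu> \<Lambda> \<xi> \<le> ennreal (1 - \<epsilon>)"
        unfolding fourier_sum_def by (intro nn_integral_count_space_least count) blast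
      then have "1 \<le> ennreal (1 - \<epsilon>)" using D(2)[OF that] by simp
      moreover have "ennreal (1 - \<epsilon>) < ennreal 1" using e by (intro ennreal_lessI) auto
      ultimately show False by simp
    qed
    then obtain F where F: "finite F" "F \<subseteq> \<Lambda>"
      and "\<not> (\<Sum>l\<in>F. ennreal ((cmod (fourier \<nu> (\<xi> - l)))\<^sup>2)) \<le> ennreal (1 - \<epsilon>)" by blast
    moreover have "(\<Sum>l\<in>F. ennreal ((cmod (fourier \<nu> (\<xi> - l)))\<^sup>2)) \<le> ennreal (1 - \<epsilon>)"
      if "(\<Sum>l\<in>F. (cmod (fourier \<nu> (\<xi> - l)))\<^sup>2) \<le> 1 - \<epsilon>"
      using ennreal_leI[OF that] by (simp add: sum_ennreal)
    ultimately have *: "1 - \<epsilon> < (\<Sum>l\<in>F. (cmod (fourier \<nu> (\<xi> - l)))\<^sup>2)"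
      by (meson not_le)
    have "(LINT x|\<nu>. (cmod (expo \<xi> x - (\<Sum>l\<in>F. fourier \<nu> (\<xi> - l) * expo l x)))\<^sup>2)
        = 1 - (\<Sum>l\<in>F. (cmod (fourier \<nu> (\<xi> - l)))\<^sup>2)"
      using distance_expansion[OF orth F, of "expo \<xi>" 1 "\<lambda>l. fourier \<nu> (\<xi> - l)"]
      by (simp add: expo_inner)
    with * F show "\<exists>F c. finite F \<and> F \<subseteq> \<Lambda> \<and> (LINT x|\<nu>. (cmod (expo \<xi> x - (\<Sum>l\<in>F. c l * expo l x)))\<^sup>2) < \<epsilon>"
      by (intro exI[of _ F] exI[of _ "\<lambda>l. fourier \<nu> (\<xi> - l)"]) simp
  qed
  have expo_S: "expo \<xi> \<in> S" for \<xi>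
  proof (rule lim[OF se])
    fix \<epsilon> :: real assume e: "\<epsilon> > 0"
    have "\<xi> \<in> closure D" using D by simp
    then obtain \<zeta> where z: "\<And>n. \<zeta> n \<in> D" "\<zeta> \<longlonglongrightarrow> \<xi>" unfolding closure_sequential by blast
    have "(\<lambda>n. LINT x|\<nu>. (cmod (expo \<xi> x - expo (\<zeta> n) x))\<^sup>2) \<longlonglongrightarrow> (LINT x|\<nu>. 0)"
    proof (rule integral_dominated_convergence[where w = "\<lambda>_. 4"])
      show "AE x in \<nu>. (\<lambda>n. (cmod (expo \<xi> x - expo (\<zeta> n) x))\<^sup>2) \<longlonglongrightarrow> 0"
      proof (rule AE_I2)
        fix x
        have "(\<lambda>n. (cmod (expo \<xi> x - expo (\<zeta> n) x))\<^sup>2) \<longlonglongrightarrow> (cmod (expo \<xi> x - expo \<xi> x))\<^sup>2"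
          unfolding expo_def cis_conv_exp by (intro tendsto_intros z)
        then show "(\<lambda>n. (cmod (expo \<xi> x - expo (\<zeta> n) x))\<^sup>2) \<longlonglongrightarrow> 0" by simp
      qed
      show "AE x in \<nu>. norm ((cmod (expo \<xi> x - expo (\<zeta> n) x))\<^sup>2) \<le> 4" for n
      proof (rule AE_I2)
        fix x
        have "cmod (expo \<xi> x - expo (\<zeta> n) x) \<le> 2"
          using norm_triangle_ineq4[of "expo \<xi> x" "expo (\<zeta> n) x"] by simp
        then have "(cmod (expo \<xi> x - expo (\<zeta> n) x))\<^sup>2 \<le> 2\<^sup>2" by (intro power_mono) auto
        then show "norm ((cmod (expo \<xi> x - expo (\<zeta> n) x))\<^sup>2) \<le> 4" by simp
      qed
    qed auto
    then have "eventually (\<lambda>n. (LINT x|\<nu>. (cmod (expo \<xi> x - expo (\<zeta> n) x))\<^sup>2) < \<epsilon>) sequentially"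
      using e by (intro order_tendstoD) auto
    then show "\<exists>g\<in>S. (LINT x|\<nu>. (cmod (expo \<xi> x - g x))\<^sup>2) < \<epsilon>"
      using expo_D[OF z(1)] by (auto simp: eventually_sequentially)
  qed
  have scale_S: "(\<lambda>x. a * f x) \<in> S" if f: "f \<in> S" for f a
    unfolding S_def
  proof (intro CollectI conjI allI impI)
    have fs: "square_integrable \<nu> f" using f by (simp add: S_def)
    then show "square_integrable \<nu> (\<lambda>x. a * f x)"
      by (auto simp: square_integrable_def norm_mult power_mult_distrib)
    fix \<epsilon> :: real assume e: "\<epsilon> > 0"
    \<comment> \<open>Adding 1 keeps the denominator positive when \<open>a = 0\<close>.\<close>
    define \<delta> where "\<delta> = \<epsilon> / ((cmod a)\<^sup>2 + 1)"
    have a1: "(cmod a)\<^sup>2 + 1 > 0" by (simp add: add_nonneg_pos)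
    then have "\<delta> > 0" using e by (simp add: \<delta>_def)
    with f obtain F c where F: "finite F" "F \<subseteq> \<Lambda>"
      "(LINT x|\<nu>. (cmod (f x - (\<Sum>l\<in>F. c l * expo l x)))\<^sup>2) < \<delta>"
      unfolding S_def by blast
    have "(LINT x|\<nu>. (cmod (a * f x - (\<Sum>l\<in>F. (a * c l) * expo l x)))\<^sup>2)
      = (LINT x|\<nu>. (cmod a)\<^sup>2 * (cmod (f x - (\<Sum>l\<in>F. c l * expo l x)))\<^sup>2)"
      by (simp add: mult.assoc norm_mult power_mult_distrib flip: sum_distrib_left right_diff_distrib)
    also have "\<dots> = (cmod a)\<^sup>2 * (LINT x|\<nu>. (cmod (f x - (\<Sum>l\<in>F. c l * expo l x)))\<^sup>2)" by simp
    also have "\<dots> \<le> (cmod a)\<^sup>2 * \<delta>" using F(3) by (intro mult_left_mono) auto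
    also have "\<dots> < ((cmod a)\<^sup>2 + 1) * \<delta>" using \<open>\<delta> > 0\<close> by (simp add: algebra_simps)
    also have "\<dots> = \<epsilon>" using a1 by (simp add: \<delta>_def)
    finally show "\<exists>F c. finite F \<and> F \<subseteq> \<Lambda> \<and> (LINT x|\<nu>. (cmod (a * f x - (\<Sum>l\<in>F. c l * expo l x)))\<^sup>2) < \<epsilon>"
      using F(1,2) by (intro exI[of _ F] exI[of _ "\<lambda>l. a * c l"]) simp
  qed
  have add_S: "(\<lambda>x. f x + g x) \<in> S" if f: "f \<in> S" and g: "g \<in> S" for f g
    unfolding S_def
  proof (intro CollectI conjI allI impI)
    have fs: "square_integrable \<nu> f" and gs: "square_integrable \<nu> g" using f g by (simp_all add: S_def)
    have "square_integrable \<nu> (\<lambda>x. (- 1) * g x)" using scale_S[OF g, of "-1"] by (simp add: S_def)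
    from square_integrable_diff[OF fs this]
    show "square_integrable \<nu> (\<lambda>x. f x + g x)"
      using fs gs by (auto simp: square_integrable_def intro: borel_measurable_add)
    fix \<epsilon> :: real assume e: "\<epsilon> > 0"
    then have e4: "\<epsilon> / 4 > 0" by simp
    obtain F c where F: "finite F" "F \<subseteq> \<Lambda>"
      "(LINT x|\<nu>. (cmod (f x - (\<Sum>l\<in>F. c l * expo l x)))\<^sup>2) < \<epsilon> / 4"
      using f e4 unfolding S_def by blast
    obtain G d where G: "finite G" "G \<subseteq> \<Lambda>"
      "(LINT x|\<nu>. (cmod (g x - (\<Sum>l\<in>G. d l * expo l x)))\<^sup>2) < \<epsilon> / 4"
      using g e4 unfolding S_def by blast
    \<comment> \<open>The index sets may overlap, and on common frequencies the coefficients
      add.\<close>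
    define k where "k l = (if l \<in> F then c l else 0) + (if l \<in> G then d l else 0)" for l
    define p q where "p x = (\<Sum>l\<in>F. c l * expo l x)" and "q x = (\<Sum>l\<in>G. d l * expo l x)" for x
    have k: "(\<Sum>l\<in>F \<union> G. k l * expo l x) = p x + q x" for x
    proof -
      have "(\<Sum>l\<in>F \<union> G. k l * expo l x)
        = (\<Sum>l\<in>F \<union> G. (if l \<in> F then c l * expo l x else 0) + (if l \<in> G then d l * expo l x else 0))"
        by (intro sum.cong refl) (auto simp: k_def distrib_right)
      also have "\<dots> = p x + q x"
        using F(1) G(1)
        by (simp add: sum.distrib p_def q_def Int_absorb1 del: Int_Un_eq flip: sum.inter_restrict)
      finally show ?thesis .
    qed
    have sp: "square_integrable \<nu> p" and sq: "square_integrable \<nu> q"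
      unfolding p_def[abs_def] q_def[abs_def] by (rule ss)+
    have le: "(cmod ((f x + g x) - (p x + q x)))\<^sup>2 \<le> 2 * (cmod (f x - p x))\<^sup>2 + 2 * (cmod (g x - q x))\<^sup>2" for x
      using cmod_diff_sq_le[of "f x - p x" "q x - g x" 0] by (simp add: algebra_simps norm_minus_commute)
    have "(LINT x|\<nu>. (cmod ((f x + g x) - (p x + q x)))\<^sup>2) \<le> (LINT x|\<nu>. 2 * (cmod (f x - p x))\<^sup>2 + 2 * (cmod (g x - q x))\<^sup>2)"
    proof (rule integral_mono_AE)
      show i: "integrable \<nu> (\<lambda>x. 2 * (cmod (f x - p x))\<^sup>2 + 2 * (cmod (g x - q x))\<^sup>2)"
        using square_integrable_diff[OF fs sp] square_integrable_diff[OF gs sq] by auto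
      have "(\<lambda>x. (cmod ((f x + g x) - (p x + q x)))\<^sup>2) \<in> borel_measurable \<nu>"
      proof -
        have [measurable]: "f \<in> borel_measurable \<nu>" "g \<in> borel_measurable \<nu>"
            "p \<in> borel_measurable \<nu>" "q \<in> borel_measurable \<nu>"
          using fs gs sp sq by (simp_all add: square_integrable_def)
        show ?thesis by measurable
      qed
      then show "integrable \<nu> (\<lambda>x. (cmod ((f x + g x) - (p x + q x)))\<^sup>2)"
        by (rule Bochner_Integration.integrable_bound[OF i]) (use le in \<open>auto intro!: AE_I2\<close>)
    qed (use le in auto)
    also have "\<dots> = 2 * (LINT x|\<nu>. (cmod (f x - p x))\<^sup>2) + 2 * (LINT x|\<nu>. (cmod (g x - q x))\<^sup>2)"
      using square_integrable_diff[OF fs sp] square_integrable_diff[OF gs sq] by simp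
    also have "\<dots> < \<epsilon>" using F(3) G(3) by (simp add: p_def q_def)
    finally show "\<exists>F c. finite F \<and> F \<subseteq> \<Lambda> \<and> (LINT x|\<nu>. (cmod (f x + g x - (\<Sum>l\<in>F. c l * expo l x)))\<^sup>2) < \<epsilon>"
      using F(1,2) G(1,2) by (intro exI[of _ "F \<union> G"] exI[of _ k]) (simp add: k)
  qed
  show ?thesis
    unfolding is_spectrum_def orthonormal_basis_L2_def expo_def[symmetric]
  proof (intro conjI ballI allI impI count se)
    show "(LINT x|\<nu>. expo i x * cnj (expo j x)) = of_bool (i = j)" if "i \<in> \<Lambda>" "j \<in> \<Lambda>" for i j
      using orth that by (auto simp: expo_inner orthogonal_exponents_def)
    fix f and \<epsilon> :: real assume f: "square_integrable \<nu> f" and e: "\<epsilon> > 0"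
    have "f \<in> S"
      using f supp
      by (rule square_integrable_induct) (use lim expo_S scale_S add_S in \<open>auto simp: S_def\<close>)
    moreover have "\<epsilon>\<^sup>2 > 0" using e by simp
    ultimately obtain F c where F: "finite F" "F \<subseteq> \<Lambda>"
      "(LINT x|\<nu>. (cmod (f x - (\<Sum>l\<in>F. c l * expo l x)))\<^sup>2) < \<epsilon>\<^sup>2"
      unfolding S_def by blast
    from F(3) have "sqrt (LINT x|\<nu>. (cmod (f x - (\<Sum>l\<in>F. c l * expo l x)))\<^sup>2) < \<epsilon>"
      using e real_sqrt_less_mono[OF F(3)] by simp
    with F show "\<exists>F c. finite F \<and> F \<subseteq> \<Lambda> \<and> sqrt (LINT x|\<nu>. (cmod (f x - (\<Sum>l\<in>F. c l * expo l x)))\<^sup>2) < \<epsilon>"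
      by blast
  qed
qed

end

subsection \<open>Block vectors\<close>

definition fst_block :: "'a ^ ('r::finite + 'd::finite) \<Rightarrow> 'a ^ 'r" where
  "fst_block v = (\<chi> p. v $ Inl p)"

definition snd_block :: "'a ^ ('r::finite + 'd::finite) \<Rightarrow> 'a ^ 'd" where
  "snd_block v = (\<chi> q. v $ Inr q)"

lemma block_vec_nth [simp]: "block_vec x y $ Inl p = x $ p" "block_vec x y $ Inr q = y $ q"
  by (simp_all add: block_vec_def)

lemma block_eq_iff: "v = w \<longleftrightarrow> fst_block v = fst_block w \<and> snd_block v = snd_block w"
  by (simp add: vec_eq_iff fst_block_def snd_block_def split_sum_all)

lemma fst_block_simps [simp]:
  "fst_block (block_vec x y) = x" "fst_block (v + w) = fst_block v + fst_block w"
  "fst_block (v - w) = fst_block v - fst_block w" "fst_block 0 = 0" "fst_block (c *s v) = c *s fst_block v"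
  "fst_block (t *\<^sub>R u) = t *\<^sub>R fst_block u"
  by (simp_all add: fst_block_def vec_eq_iff)

lemma snd_block_simps [simp]:
  "snd_block (block_vec x y) = y" "snd_block (v + w) = snd_block v + snd_block w"
  "snd_block (v - w) = snd_block v - snd_block w" "snd_block 0 = 0" "snd_block (c *s v) = c *s snd_block v"
  "snd_block (t *\<^sub>R u) = t *\<^sub>R snd_block u"
  by (simp_all add: snd_block_def vec_eq_iff)

lemma sum_UNIV_Plus:
  "(\<Sum>k\<in>(UNIV :: ('r::finite + 'd::finite) set). f k) = (\<Sum>p\<in>UNIV. f (Inl p)) + (\<Sum>q\<in>UNIV. f (Inr q))"
  by (simp add: UNIV_Plus_UNIV[symmetric] sum.Plus del: UNIV_Plus_UNIV)

lemma inner_block: "v \<bullet> w = fst_block v \<bullet> fst_block w + snd_block v \<bullet> snd_block w"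
  for v w :: "real ^ ('r::finite + 'd::finite)"
  by (simp add: inner_vec_def sum_UNIV_Plus fst_block_def snd_block_def)

lemma bounded_linear_fst_block: "bounded_linear (fst_block :: real ^ ('r::finite + 'd::finite) \<Rightarrow> real ^ 'r)"
  by (rule linear_conv_bounded_linear[THEN iffD1]) (auto intro: linearI)

lemma bounded_linear_snd_block: "bounded_linear (snd_block :: real ^ ('r::finite + 'd::finite) \<Rightarrow> real ^ 'd)"
  by (rule linear_conv_bounded_linear[THEN iffD1]) (auto intro: linearI)

lemma expo_zero_right [simp]: "expo \<xi> 0 = 1"
  by (simp add: expo_def)

lemma expo_block:
  fixes v w :: "real ^ ('r::finite + 'd::finite)"
  shows "expo v w = expo (fst_block v) (fst_block w) * expo (snd_block v) (snd_block w)"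
  by (simp add: expo_def inner_block[of v w] cis_mult distrib_left)

lemma vec_of_int_block: "vec_of_int (block_vec x y) = block_vec (vec_of_int x) (vec_of_int y)"
  unfolding block_eq_iff by (simp add: fst_block_def snd_block_def vec_of_int_def)

lemma lower_block_matrix_nth [simp]:
  "lower_block_matrix A C B $ Inl p $ Inl p' = A $ p $ p'" "lower_block_matrix A C B $ Inl p $ Inr q' = 0"
  "lower_block_matrix A C B $ Inr q $ Inl p' = C $ q $ p'" "lower_block_matrix A C B $ Inr q $ Inr q' = B $ q $ q'"
  by (simp_all add: lower_block_matrix_def)

lemma map_lower_block_matrix:
  "map_matrix of_int (lower_block_matrix A C B) =
    lower_block_matrix (map_matrix of_int A) (map_matrix of_int C) (map_matrix of_int B)"
  by (simp add: vec_eq_iff split_sum_all)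

lemma fst_block_mult:
  "fst_block (lower_block_matrix A C B *v v) = A *v fst_block v"
  for A :: "'a::semiring_1 ^ 'r ^ 'r"
  by (simp add: vec_eq_iff fst_block_def matrix_vector_mult_def sum_UNIV_Plus)

lemma snd_block_mult:
  "snd_block (lower_block_matrix A C B *v v) = C *v fst_block v + B *v snd_block v"
  for A :: "'a::semiring_1 ^ 'r ^ 'r"
  by (simp add: vec_eq_iff fst_block_def snd_block_def matrix_vector_mult_def sum_UNIV_Plus)

text \<open>The first block of an eigenvector is either an eigenvector of \<open>A\<close>, or zero;
  in the latter case the second block is an eigenvector of \<open>B\<close>.\<close>

lemma expansive_lower_block_matrix:
  fixes A :: "int ^ 'r ^ 'r" and B :: "int ^ 'd ^ 'd"
  assumes "expansive A" "expansive B"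
  shows "expansive (lower_block_matrix A C B)"
  unfolding expansive_def
proof (intro allI impI, elim conjE)
  fix z :: complex and v :: "complex ^ ('r + 'd)"
  assume v: "v \<noteq> 0" and eig: "map_matrix of_int (lower_block_matrix A C B) *v v = z *s v"
  from arg_cong[OF eig, of fst_block] have 1: "map_matrix of_int A *v fst_block v = z *s fst_block v"
    by (simp add: map_lower_block_matrix fst_block_mult)
  from arg_cong[OF eig, of snd_block]
  have 2: "map_matrix of_int C *v fst_block v + map_matrix of_int B *v snd_block v = z *s snd_block v"
    by (simp add: map_lower_block_matrix snd_block_mult)
  show "1 < cmod z"
  proof (cases "fst_block v = 0")
    case True
    then have "snd_block v \<noteq> 0" using v by (simp add: block_eq_iff)
    with 2 True assms(2) show ?thesis unfolding expansive_def by auto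
  next
    case False
    with 1 assms(1) show ?thesis unfolding expansive_def by blast
  qed
qed

section \<open>One-sided bounds and mean one\<close>

lemma (in prob_space) AE_eq_1_if_ge:
  assumes [measurable]: "f \<in> borel_measurable M" and "\<And>x. x \<in> space M \<Longrightarrow> f x \<ge> (1 :: ennreal)" "(\<integral>\<^sup>+x. f x \<partial>M) = 1"
  shows "AE x in M. f x = 1"
proof -
  have "(\<integral>\<^sup>+x. f x - 1 \<partial>M) = (\<integral>\<^sup>+x. f x \<partial>M) - (\<integral>\<^sup>+x. 1 \<partial>M)"
    by (rule nn_integral_diff) (use assms in \<open>auto simp: emeasure_space_1\<close>)
  then have "AE x in M. f x - 1 = 0"
    using assms(3) by (subst nn_integral_0_iff_AE[symmetric]) (auto simp: emeasure_space_1)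
  then show ?thesis using AE_space
  proof eventually_elim
    case (elim x)
    from ennreal_minus_eq_0[OF elim(1)] assms(2)[OF elim(2)] show ?case by (rule antisym)
  qed
qed

lemma (in prob_space) AE_eq_1_if_le:
  assumes [measurable]: "f \<in> borel_measurable M" and "AE x in M. f x \<le> (1 :: ennreal)" "(\<integral>\<^sup>+x. f x \<partial>M) = 1"
  shows "AE x in M. f x = 1"
proof -
  have "(\<integral>\<^sup>+x. 1 - f x \<partial>M) = (\<integral>\<^sup>+x. 1 \<partial>M) - (\<integral>\<^sup>+x. f x \<partial>M)"
    by (rule nn_integral_diff) (use assms in auto)
  then have "AE x in M. 1 - f x = 0"
    using assms(3) by (subst nn_integral_0_iff_AE[symmetric]) (auto simp: emeasure_space_1)
  then show ?thesis using assms(2)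
    by eventually_elim (rule antisym[OF _ ennreal_minus_eq_0])
qed

subsection \<open>The self-affine measure in quasi-product form\<close>

locale quasi_product = digit_system R\<^sub>1 a N
  for R\<^sub>1 :: "int ^ 'r::finite ^ 'r" and a :: "nat \<Rightarrow> int ^ 'r" and N :: nat +
  fixes R :: "int ^ 'd::finite ^ 'd" and E :: "int ^ 'r ^ 'd" and d :: "nat \<Rightarrow> nat \<Rightarrow> int ^ 'd" and M :: nat
  assumes expansive_R: "expansive R" and M: "M \<ge> 1"
    and inj_d: "\<And>i. i \<in> {1..N} \<Longrightarrow> inj_on (d i) {1..M}"
begin

abbreviation "RR \<equiv> lower_block_matrix R\<^sub>1 E R"
abbreviation "Q \<equiv> symbol_measure M"
abbreviation "\<mu>\<^sub>1 \<equiv> self_affine_measure R\<^sub>1 (a ` {1..N})"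
abbreviation "\<mu> \<equiv> self_affine_measure RR {block_vec (a i) (d i j) | i j. i \<in> {1..N} \<and> j \<in> {1..M}}"
abbreviation "\<mu>\<^sub>\<omega> \<equiv> random_convolution R (\<lambda>i. d i ` {1..M})"

text \<open>The contribution of the digits \<open>a i\<close> alone. Its first block is
  \<open>F \<omega>\<close>; its second block, created by \<open>E\<close>, is the translation
  called H \<omega> in the overview.\<close>

definition X :: "(nat \<Rightarrow> nat) \<Rightarrow> real ^ ('r + 'd)" where
  "X = series_map (digit_term RR (\<lambda>i. block_vec (a i) 0))"

definition Y :: "(nat \<Rightarrow> nat) \<Rightarrow> (nat \<Rightarrow> nat) \<Rightarrow> real ^ 'd" where
  "Y \<omega> = series_map (\<lambda>k. digit_term R (d (\<omega> k)) k)"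

definition Z :: "(nat \<Rightarrow> nat) \<Rightarrow> (nat \<Rightarrow> nat) \<Rightarrow> real ^ ('r + 'd)" where
  "Z \<omega> \<eta> = series_map (digit_term RR (\<lambda>(i, j). block_vec (a i) (d i j))) (\<lambda>k. (\<omega> k, \<eta> k))"

lemma expansive_RR: "expansive RR"
  by (rule expansive_lower_block_matrix[OF expansive expansive_R])

sublocale Q: prob_space Q using M by (rule prob_space_symbol_measure)

sublocale PQ: pair_prob_space P Q ..

lemma space_Q: "space Q = {\<eta>. \<forall>k. \<eta> k \<in> {1..M}}"
  by (rule space_symbol_measure)

abbreviation "T \<equiv> (*v) (matrix_inv (map_matrix of_int RR :: real ^ ('r + 'd) ^ ('r + 'd)))"

text \<open>The inverse is again lower block triangular, with the inverses of the diagonal blocks on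
  its diagonal. Each identity is checked after multiplying back by the block matrix.\<close>

lemma block_inverse_powers:
  "fst_block ((T ^^ k) v) = ((*v) (matrix_inv (map_matrix of_int R\<^sub>1)) ^^ k) (fst_block v)"
  "(T ^^ k) (block_vec 0 y) = block_vec 0 (((*v) (matrix_inv (map_matrix of_int R)) ^^ k) y)"
proof -
  note inv = matrix_inv_vector[OF expansive_invertible[OF expansive_RR]]
  note inv1 = matrix_inv_vector[OF expansive_invertible[OF expansive]]
  note inv2 = matrix_inv_vector[OF expansive_invertible[OF expansive_R]]
  have f: "fst_block (T v) = matrix_inv (map_matrix of_int R\<^sub>1) *v fst_block v" for v
  proof -
    have "fst_block v = map_matrix of_int R\<^sub>1 *v fst_block (T v)"
      using arg_cong[OF inv(1)[of v], of fst_block] by (simp add: map_lower_block_matrix fst_block_mult)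
    then show ?thesis by (metis inv1(2))
  qed
  show "fst_block ((T ^^ k) v) = ((*v) (matrix_inv (map_matrix of_int R\<^sub>1)) ^^ k) (fst_block v)"
    by (induction k) (simp_all add: f)
  have "T (block_vec 0 y) = block_vec 0 (matrix_inv (map_matrix of_int R) *v y)" for y
  proof -
    have "block_vec 0 y = map_matrix of_int RR *v block_vec 0 (matrix_inv (map_matrix of_int R) *v y)"
      unfolding map_lower_block_matrix block_eq_iff fst_block_mult snd_block_mult by (simp add: inv2)
    then show ?thesis by (metis inv(2))
  qed
  then show "(T ^^ k) (block_vec 0 y) = block_vec 0 (((*v) (matrix_inv (map_matrix of_int R)) ^^ k) y)"
    by (induction k) simp_all
qed

definition digit_bound :: real where
  "digit_bound = (\<Sum>i\<in>{1..N}. norm (vec_of_int (block_vec (a i) (0 :: int ^ 'd))))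
    + (\<Sum>i\<in>{1..N}. \<Sum>j\<in>{1..M}. norm (vec_of_int (d i j)) + norm (vec_of_int (block_vec (a i) (d i j))))"

lemma digit_bound:
  assumes i: "i \<in> {1..N}"
  shows "norm (vec_of_int (block_vec (a i) (0 :: int ^ 'd))) \<le> digit_bound"
    and "j \<in> {1..M} \<Longrightarrow> norm (vec_of_int (d i j)) \<le> digit_bound"
    and "j \<in> {1..M} \<Longrightarrow> norm (vec_of_int (block_vec (a i) (d i j))) \<le> digit_bound"
proof -
  let ?s = "\<lambda>i. \<Sum>j\<in>{1..M}. norm (vec_of_int (d i j)) + norm (vec_of_int (block_vec (a i) (d i j)))"
  have s0: "0 \<le> ?s i" for i by (intro sum_nonneg) simp
  have "norm (vec_of_int (block_vec (a i) (0 :: int ^ 'd))) \<le> (\<Sum>i\<in>{1..N}. norm (vec_of_int (block_vec (a i) (0 :: int ^ 'd))))"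
    using i by (intro member_le_sum[of i _ "\<lambda>i. norm (vec_of_int (block_vec (a i) (0 :: int ^ 'd)))"]) auto
  moreover have "0 \<le> (\<Sum>i\<in>{1..N}. ?s i)" by (intro sum_nonneg s0)
  ultimately show "norm (vec_of_int (block_vec (a i) (0 :: int ^ 'd))) \<le> digit_bound" unfolding digit_bound_def by linarith
  have "?s i \<le> (\<Sum>i\<in>{1..N}. ?s i)" using i s0 by (intro member_le_sum) auto
  moreover have "0 \<le> (\<Sum>i\<in>{1..N}. norm (vec_of_int (block_vec (a i) (0 :: int ^ 'd))))" by (intro sum_nonneg) simp
  ultimately have s: "?s i \<le> digit_bound" unfolding digit_bound_def by linarith
  {
    assume j: "j \<in> {1..M}"
    have "norm (vec_of_int (d i j)) + norm (vec_of_int (block_vec (a i) (d i j))) \<le> ?s i"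
      using j by (intro member_le_sum[of j _ "\<lambda>j. norm (vec_of_int (d i j)) + norm (vec_of_int (block_vec (a i) (d i j)))"]) auto
    with s have *: "norm (vec_of_int (d i j)) + norm (vec_of_int (block_vec (a i) (d i j))) \<le> digit_bound" by linarith
    show "norm (vec_of_int (d i j)) \<le> digit_bound"
      by (rule order.trans[OF _ *]) simp
    show "norm (vec_of_int (block_vec (a i) (d i j))) \<le> digit_bound"
      by (rule order.trans[OF _ *]) simp
  }
qed

lemma series_bounds:
  obtains K where
    "\<And>\<omega>. \<omega> \<in> space P \<Longrightarrow> (\<lambda>k. digit_term RR (\<lambda>i. block_vec (a i) 0) k (\<omega> k)) sums X \<omega>"
    "\<And>\<omega> \<eta>. \<omega> \<in> space P \<Longrightarrow> \<eta> \<in> space Q \<Longrightarrow> (\<lambda>k. digit_term R (d (\<omega> k)) k (\<eta> k)) sums Y \<omega> \<eta> \<and> norm (Y \<omega> \<eta>) \<le> K"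
    "\<And>\<omega> \<eta>. \<omega> \<in> space P \<Longrightarrow> \<eta> \<in> space Q \<Longrightarrow>
      (\<lambda>k. digit_term RR (\<lambda>(i, j). block_vec (a i) (d i j)) k (\<omega> k, \<eta> k)) sums Z \<omega> \<eta> \<and> norm (Z \<omega> \<eta>) \<le> K"
proof -
  \<comment> \<open>Three bounds are taken because they concern different symbol types or matrices:
    single symbols and pairs for \<open>RR\<close>, single symbols for \<open>R\<close>.\<close>
  obtain c1 where c1: "summable c1" "\<And>k. c1 k \<ge> 0"
    "\<And>K k (u :: nat \<Rightarrow> _) s. norm (vec_of_int (u s)) \<le> K \<Longrightarrow> norm (digit_term RR u k s) \<le> c1 k * K"
    by (rule digit_term_bound[OF expansive_RR]) (blast intro: that)
  obtain c2 where c2: "summable c2" "\<And>k. c2 k \<ge> 0"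
    "\<And>K k (u :: nat \<times> nat \<Rightarrow> _) s. norm (vec_of_int (u s)) \<le> K \<Longrightarrow> norm (digit_term RR u k s) \<le> c2 k * K"
    by (rule digit_term_bound[OF expansive_RR]) (blast intro: that)
  obtain c3 where c3: "summable c3" "\<And>k. c3 k \<ge> 0"
    "\<And>K k (u :: nat \<Rightarrow> _) s. norm (vec_of_int (u s)) \<le> K \<Longrightarrow> norm (digit_term R u k s) \<le> c3 k * K"
    by (rule digit_term_bound[OF expansive_R]) (blast intro: that)
  let ?K2 = "suminf (\<lambda>k. c2 k * digit_bound)" and ?K3 = "suminf (\<lambda>k. c3 k * digit_bound)"
  show ?thesis
  proof (rule that[of "max ?K2 ?K3"])
    fix \<omega> assume w: "\<omega> \<in> space P"
    have b1: "norm (digit_term RR (\<lambda>i. block_vec (a i) 0) k (\<omega> k)) \<le> c1 k * digit_bound" for k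
      by (rule c1(3), rule digit_bound) (use w in \<open>simp add: space_P\<close>)
    show "(\<lambda>k. digit_term RR (\<lambda>i. block_vec (a i) 0) k (\<omega> k)) sums X \<omega>"
      unfolding X_def
      using series_map_sums(1)[of "digit_term RR (\<lambda>i. block_vec (a i) 0)" \<omega> "\<lambda>k. c1 k * digit_bound", OF b1 summable_mult2[OF c1(1)]] .
    fix \<eta> assume e: "\<eta> \<in> space Q"
    have b3: "norm (digit_term R (d (\<omega> k)) k (\<eta> k)) \<le> c3 k * digit_bound" for k
      by (rule c3(3), rule digit_bound) (use w e in \<open>auto simp: space_P space_Q\<close>)
    show "(\<lambda>k. digit_term R (d (\<omega> k)) k (\<eta> k)) sums Y \<omega> \<eta> \<and> norm (Y \<omega> \<eta>) \<le> max ?K2 ?K3"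
      using series_map_sums[of "\<lambda>k. digit_term R (d (\<omega> k)) k" \<eta> "\<lambda>k. c3 k * digit_bound", OF b3 summable_mult2[OF c3(1)]]
      unfolding Y_def by (simp add: le_max_iff_disj)
    have b2: "norm (digit_term RR (\<lambda>(i, j). block_vec (a i) (d i j)) k (\<omega> k, \<eta> k)) \<le> c2 k * digit_bound" for k
      by (rule c2(3), simp only: prod.case, rule digit_bound) (use w e in \<open>auto simp: space_P space_Q\<close>)
    show "(\<lambda>k. digit_term RR (\<lambda>(i, j). block_vec (a i) (d i j)) k (\<omega> k, \<eta> k)) sums Z \<omega> \<eta> \<and> norm (Z \<omega> \<eta>) \<le> max ?K2 ?K3"
      using series_map_sums[of "digit_term RR (\<lambda>(i, j). block_vec (a i) (d i j))" "\<lambda>k. (\<omega> k, \<eta> k)" "\<lambda>k. c2 k * digit_bound", OF b2 summable_mult2[OF c2(1)]]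
      unfolding Z_def by (simp add: le_max_iff_disj)
  qed
qed

text \<open>Each digit splits as (a, 0) + (0, d), and powers of the inverse keep (0, d) in the
  second block, where they act as powers of the inverse of \<open>R\<close>.\<close>

lemma Z_eq:
  assumes "\<omega> \<in> space P" "\<eta> \<in> space Q"
  shows "Z \<omega> \<eta> = X \<omega> + block_vec 0 (Y \<omega> \<eta>)"
proof -
  obtain K where s: "(\<lambda>k. digit_term RR (\<lambda>i. block_vec (a i) 0) k (\<omega> k)) sums X \<omega>"
    "(\<lambda>k. digit_term R (d (\<omega> k)) k (\<eta> k)) sums Y \<omega> \<eta>"
    "(\<lambda>k. digit_term RR (\<lambda>(i, j). block_vec (a i) (d i j)) k (\<omega> k, \<eta> k)) sums Z \<omega> \<eta>"
    by (rule series_bounds) (use assms in blast)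
  have lin: "bounded_linear (block_vec 0 :: real ^ 'd \<Rightarrow> real ^ ('r + 'd))"
    by (rule linear_conv_bounded_linear[THEN iffD1]) (auto intro!: linearI simp: block_eq_iff)
  have "(\<lambda>k. digit_term RR (\<lambda>i. block_vec (a i) 0) k (\<omega> k) + block_vec 0 (digit_term R (d (\<omega> k)) k (\<eta> k)))
      sums (X \<omega> + block_vec 0 (Y \<omega> \<eta>))"
    by (intro sums_add s bounded_linear.sums[OF lin])
  moreover have "digit_term RR (\<lambda>i. block_vec (a i) 0) k (\<omega> k) + block_vec 0 (digit_term R (d (\<omega> k)) k (\<eta> k))
      = digit_term RR (\<lambda>(i, j). block_vec (a i) (d i j)) k (\<omega> k, \<eta> k)" for k
  proof -
    have v: "vec_of_int (block_vec (a (\<omega> k)) (d (\<omega> k) (\<eta> k)))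
        = vec_of_int (block_vec (a (\<omega> k)) 0) + block_vec 0 (vec_of_int (d (\<omega> k) (\<eta> k)))"
      by (simp add: vec_of_int_block block_eq_iff)
    show ?thesis
      unfolding digit_term_def prod.case v funpow_matrix_add block_inverse_powers(2) ..
  qed
  ultimately show ?thesis using s(3) by (metis (no_types, lifting) sums_cong sums_unique2)
qed

lemma fst_block_X:
  assumes "\<omega> \<in> space P"
  shows "fst_block (X \<omega>) = F \<omega>"
proof -
  obtain K where s: "(\<lambda>k. digit_term RR (\<lambda>i. block_vec (a i) 0) k (\<omega> k)) sums X \<omega>"
    by (rule series_bounds) (use assms in blast)
  have "(\<lambda>k. fst_block (digit_term RR (\<lambda>i. block_vec (a i) 0) k (\<omega> k))) sums fst_block (X \<omega>)"
    by (rule bounded_linear.sums[OF bounded_linear_fst_block s])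
  moreover have "fst_block (digit_term RR (\<lambda>i. block_vec (a i) 0) k (\<omega> k)) = digit_term R\<^sub>1 a k (\<omega> k)" for k
    unfolding digit_term_def block_inverse_powers(1) by (simp add: vec_of_int_block)
  ultimately show ?thesis using radius(1)[OF assms] by (simp add: sums_unique2)
qed

lemma digit_term_measurable_ucm: "digit_term G u k \<in> borel_measurable (uniform_count_measure S)"
  by (auto simp: measurable_def sets_uniform_count_measure space_uniform_count_measure)

lemma measurable_X [measurable]: "X \<in> borel_measurable P"
  unfolding X_def symbol_measure_def by (rule series_map_measurable) (rule digit_term_measurable_ucm)

lemma measurable_Y [measurable]: "Y \<omega> \<in> borel_measurable Q"
  unfolding Y_def symbol_measure_def by (rule series_map_measurable) (rule digit_term_measurable_ucm)

text \<open>A sequence of independent uniform pairs is the same as a pair of independent uniform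
  sequences.\<close>

lemma zip_distr:
  "(\<lambda>(\<omega>, \<eta>) k. (\<omega> k, \<eta> k)) \<in> measurable (P \<Otimes>\<^sub>M Q) (PiM UNIV (\<lambda>_. uniform_count_measure ({1..N} \<times> {1..M})))"
  "distr (P \<Otimes>\<^sub>M Q) (PiM UNIV (\<lambda>_. uniform_count_measure ({1..N} \<times> {1..M}))) (\<lambda>(\<omega>, \<eta>) k. (\<omega> k, \<eta> k))
    = PiM UNIV (\<lambda>_. uniform_count_measure ({1..N} \<times> {1..M}))"
proof -
  have p: "uniform_count_measure ({1..N} \<times> {1..M}) = uniform_count_measure {1..N} \<Otimes>\<^sub>M uniform_count_measure {1..M}"
    using N M by (intro uniform_count_measure_pair[symmetric]) auto
  show "distr (P \<Otimes>\<^sub>M Q) (PiM UNIV (\<lambda>_. uniform_count_measure ({1..N} \<times> {1..M}))) (\<lambda>(\<omega>, \<eta>) k. (\<omega> k, \<eta> k))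
    = PiM UNIV (\<lambda>_. uniform_count_measure ({1..N} \<times> {1..M}))"
    unfolding symbol_measure_def p using N M by (intro PiM_pair_zip prob_space_uniform_count_measure) auto
  show "(\<lambda>(\<omega>, \<eta>) k. (\<omega> k, \<eta> k)) \<in> measurable (P \<Otimes>\<^sub>M Q) (PiM UNIV (\<lambda>_. uniform_count_measure ({1..N} \<times> {1..M})))"
    unfolding symbol_measure_def p
    by (intro measurable_PiM_single') (auto simp: space_pair_measure space_PiM split_beta')
qed

lemma measurable_series_pairs:
  "series_map (digit_term RR (\<lambda>(i, j). block_vec (a i) (d i j)))
    \<in> borel_measurable (PiM UNIV (\<lambda>_. uniform_count_measure ({1..N} \<times> {1..M})))"
  by (rule series_map_measurable) (rule digit_term_measurable_ucm)

lemma measurable_Z [measurable]: "(\<lambda>(\<omega>, \<eta>). Z \<omega> \<eta>) \<in> borel_measurable (P \<Otimes>\<^sub>M Q)"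
  using measurable_comp[OF zip_distr(1) measurable_series_pairs] unfolding Z_def
  by (simp add: o_def split_beta')

lemma \<mu>\<^sub>1_eq: "\<mu>\<^sub>1 = distr P borel F"
proof -
  have "inj_on a {1..N}" using residues[where z = 0] by (intro inj_onI) simp
  moreover have "norm (vec_of_int (a i)) \<le> (\<Sum>i\<in>{1..N}. norm (vec_of_int (a i)))" if "i \<in> {1..N}" for i
    using that by (intro member_le_sum) auto
  ultimately show ?thesis
    unfolding self_affine_measure_def F_def symbol_measure_def using N
    by (intro infinite_convolution_digits[OF expansive, where d = "\<lambda>_. a"]) auto
qed

lemma \<mu>\<^sub>\<omega>_eq:
  assumes "\<omega> \<in> space P"
  shows "\<mu>\<^sub>\<omega> \<omega> = distr Q borel (Y \<omega>)"
proof -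
  have w: "\<omega> k \<in> {1..N}" for k using assms by (simp add: space_P)
  have "{1..M} \<noteq> {}" using M by simp
  then show ?thesis
    unfolding random_convolution_def Y_def symbol_measure_def[of M]
    by (rule infinite_convolution_digits[OF expansive_R finite_atLeastAtMost, where d = "\<lambda>k. d (\<omega> k)"])
       (rule inj_d[OF w], rule digit_bound(2)[OF w])
qed

text \<open>The digits of \<open>RR\<close> are indexed injectively by pairs of symbols, so the
  measure is the law of a series over sequences of pairs; zipping transports it to the product of
  the two symbol spaces.\<close>

lemma \<mu>_eq: "\<mu> = distr (P \<Otimes>\<^sub>M Q) borel (\<lambda>(\<omega>, \<eta>). Z \<omega> \<eta>)"
proof -
  let ?b = "\<lambda>(i, j). block_vec (a i) (d i j)"
  let ?D = "uniform_count_measure ({1..N} \<times> {1..M})"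
  have inj_a: "inj_on a {1..N}" using residues[where z = 0] by (intro inj_onI) simp
  have inj: "inj_on ?b ({1..N} \<times> {1..M})"
  proof (rule inj_onI)
    fix p q assume pq: "p \<in> {1..N} \<times> {1..M}" "q \<in> {1..N} \<times> {1..M}" "?b p = ?b q"
    then have "a (fst p) = a (fst q)" and d: "d (fst p) (snd p) = d (fst q) (snd q)"
      by (simp_all add: split_beta' block_eq_iff)
    with pq have f: "fst p = fst q" by (intro inj_onD[OF inj_a]) auto
    with pq d have "snd p = snd q" by (intro inj_onD[OF inj_d[of "fst p"]]) auto
    with f show "p = q" by (rule prod_eqI)
  qed
  have ne: "{1..N} \<times> {1..M} \<noteq> {}" using N M by simp
  have bd: "norm (vec_of_int (?b s)) \<le> digit_bound" if "s \<in> {1..N} \<times> {1..M}" for s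
    using that digit_bound(3)[of "fst s" "snd s"] by (simp add: split_beta' mem_Times_iff)
  have conv: "infinite_convolution (\<lambda>k. uniform_point_measure (scaled_digits RR (Suc k) (?b ` ({1..N} \<times> {1..M}))))
      = distr (PiM UNIV (\<lambda>_. ?D)) borel (series_map (digit_term RR ?b))"
    by (rule infinite_convolution_digits[OF expansive_RR _ ne, where d = "\<lambda>_. ?b"]) (simp, rule inj, rule bd)
  have "{block_vec (a i) (d i j) | i j. i \<in> {1..N} \<and> j \<in> {1..M}} = ?b ` ({1..N} \<times> {1..M})"
    by auto blast
  then have "\<mu> = distr (PiM UNIV (\<lambda>_. ?D)) borel (series_map (digit_term RR ?b))"
    unfolding self_affine_measure_def using conv by (simp only:)
  also have "\<dots> = distr (distr (P \<Otimes>\<^sub>M Q) (PiM UNIV (\<lambda>_. ?D)) (\<lambda>(\<omega>, \<eta>) k. (\<omega> k, \<eta> k))) borel (series_map (digit_term RR ?b))"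
    by (simp only: zip_distr(2))
  also have "\<dots> = distr (P \<Otimes>\<^sub>M Q) borel (\<lambda>(\<omega>, \<eta>). Z \<omega> \<eta>)"
    by (subst distr_distr[OF measurable_series_pairs zip_distr(1)]) (simp add: o_def Z_def split_beta')
  finally show ?thesis .
qed

lemma borel_prob_\<mu>\<^sub>1: "borel_prob \<mu>\<^sub>1"
  unfolding \<mu>\<^sub>1_eq by (intro borel_prob.intro borel_prob_axioms.intro P.prob_space_distr) simp_all

lemma borel_prob_\<mu>\<^sub>\<omega>: "\<omega> \<in> space P \<Longrightarrow> borel_prob (\<mu>\<^sub>\<omega> \<omega>)"
  unfolding \<mu>\<^sub>\<omega>_eq by (intro borel_prob.intro borel_prob_axioms.intro Q.prob_space_distr) simp_all

lemma borel_prob_\<mu>: "borel_prob \<mu>"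
  unfolding \<mu>_eq by (intro borel_prob.intro borel_prob_axioms.intro PQ.prob_space_distr) simp_all

lemma AE_bounded:
  obtains K where "AE x in \<mu>. norm x \<le> K" "\<And>\<omega>. \<omega> \<in> space P \<Longrightarrow> AE x in \<mu>\<^sub>\<omega> \<omega>. norm x \<le> K"
proof -
  obtain K where
    Y: "\<And>\<omega> \<eta>. \<omega> \<in> space P \<Longrightarrow> \<eta> \<in> space Q \<Longrightarrow> norm (Y \<omega> \<eta>) \<le> K" and
    Z: "\<And>\<omega> \<eta>. \<omega> \<in> space P \<Longrightarrow> \<eta> \<in> space Q \<Longrightarrow> norm (Z \<omega> \<eta>) \<le> K"
    by (rule series_bounds) blast
  show ?thesis
  proof (rule that[of K])
    show "AE x in \<mu>. norm x \<le> K"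
      unfolding \<mu>_eq
      by (subst AE_distr_iff) (auto simp: space_pair_measure intro!: AE_I2 Z)
    show "AE x in \<mu>\<^sub>\<omega> \<omega>. norm x \<le> K" if "\<omega> \<in> space P" for \<omega>
      unfolding \<mu>\<^sub>\<omega>_eq[OF that]
      by (subst AE_distr_iff) (auto intro!: AE_I2 Y that)
  qed
qed

section \<open>Disintegration of the Fourier sum\<close>

text \<open>Here the injectivity of \<open>F\<close> is used: composing \<open>u\<close> with
  \<open>decode\<close> turns a bounded function of codes into a function of points, to which
  Parseval's identity for \<open>\<mu>\<^sub>1\<close> applies.\<close>

lemma parseval_decoded:
  assumes spec: "is_spectrum \<Lambda>\<^sub>1 \<mu>\<^sub>1" and [measurable]: "u \<in> borel_measurable P"
    and b: "\<And>\<omega>. \<omega> \<in> space P \<Longrightarrow> cmod (u \<omega>) \<le> b"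
  shows "(\<integral>\<^sup>+l. ennreal ((cmod (LINT \<omega>|P. u \<omega> * cnj (expo l (F \<omega>))))\<^sup>2) \<partial>count_space \<Lambda>\<^sub>1)
    = (\<integral>\<^sup>+\<omega>. ennreal ((cmod (u \<omega>))\<^sup>2) \<partial>P)"
proof -
  interpret \<mu>\<^sub>1: borel_prob "\<mu>\<^sub>1" by (rule borel_prob_\<mu>\<^sub>1)
  define g where "g x = u (decode x)" for x
  have [measurable]: "g \<in> borel_measurable borel" unfolding g_def[abs_def] by measurable
  \<comment> \<open>The bound holds at every point, since \<open>decode\<close> always takes values
    in the space of codes.\<close>
  have g_le: "cmod (g x) \<le> b" for x
    unfolding g_def by (rule b) (rule measurable_space[OF measurable_decode], simp)
  have AE: "AE \<omega> in P. g (F \<omega>) = u \<omega>"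
    using AE_decode by eventually_elim (simp add: g_def)
  have 1: "(LINT x|\<mu>\<^sub>1. g x * cnj (expo l x)) = (LINT \<omega>|P. u \<omega> * cnj (expo l (F \<omega>)))" for l
    unfolding \<mu>\<^sub>1_eq by (subst integral_distr) (use AE in \<open>auto intro!: integral_cong_AE\<close>)
  have 2: "(LINT x|\<mu>\<^sub>1. (cmod (g x))\<^sup>2) = (LINT \<omega>|P. (cmod (u \<omega>))\<^sup>2)"
    unfolding \<mu>\<^sub>1_eq by (subst integral_distr) (use AE in \<open>auto intro!: integral_cong_AE\<close>)
  have "g \<in> borel_measurable \<mu>\<^sub>1" unfolding \<mu>\<^sub>1_eq by simp
  from \<mu>\<^sub>1.parseval[OF spec this g_le]
  have "(\<integral>\<^sup>+l. ennreal ((cmod (LINT \<omega>|P. u \<omega> * cnj (expo l (F \<omega>))))\<^sup>2) \<partial>count_space \<Lambda>\<^sub>1)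
    = ennreal (LINT \<omega>|P. (cmod (u \<omega>))\<^sup>2)" by (simp only: 1 2)
  also have "\<dots> = (\<integral>\<^sup>+\<omega>. ennreal ((cmod (u \<omega>))\<^sup>2) \<partial>P)"
    by (rule nn_integral_eq_integral[symmetric], rule P.integrable_const_bound[where B = "b\<^sup>2"])
       (auto intro!: AE_I2 power_mono b)
  finally show ?thesis .
qed

text \<open>\<open>\<phi> \<zeta> \<omega>\<close> is the Fourier transform of \<open>\<mu>\<^sub>\<omega> \<omega>\<close>; it is written through \<open>Z - X\<close>, because the joint
  measurability of \<open>Z\<close> makes the measurability in \<open>\<omega>\<close> visible.\<close>

definition \<phi> :: "real ^ 'd \<Rightarrow> (nat \<Rightarrow> nat) \<Rightarrow> complex" where
  "\<phi> \<zeta> \<omega> = (LINT \<eta>|Q. expo \<zeta> (snd_block (Z \<omega> \<eta> - X \<omega>)))"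

lemma measurable_snd_block [measurable]: "snd_block \<in> borel_measurable (borel :: (real ^ ('r + 'd)) measure)"
  by (intro borel_measurable_continuous_onI linear_continuous_on bounded_linear_snd_block)

lemma measurable_\<phi> [measurable]: "\<phi> \<zeta> \<in> borel_measurable P"
  unfolding \<phi>_def[abs_def]
proof (rule Q.borel_measurable_lebesgue_integral)
  have [measurable]: "(\<lambda>p. Z (fst p) (snd p)) \<in> borel_measurable (P \<Otimes>\<^sub>M Q)"
    using measurable_Z by (simp add: split_beta')
  show "(\<lambda>(\<omega>, \<eta>). expo \<zeta> (snd_block (Z \<omega> \<eta> - X \<omega>))) \<in> borel_measurable (P \<Otimes>\<^sub>M Q)"
    unfolding split_beta' by measurable
qed

lemma \<phi>_eq_fourier:
  assumes "\<omega> \<in> space P"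
  shows "\<phi> \<zeta> \<omega> = fourier (\<mu>\<^sub>\<omega> \<omega>) \<zeta>"
proof -
  have "\<phi> \<zeta> \<omega> = (LINT \<eta>|Q. expo \<zeta> (Y \<omega> \<eta>))"
    unfolding \<phi>_def by (intro Bochner_Integration.integral_cong refl) (simp add: Z_eq[OF assms])
  then show ?thesis
    unfolding fourier_def \<mu>\<^sub>\<omega>_eq[OF assms] by (simp add: integral_distr)
qed

lemma norm_\<phi>: "cmod (\<phi> \<zeta> \<omega>) \<le> 1"
proof -
  have "cmod (\<phi> \<zeta> \<omega>) \<le> (LINT \<eta>|Q. norm (expo \<zeta> (snd_block (Z \<omega> \<eta> - X \<omega>))))"
    unfolding \<phi>_def by (rule integral_norm_bound)
  then show ?thesis using Q.prob_space by simp
qed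

text \<open>Fubini, with the variable \<eta> integrated first: given \<omega>, it occurs only
  through \<open>Y \<omega> \<eta>\<close> in the second block, and its integral is
  \<open>\<phi>\<close>.\<close>

lemma fourier_\<mu>:
  "fourier \<mu> \<xi> = (LINT \<omega>|P. expo (fst_block \<xi>) (F \<omega>) * expo (snd_block \<xi>) (snd_block (X \<omega>)) * \<phi> (snd_block \<xi>) \<omega>)"
proof -
  have [measurable]: "(\<lambda>p. Z (fst p) (snd p)) \<in> borel_measurable (P \<Otimes>\<^sub>M Q)"
    using measurable_Z by (simp add: split_beta')
  have int: "integrable (P \<Otimes>\<^sub>M Q) (\<lambda>p. expo \<xi> (Z (fst p) (snd p)))"
    by (rule PQ.integrable_const_bound[where B = 1]) auto
  have "fourier \<mu> \<xi> = (LINT p|(P \<Otimes>\<^sub>M Q). expo \<xi> (Z (fst p) (snd p)))"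
    unfolding fourier_def \<mu>_eq by (subst integral_distr) (auto simp: split_beta')
  also have "\<dots> = (LINT \<omega>|P. LINT \<eta>|Q. expo \<xi> (Z \<omega> \<eta>))"
    using PQ.integral_fst'[OF int] by simp
  also have "\<dots> = (LINT \<omega>|P. expo (fst_block \<xi>) (F \<omega>) * expo (snd_block \<xi>) (snd_block (X \<omega>)) * \<phi> (snd_block \<xi>) \<omega>)"
  proof (rule Bochner_Integration.integral_cong[OF refl])
    fix \<omega> assume w: "\<omega> \<in> space P"
    have "(LINT \<eta>|Q. expo \<xi> (Z \<omega> \<eta>))
      = (LINT \<eta>|Q. (expo (fst_block \<xi>) (F \<omega>) * expo (snd_block \<xi>) (snd_block (X \<omega>))) * expo (snd_block \<xi>) (snd_block (Z \<omega> \<eta> - X \<omega>)))"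
      by (intro Bochner_Integration.integral_cong refl)
         (simp add: Z_eq[OF w] expo_block[of \<xi>] fst_block_X[OF w] expo_add)
    then show "(LINT \<eta>|Q. expo \<xi> (Z \<omega> \<eta>))
      = expo (fst_block \<xi>) (F \<omega>) * expo (snd_block \<xi>) (snd_block (X \<omega>)) * \<phi> (snd_block \<xi>) \<omega>"
      by (simp add: \<phi>_def)
  qed
  finally show ?thesis .
qed

text \<open>For fixed l2, the sum over \<Lambda>_1 is a Parseval sum of a function whose modulus is
  that of \<open>\<phi>\<close>, because the remaining exponentials have modulus one. This removes
  the first block of \<xi>, and Tonelli exchanges the sum over l2 with the integral over
  \<omega>.\<close>

lemma fourier_sum_\<mu>:
  assumes spec: "is_spectrum \<Lambda>\<^sub>1 \<mu>\<^sub>1" and count: "countable \<Lambda>\<^sub>2"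
  shows "fourier_sum \<mu> (block_Times \<Lambda>\<^sub>1 \<Lambda>\<^sub>2) \<xi> = (\<integral>\<^sup>+\<omega>. fourier_sum (\<mu>\<^sub>\<omega> \<omega>) \<Lambda>\<^sub>2 (snd_block \<xi>) \<partial>P)"
    and "(\<lambda>\<omega>. fourier_sum (\<mu>\<^sub>\<omega> \<omega>) \<Lambda>\<^sub>2 \<zeta>) \<in> borel_measurable P"
proof -
  have count1: "countable \<Lambda>\<^sub>1" using spec by (simp add: is_spectrum_def)
  interpret c: pair_sigma_finite "count_space \<Lambda>\<^sub>1" "count_space \<Lambda>\<^sub>2"
    using count count1 by (intro pair_sigma_finite.intro sigma_finite_measure_count_space_countable)
  interpret Pc: pair_sigma_finite P "count_space \<Lambda>\<^sub>2"
    using count by (intro pair_sigma_finite.intro sigma_finite_measure_count_space_countable P.sigma_finite_measure_axioms)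
  have cong: "fourier_sum (\<mu>\<^sub>\<omega> \<omega>) \<Lambda>\<^sub>2 \<zeta> = (\<integral>\<^sup>+l2. ennreal ((cmod (\<phi> (\<zeta> - l2) \<omega>))\<^sup>2) \<partial>count_space \<Lambda>\<^sub>2)"
    if "\<omega> \<in> space P" for \<omega> \<zeta>
    unfolding fourier_sum_def using \<phi>_eq_fourier[OF that] by simp
  \<comment> \<open>Joint measurability holds because the coordinate l2 ranges over a countable
    discrete space.\<close>
  have "(\<lambda>(l2, \<omega>). ennreal ((cmod (\<phi> (\<zeta> - l2) \<omega>))\<^sup>2)) \<in> borel_measurable (count_space \<Lambda>\<^sub>2 \<Otimes>\<^sub>M P)" for \<zeta>
    by (rule measurable_pair_measure_countable1[OF count]) simp
  then have joint: "(\<lambda>(\<omega>, l2). ennreal ((cmod (\<phi> (\<zeta> - l2) \<omega>))\<^sup>2)) \<in> borel_measurable (P \<Otimes>\<^sub>M count_space \<Lambda>\<^sub>2)" for \<zeta>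
    by (subst measurable_pair_swap_iff) (simp add: split_beta')
  have "(\<lambda>\<omega>. \<integral>\<^sup>+l2. ennreal ((cmod (\<phi> (\<zeta> - l2) \<omega>))\<^sup>2) \<partial>count_space \<Lambda>\<^sub>2) \<in> borel_measurable P"
    by (rule c.M2.borel_measurable_nn_integral[OF joint])
  then show "(\<lambda>\<omega>. fourier_sum (\<mu>\<^sub>\<omega> \<omega>) \<Lambda>\<^sub>2 \<zeta>) \<in> borel_measurable P"
    by (subst measurable_cong[OF cong])
  let ?f = "\<lambda>l1 l2. ennreal ((cmod (fourier \<mu> (\<xi> - block_vec l1 l2)))\<^sup>2)"
  have "block_Times \<Lambda>\<^sub>1 \<Lambda>\<^sub>2 = (\<lambda>(l1, l2). block_vec l1 l2) ` (\<Lambda>\<^sub>1 \<times> \<Lambda>\<^sub>2)"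
    by (auto simp: block_Times_def)
  then have bij: "bij_betw (\<lambda>(l1, l2). block_vec l1 l2) (\<Lambda>\<^sub>1 \<times> \<Lambda>\<^sub>2) (block_Times \<Lambda>\<^sub>1 \<Lambda>\<^sub>2)"
    by (auto simp: bij_betw_def inj_on_def block_eq_iff)
  have "fourier_sum \<mu> (block_Times \<Lambda>\<^sub>1 \<Lambda>\<^sub>2) \<xi> = (\<integral>\<^sup>+p. ?f (fst p) (snd p) \<partial>count_space (\<Lambda>\<^sub>1 \<times> \<Lambda>\<^sub>2))"
    unfolding fourier_sum_def by (subst nn_integral_bij_count_space[OF bij, symmetric]) (simp add: split_beta')
  also have "\<dots> = (\<integral>\<^sup>+p. ?f (fst p) (snd p) \<partial>(count_space \<Lambda>\<^sub>1 \<Otimes>\<^sub>M count_space \<Lambda>\<^sub>2))"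
    using count count1 by (simp add: pair_measure_countable)
  also have "\<dots> = (\<integral>\<^sup>+l2. \<integral>\<^sup>+l1. ?f l1 l2 \<partial>count_space \<Lambda>\<^sub>1 \<partial>count_space \<Lambda>\<^sub>2)"
    by (subst c.nn_integral_snd[symmetric]) (use count count1 in \<open>auto simp: pair_measure_countable\<close>)
  also have "\<dots> = (\<integral>\<^sup>+l2. \<integral>\<^sup>+\<omega>. ennreal ((cmod (\<phi> (snd_block \<xi> - l2) \<omega>))\<^sup>2) \<partial>P \<partial>count_space \<Lambda>\<^sub>2)"
  proof (rule nn_integral_cong)
    fix l2
    define u where "u \<omega> = expo (fst_block \<xi>) (F \<omega>) * expo (snd_block \<xi> - l2) (snd_block (X \<omega>)) * \<phi> (snd_block \<xi> - l2) \<omega>" for \<omega>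
    have [measurable]: "u \<in> borel_measurable P" unfolding u_def[abs_def] by measurable
    have "fourier \<mu> (\<xi> - block_vec l1 l2) = (LINT \<omega>|P. u \<omega> * cnj (expo l1 (F \<omega>)))" for l1
    proof -
      have e: "expo (fst_block \<xi> - l1) x = expo (fst_block \<xi>) x * cnj (expo l1 x)" for x
        by (simp add: expo_mult_cnj)
      show ?thesis unfolding fourier_\<mu> u_def by (simp add: e mult_ac)
    qed
    then have "(\<integral>\<^sup>+l1. ?f l1 l2 \<partial>count_space \<Lambda>\<^sub>1)
      = (\<integral>\<^sup>+l1. ennreal ((cmod (LINT \<omega>|P. u \<omega> * cnj (expo l1 (F \<omega>))))\<^sup>2) \<partial>count_space \<Lambda>\<^sub>1)" by simp
    also have "\<dots> = (\<integral>\<^sup>+\<omega>. ennreal ((cmod (u \<omega>))\<^sup>2) \<partial>P)"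
      by (rule parseval_decoded[OF spec, where b = 1]) (auto simp: u_def norm_mult norm_\<phi>)
    also have "\<dots> = (\<integral>\<^sup>+\<omega>. ennreal ((cmod (\<phi> (snd_block \<xi> - l2) \<omega>))\<^sup>2) \<partial>P)"
      by (simp add: u_def norm_mult)
    finally show "(\<integral>\<^sup>+l1. ?f l1 l2 \<partial>count_space \<Lambda>\<^sub>1) = (\<integral>\<^sup>+\<omega>. ennreal ((cmod (\<phi> (snd_block \<xi> - l2) \<omega>))\<^sup>2) \<partial>P)" .
  qed
  also have "\<dots> = (\<integral>\<^sup>+\<omega>. \<integral>\<^sup>+l2. ennreal ((cmod (\<phi> (snd_block \<xi> - l2) \<omega>))\<^sup>2) \<partial>count_space \<Lambda>\<^sub>2 \<partial>P)"
    by (rule Pc.Fubini'[OF joint])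
  also have "\<dots> = (\<integral>\<^sup>+\<omega>. fourier_sum (\<mu>\<^sub>\<omega> \<omega>) \<Lambda>\<^sub>2 (snd_block \<xi>) \<partial>P)"
    by (rule nn_integral_cong) (rule cong[symmetric])
  finally show "fourier_sum \<mu> (block_Times \<Lambda>\<^sub>1 \<Lambda>\<^sub>2) \<xi> = (\<integral>\<^sup>+\<omega>. fourier_sum (\<mu>\<^sub>\<omega> \<omega>) \<Lambda>\<^sub>2 (snd_block \<xi>) \<partial>P)" .
qed

section \<open>The two implications\<close>

lemma spectrum_\<mu>_if:
  assumes spec: "is_spectrum \<Lambda>\<^sub>1 \<mu>\<^sub>1" and AE: "AE \<omega> in P. is_spectrum \<Lambda>\<^sub>2 (\<mu>\<^sub>\<omega> \<omega>)"
  shows "is_spectrum (block_Times \<Lambda>\<^sub>1 \<Lambda>\<^sub>2) \<mu>"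
proof -
  interpret \<mu>: borel_prob "\<mu>" by (rule borel_prob_\<mu>)
  obtain K where K: "AE x in \<mu>. norm x \<le> K" by (rule AE_bounded)
  \<comment> \<open>Countability does not depend on \<omega>, so a single good \<omega> supplies
    it.\<close>
  have "\<exists>\<omega>\<in>space P. is_spectrum \<Lambda>\<^sub>2 (\<mu>\<^sub>\<omega> \<omega>)"
  proof (rule ccontr)
    assume "\<not> ?thesis"
    then have no: "\<not> is_spectrum \<Lambda>\<^sub>2 (\<mu>\<^sub>\<omega> \<omega>)" if "\<omega> \<in> space P" for \<omega> using that by blast
    have "AE \<omega> in P. False" using AE AE_space by eventually_elim (use no in blast)
    then show False by simp
  qed
  then have count: "countable \<Lambda>\<^sub>2" by (auto simp: is_spectrum_def)
  have "block_Times \<Lambda>\<^sub>1 \<Lambda>\<^sub>2 = (\<lambda>(x, y). block_vec x y) ` (\<Lambda>\<^sub>1 \<times> \<Lambda>\<^sub>2)" by (auto simp: block_Times_def)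
  then have c: "countable (block_Times \<Lambda>\<^sub>1 \<Lambda>\<^sub>2)" using count spec by (simp add: is_spectrum_def)
  have sum: "fourier_sum \<mu> (block_Times \<Lambda>\<^sub>1 \<Lambda>\<^sub>2) \<xi> = 1" for \<xi>
  proof -
    have "AE \<omega> in P. fourier_sum (\<mu>\<^sub>\<omega> \<omega>) \<Lambda>\<^sub>2 (snd_block \<xi>) = 1"
      using AE AE_space by eventually_elim (rule borel_prob.fourier_sum_spectrum[OF borel_prob_\<mu>\<^sub>\<omega>])
    then have "(\<integral>\<^sup>+\<omega>. fourier_sum (\<mu>\<^sub>\<omega> \<omega>) \<Lambda>\<^sub>2 (snd_block \<xi>) \<partial>P) = (\<integral>\<^sup>+\<omega>. 1 \<partial>P)"
      by (rule nn_integral_cong_AE)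
    then show ?thesis unfolding fourier_sum_\<mu>(1)[OF spec count] by (simp add: P.emeasure_space_1)
  qed
  show ?thesis by (rule \<mu>.is_spectrumI[OF K c sum closure_UNIV sum])
qed

lemma AE_spectrum_if:
  assumes spec: "is_spectrum \<Lambda>\<^sub>1 \<mu>\<^sub>1" and spec\<mu>: "is_spectrum (block_Times \<Lambda>\<^sub>1 \<Lambda>\<^sub>2) \<mu>"
  shows "AE \<omega> in P. is_spectrum \<Lambda>\<^sub>2 (\<mu>\<^sub>\<omega> \<omega>)"
proof -
  interpret \<mu>\<^sub>1: borel_prob "\<mu>\<^sub>1" by (rule borel_prob_\<mu>\<^sub>1)
  interpret \<mu>: borel_prob "\<mu>" by (rule borel_prob_\<mu>)
  obtain K where K: "\<And>\<omega>. \<omega> \<in> space P \<Longrightarrow> AE x in \<mu>\<^sub>\<omega> \<omega>. norm x \<le> K"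
    using AE_bounded by blast
  \<comment> \<open>An empty set would have Fourier sum 0. With a point in the first factor, the
    second factor is a projection of the countable product.\<close>
  have "\<Lambda>\<^sub>1 \<noteq> {}"
    using \<mu>\<^sub>1.fourier_sum_spectrum[OF spec, of 0]
    by (auto simp: fourier_sum_def nn_integral_count_space_finite)
  then have "\<Lambda>\<^sub>2 \<subseteq> snd_block ` block_Times \<Lambda>\<^sub>1 \<Lambda>\<^sub>2"
    by (force simp: block_Times_def image_iff)
  moreover have "countable (block_Times \<Lambda>\<^sub>1 \<Lambda>\<^sub>2)" using spec\<mu> by (simp add: is_spectrum_def)
  ultimately have count: "countable \<Lambda>\<^sub>2" by (meson countable_image countable_subset)
  have one: "(\<integral>\<^sup>+\<omega>. fourier_sum (\<mu>\<^sub>\<omega> \<omega>) \<Lambda>\<^sub>2 \<zeta> \<partial>P) = 1" for \<zeta>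
    using \<mu>.fourier_sum_spectrum[OF spec\<mu>, of "block_vec 0 \<zeta>"] fourier_sum_\<mu>(1)[OF spec count, of "block_vec 0 \<zeta>"]
    by simp
  note meas = fourier_sum_\<mu>(2)[OF spec count]
  have "AE \<omega> in P. fourier_sum (\<mu>\<^sub>\<omega> \<omega>) \<Lambda>\<^sub>2 l = 1" if "l \<in> \<Lambda>\<^sub>2" for l
    by (rule P.AE_eq_1_if_ge[OF meas _ one]) (rule borel_prob.fourier_sum_ge_1[OF borel_prob_\<mu>\<^sub>\<omega> that])
  then have AE\<Lambda>: "AE \<omega> in P. \<forall>l\<in>\<Lambda>\<^sub>2. fourier_sum (\<mu>\<^sub>\<omega> \<omega>) \<Lambda>\<^sub>2 l = 1"
    using count by (simp add: AE_ball_countable)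
  \<comment> \<open>The exceptional null set depends on \<zeta>; a countable dense set lets them be
    united.\<close>
  obtain D :: "(real ^ 'd) set" where D: "countable D" "\<And>S. open S \<Longrightarrow> S \<noteq> {} \<Longrightarrow> \<exists>x\<in>D. x \<in> S"
    using countable_dense_setE by blast
  have cl: "closure D = UNIV"
    using D(2)[of "- closure D"] closure_subset[of D] by blast
  have "AE \<omega> in P. fourier_sum (\<mu>\<^sub>\<omega> \<omega>) \<Lambda>\<^sub>2 \<zeta> = 1" for \<zeta>
  proof (rule P.AE_eq_1_if_le[OF meas _ one])
    show "AE \<omega> in P. fourier_sum (\<mu>\<^sub>\<omega> \<omega>) \<Lambda>\<^sub>2 \<zeta> \<le> 1"
      using AE\<Lambda> AE_space
    proof eventually_elim
      case (elim \<omega>)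
      interpret \<omega>: borel_prob "\<mu>\<^sub>\<omega> \<omega>" by (rule borel_prob_\<mu>\<^sub>\<omega>) fact
      from elim(1) show ?case by (intro \<omega>.fourier_sum_le_1 \<omega>.orthogonal_exponentsI count) auto
    qed
  qed
  then have "AE \<omega> in P. \<forall>\<zeta>\<in>D. fourier_sum (\<mu>\<^sub>\<omega> \<omega>) \<Lambda>\<^sub>2 \<zeta> = 1"
    using D(1) by (simp add: AE_ball_countable)
  then show ?thesis using AE\<Lambda> AE_space
  proof eventually_elim
    case (elim \<omega>)
    interpret \<omega>: borel_prob "\<mu>\<^sub>\<omega> \<omega>" by (rule borel_prob_\<mu>\<^sub>\<omega>) fact
    show ?case by (rule \<omega>.is_spectrumI[OF K[OF elim(3)] count _ cl]) (use elim in auto)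
  qed
qed

end

theorem theorem1p4:
  fixes N M :: nat
    and R :: "int ^ 'd ^ 'd" and B :: "nat \<Rightarrow> (int ^ 'd) set" and L :: "(int ^ 'd) set"
    and RR :: "int ^ ('r::finite + 'd::finite) ^ ('r::finite + 'd::finite)" and BB LL :: "(int ^ ('r::finite + 'd::finite)) set"
    and R\<^sub>1 :: "int ^ 'r ^ 'r" and B\<^sub>1 L\<^sub>1 :: "(int ^ 'r) set"
    and \<Lambda>\<^sub>1 :: "(real ^ 'r) set" and \<Lambda>\<^sub>2 :: "(real ^ 'd) set"
  assumes "\<And>i. i \<in> {1..N} \<Longrightarrow> hadamard_triple R (B i) L"
    and "\<And>i. i \<in> {1..N} \<Longrightarrow> card (B i) = M"
    and "quasi_product_form RR BB LL N M R B L R\<^sub>1 B\<^sub>1 L\<^sub>1"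
    and "is_spectrum \<Lambda>\<^sub>1 (self_affine_measure R\<^sub>1 B\<^sub>1)"
  shows "is_spectrum (block_Times \<Lambda>\<^sub>1 \<Lambda>\<^sub>2) (self_affine_measure RR BB) \<longleftrightarrow>
    (AE \<omega> in symbol_measure N. is_spectrum \<Lambda>\<^sub>2 (random_convolution R B \<omega>))"
proof -
  from assms(3) obtain E a d where RR: "RR = lower_block_matrix R\<^sub>1 E R"
    and a: "inj_on a {1..N}" "B\<^sub>1 = a ` {1..N}"
    and B: "\<And>i. i \<in> {1..N} \<Longrightarrow> B i = d i ` {1..M}"
    and BB: "BB = {block_vec (a i) (d i j) | i j. i \<in> {1..N} \<and> j \<in> {1..M}}"
    and h: "hadamard_triple R\<^sub>1 B\<^sub>1 L\<^sub>1"
    unfolding quasi_product_form_def by blast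
  \<comment> \<open>The digit set contains 0, so its index set is not empty; this makes symbol 1
    available for the bound on \<open>M\<close>.\<close>
  have N: "N \<ge> 1" using h a(2) by (auto simp: hadamard_triple_def)
  have M: "M \<ge> 1" and R: "expansive R"
    using assms(1)[of 1] assms(2)[of 1] N by (auto simp: hadamard_triple_def Suc_le_eq card_gt_0_iff)
  interpret quasi_product R\<^sub>1 a N R E d M
  proof
    show "expansive R\<^sub>1" using h by (simp add: hadamard_triple_def)
    show "i = j" if "i \<in> {1..N}" "j \<in> {1..N}" "a i - a j = R\<^sub>1 *v z" for i j z
      using hadamard_triple_residues[OF h _ _ that(3)] that a by (auto dest: inj_onD)
    \<comment> \<open>The image of \<open>M\<close> indices has cardinality \<open>M\<close>, so no
      digit is repeated.\<close>
    show "inj_on (d i) {1..M}" if "i \<in> {1..N}" for i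
      using assms(2)[OF that] B[OF that] by (intro eq_card_imp_inj_on) auto
  qed (fact N M R)+
  \<comment> \<open>The digit sets agree with the enumerated ones at symbols in
    \<open>{1..N}\<close>, and sequences in the space use no others.\<close>
  have "random_convolution R B \<omega> = random_convolution R (\<lambda>i. d i ` {1..M}) \<omega>"
    if "\<omega> \<in> space (symbol_measure N)" for \<omega>
    using that B unfolding random_convolution_def by (simp add: space_P)
  then have "(AE \<omega> in symbol_measure N. is_spectrum \<Lambda>\<^sub>2 (random_convolution R B \<omega>)) \<longleftrightarrow>
      (AE \<omega> in symbol_measure N. is_spectrum \<Lambda>\<^sub>2 (random_convolution R (\<lambda>i. d i ` {1..M}) \<omega>))"
    by (intro AE_cong) simp
  then show ?thesis
    using spectrum_\<mu>_if AE_spectrum_if assms(4) unfolding RR BB a(2) by blast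
qed

end
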